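(* Let $H$ be a separable Hilbert space, $(S,\Sigma,\nu)$ a $\sigma$-finite measure space and $\mathcal{M}=L_\infty(\nu)\overline{\otimes}B(H)$, acting on $L_2(\nu;H)$. The map $f\mapsto x_f$, $f\in L_0^{wo}(\nu;B(H))$, is a unital $*$-isomorphism from $L_0^{wo}(\nu;B(H))$ onto $LS(\mathcal{M})$.
   Context: Hilbert spaces are complex; measure spaces are complete. $B(H)$ is the algebra of bounded linear operators on $H$. $L_0^{wo}(\nu;B(H))$ is the unital $*$-algebra (pointwise operations) of $\nu$-a.e. equivalence classes of functions $f:S\to B(H)$ such that $s\mapsto\langle f(s)\xi,\eta\rangle$ is $\nu$-measurable for all $\xi,\eta\in H$; $L_\infty^{wo}(\nu;B(H))$ consists of the essentially bounded ones. The Hilbert space tensor product $L_2(\nu)\overline{\otimes}H$ is identified with the Bochner space $L_2(\nu;H)$, and the von Neumann algebra tensor product $\mathcal{M}=L_\infty(\nu)\overline{\otimes}B(H)$ is identified with $L_\infty^{wo}(\nu;B(H))$ acting on $L_2(\nu;H)$ by $(fF)(s)=f(s)F(s)$. For $f\in L_0^{wo}(\nu;B(H))$, $x_f$ is the operator in $L_2(\nu;H)$ with domain $\mathfrak{D}(x_f)=\{F\in L_2(\nu;H):fF\in L_2(\nu;H)\}$ and $x_fF=fF$, where $(fF)(s)=f(s)F(s)$. For a von Neumann algebra $\mathcal{M}$ on a Hilbert space $K$: $P(\mathcal{M})$ is the set of self-adjoint projections in $\mathcal{M}$, $\mathcal{M}'$ the commutant, $\mathcal{Z}(\mathcal{M})$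 the center. A linear operator $x:\mathfrak{D}(x)\to K$ is affiliated with $\mathcal{M}$ if $yx\subseteq xy$ for all $y\in\mathcal{M}'$. A closed densely defined $x$ affiliated with $\mathcal{M}$ is measurable ($x\in S(\mathcal{M})$) if there is a sequence $p_n\in P(\mathcal{M})$ with $p_n\uparrow\mathbf 1$, $p_n(K)\subseteq\mathfrak{D}(x)$ and $p_n^\perp=\mathbf 1-p_n$ finite (with respect to $\mathcal{M}$) for all $n$. It is locally measurable ($x\in LS(\mathcal{M})$) if there is a sequence $p_n\in P(\mathcal{Z}(\mathcal{M}))$ with $p_n\uparrow\mathbf 1$ and $xp_n\in S(\mathcal{M})$ for all $n$. $LS(\mathcal{M})$ is a unital $*$-algebra with respect to strong sum and strong product (closures of the algebraic sum and product). *)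

theory Defs
  imports
    "HOL-Analysis.Analysis"
    "HOL-Algebra.QuotRing"
    "HOL-Algebra.Algebraic_Closure_Type"
begin

section \<open>Complex Hilbert spaces and bounded operators\<close>

text \<open>The inner product is linear in the first argument.\<close>

class complex_hilbert = banach +
  fixes scaleC :: "complex \<Rightarrow> 'a \<Rightarrow> 'a" (infixr \<open>*\<^sub>C\<close> 75)
    and cinner :: "'a \<Rightarrow> 'a \<Rightarrow> complex"
  assumes scaleC_add_right: "c *\<^sub>C (x + y) = c *\<^sub>C x + c *\<^sub>C y"
    and scaleC_add_left: "(c + d) *\<^sub>C x = c *\<^sub>C x + d *\<^sub>C x"
    and scaleC_scaleC: "c *\<^sub>C d *\<^sub>C x = (c * d) *\<^sub>C x"
    and scaleR_scaleC: "r *\<^sub>R x = complex_of_real r *\<^sub>C x"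
    and cinner_commute: "cinner x y = cnj (cinner y x)"
    and cinner_add_left: "cinner (x + y) z = cinner x z + cinner y z"
    and cinner_scaleC_left: "cinner (c *\<^sub>C x) y = c * cinner x y"
    and cinner_self: "cinner x x = complex_of_real ((norm x)\<^sup>2)"

instantiation complex :: complex_hilbert
begin

definition scaleC_complex :: "complex \<Rightarrow> complex \<Rightarrow> complex"
  where "scaleC_complex c x = c * x"

definition cinner_complex :: "complex \<Rightarrow> complex \<Rightarrow> complex"
  where "cinner_complex x y = x * cnj y"

instance
  by standard
    (simp_all add: scaleC_complex_def cinner_complex_def algebra_simps scaleR_conv_of_real
      complex_norm_square[symmetric])

end

text \<open>
  The library type of bounded operators is the type of bounded real-linear maps; B(H) is the
  set of its complex-linear elements.
\<close>

definition BH :: "('h::complex_hilbert \<Rightarrow>\<^sub>L 'h) set"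
  where "BH = {a. \<forall>c \<xi>. blinfun_apply a (c *\<^sub>C \<xi>) = c *\<^sub>C blinfun_apply a \<xi>}"

definition BH_scale :: "complex \<Rightarrow> ('h::complex_hilbert \<Rightarrow>\<^sub>L 'h) \<Rightarrow> ('h \<Rightarrow>\<^sub>L 'h)"
  where "BH_scale c a = Blinfun (\<lambda>\<xi>. c *\<^sub>C blinfun_apply a \<xi>)"

definition BH_adj :: "('h::complex_hilbert \<Rightarrow>\<^sub>L 'h) \<Rightarrow> ('h \<Rightarrow>\<^sub>L 'h)"
  where "BH_adj a =
    (THE b. \<forall>\<xi> \<eta>. cinner (blinfun_apply a \<xi>) \<eta> = cinner \<xi> (blinfun_apply b \<eta>))"

section \<open>Unital *-algebras\<close>

record 'a star_algebra = "(complex, 'a) module" +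
  star :: "'a \<Rightarrow> 'a"

locale unital_star_algebra = ring A + module "ring_of_type_algebra :: complex ring" A
  for A :: "('a, 'm) star_algebra_scheme" (structure) +
  assumes smult_mult_left:
      "x \<in> carrier A \<Longrightarrow> y \<in> carrier A \<Longrightarrow> (c \<odot> x) \<otimes> y = c \<odot> (x \<otimes> y)"
    and smult_mult_right:
      "x \<in> carrier A \<Longrightarrow> y \<in> carrier A \<Longrightarrow> x \<otimes> (c \<odot> y) = c \<odot> (x \<otimes> y)"
    and star_closed: "x \<in> carrier A \<Longrightarrow> star A x \<in> carrier A"
    and star_star: "x \<in> carrier A \<Longrightarrow> star A (star A x) = x"
    and star_add:
      "x \<in> carrier A \<Longrightarrow> y \<in> carrier A \<Longrightarrow> star A (x \<oplus> y) = star A x \<oplus> star A y"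
    and star_smult: "x \<in> carrier A \<Longrightarrow> star A (c \<odot> x) = cnj c \<odot> star A x"
    and star_mult:
      "x \<in> carrier A \<Longrightarrow> y \<in> carrier A \<Longrightarrow> star A (x \<otimes> y) = star A y \<otimes> star A x"

definition unital_star_isomorphism ::
    "('a, 'm) star_algebra_scheme \<Rightarrow> ('b, 'n) star_algebra_scheme \<Rightarrow> ('a \<Rightarrow> 'b) \<Rightarrow> bool"
  where "unital_star_isomorphism A B h \<longleftrightarrow>
    unital_star_algebra A \<and> unital_star_algebra B \<and>
    h \<in> ring_iso A B \<and>
    (\<forall>c. \<forall>x\<in>carrier A. h (c \<odot>\<^bsub>A\<^esub> x) = c \<odot>\<^bsub>B\<^esub> h x) \<and>
    (\<forall>x\<in>carrier A. h (star A x) = star B (h x))"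

section \<open>Unbounded operators in a Hilbert space\<close>

text \<open>
  The space \<open>L\<^sub>2(\<nu>;H)\<close> depends on the measure \<open>\<nu>\<close>, hence is not a type; operator theory is
  therefore set up over a Hilbert space given by its carrier set and operations.
\<close>

record 'a hilbert_space =
  hcarrier :: "'a set"
  hzero :: 'a
  hadd :: "'a \<Rightarrow> 'a \<Rightarrow> 'a"
  hscale :: "complex \<Rightarrow> 'a \<Rightarrow> 'a"
  hinner :: "'a \<Rightarrow> 'a \<Rightarrow> complex"

definition hnorm :: "'a hilbert_space \<Rightarrow> 'a \<Rightarrow> real"
  where "hnorm K a = sqrt (Re (hinner K a a))"

definition hdist :: "'a hilbert_space \<Rightarrow> 'a \<Rightarrow> 'a \<Rightarrow> real"
  where "hdist K a b = hnorm K (hadd K a (hscale K (- 1) b))"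

definition hconv :: "'a hilbert_space \<Rightarrow> (nat \<Rightarrow> 'a) \<Rightarrow> 'a \<Rightarrow> bool"
  where "hconv K u a \<longleftrightarrow> (\<lambda>n. hdist K (u n) a) \<longlonglongrightarrow> 0"

text \<open>
  An operator is identified with its graph, a set of pairs (argument, value). Thus the domain
  is \<^const>\<open>Domain\<close>, extension of operators is set inclusion, and the product \<open>x y\<close> (first \<open>y\<close>,
  then \<open>x\<close>) is the relation composition \<open>y O x\<close>.
\<close>

type_synonym 'a operator = "('a \<times> 'a) set"

definition linear_operator :: "'a hilbert_space \<Rightarrow> 'a operator \<Rightarrow> bool"
  where "linear_operator K x \<longleftrightarrow>
    x \<subseteq> hcarrier K \<times> hcarrier K \<and> single_valued x \<and> (hzero K, hzero K) \<in> x \<and>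
    (\<forall>a b a' b'. (a, b) \<in> x \<longrightarrow> (a', b') \<in> x \<longrightarrow> (hadd K a a', hadd K b b') \<in> x) \<and>
    (\<forall>c a b. (a, b) \<in> x \<longrightarrow> (hscale K c a, hscale K c b) \<in> x)"

definition densely_defined :: "'a hilbert_space \<Rightarrow> 'a operator \<Rightarrow> bool"
  where "densely_defined K x \<longleftrightarrow>
    (\<forall>a\<in>hcarrier K. \<forall>e>0. \<exists>b\<in>Domain x. hdist K b a < e)"

definition op_closure :: "'a hilbert_space \<Rightarrow> 'a operator \<Rightarrow> 'a operator"
  where "op_closure K x = {(a, b). a \<in> hcarrier K \<and> b \<in> hcarrier K \<and>
    (\<exists>u v. (\<forall>n. (u n, v n) \<in> x) \<and> hconv K u a \<and> hconv K v b)}"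

definition closed_operator :: "'a hilbert_space \<Rightarrow> 'a operator \<Rightarrow> bool"
  where "closed_operator K x \<longleftrightarrow> op_closure K x \<subseteq> x"

definition op_one :: "'a hilbert_space \<Rightarrow> 'a operator"
  where "op_one K = Id_on (hcarrier K)"

definition op_zero :: "'a hilbert_space \<Rightarrow> 'a operator"
  where "op_zero K = hcarrier K \<times> {hzero K}"

definition op_add :: "'a hilbert_space \<Rightarrow> 'a operator \<Rightarrow> 'a operator \<Rightarrow> 'a operator"
  where "op_add K x y = {(a, hadd K b c) | a b c. (a, b) \<in> x \<and> (a, c) \<in> y}"

definition op_scale :: "'a hilbert_space \<Rightarrow> complex \<Rightarrow> 'a operator \<Rightarrow> 'a operator"
  where "op_scale K c x = {(a, hscale K c b) | a b. (a, b) \<in> x}"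

definition op_adj :: "'a hilbert_space \<Rightarrow> 'a operator \<Rightarrow> 'a operator"
  where "op_adj K x = {(b, c). b \<in> hcarrier K \<and> c \<in> hcarrier K \<and>
    (\<forall>(a, d)\<in>x. hinner K d b = hinner K a c)}"

definition bounded_operators :: "'a hilbert_space \<Rightarrow> 'a operator set"
  where "bounded_operators K = {x. linear_operator K x \<and> Domain x = hcarrier K \<and>
    (\<exists>C. \<forall>(a, b)\<in>x. hnorm K b \<le> C * hnorm K a)}"

section \<open>Von Neumann algebras and locally measurable operators\<close>

definition commutant :: "'a hilbert_space \<Rightarrow> 'a operator set \<Rightarrow> 'a operator set"
  where "commutant K M = {y \<in> bounded_operators K. \<forall>x\<in>M. x O y = y O x}"

text \<open>
  For a set \<open>G\<close> closed under adjoints, the double commutant is the von Neumann algebra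
  generated by \<open>G\<close>.
\<close>

definition generated_vN :: "'a hilbert_space \<Rightarrow> 'a operator set \<Rightarrow> 'a operator set"
  where "generated_vN K G = commutant K (commutant K G)"

definition center :: "'a hilbert_space \<Rightarrow> 'a operator set \<Rightarrow> 'a operator set"
  where "center K M = M \<inter> commutant K M"

definition projections :: "'a hilbert_space \<Rightarrow> 'a operator set \<Rightarrow> 'a operator set"
  where "projections K M = {p \<in> M. p \<in> bounded_operators K \<and> p O p = p \<and> op_adj K p = p}"

definition proj_le :: "'a operator \<Rightarrow> 'a operator \<Rightarrow> bool"
  where "proj_le p q \<longleftrightarrow> Range p \<subseteq> Range q"

definition proj_perp :: "'a hilbert_space \<Rightarrow> 'a operator \<Rightarrow> 'a operator"
  where "proj_perp K p = op_add K (op_one K) (op_scale K (- 1) p)"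

text \<open>\<open>p\<^sub>n \<up> 1\<close>: the sequence is increasing and its supremum among all projections is 1.\<close>

definition increases_to_one :: "'a hilbert_space \<Rightarrow> (nat \<Rightarrow> 'a operator) \<Rightarrow> bool"
  where "increases_to_one K p \<longleftrightarrow>
    (\<forall>n. proj_le (p n) (p (Suc n))) \<and>
    (\<forall>q\<in>projections K (bounded_operators K). (\<forall>n. proj_le (p n) q) \<longrightarrow> q = op_one K)"

text \<open>Murray-von Neumann equivalence: \<open>v\<^sup>* v = p\<close> and \<open>v v\<^sup>* = q\<close>.\<close>

definition proj_equiv ::
    "'a hilbert_space \<Rightarrow> 'a operator set \<Rightarrow> 'a operator \<Rightarrow> 'a operator \<Rightarrow> bool"
  where "proj_equiv K M p q \<longleftrightarrow> (\<exists>v\<in>M. v O op_adj K v = p \<and> op_adj K v O v = q)"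

definition finite_projection ::
    "'a hilbert_space \<Rightarrow> 'a operator set \<Rightarrow> 'a operator \<Rightarrow> bool"
  where "finite_projection K M p \<longleftrightarrow> p \<in> projections K M \<and>
    (\<forall>q\<in>projections K M. proj_le q p \<longrightarrow> proj_equiv K M p q \<longrightarrow> q = p)"

definition affiliated :: "'a hilbert_space \<Rightarrow> 'a operator set \<Rightarrow> 'a operator \<Rightarrow> bool"
  where "affiliated K M x \<longleftrightarrow>
    linear_operator K x \<and> (\<forall>y\<in>commutant K M. x O y \<subseteq> y O x)"

definition closed_dense_affiliated ::
    "'a hilbert_space \<Rightarrow> 'a operator set \<Rightarrow> 'a operator \<Rightarrow> bool"
  where "closed_dense_affiliated K M x \<longleftrightarrow>
    affiliated K M x \<and> closed_operator K x \<and> densely_defined K x"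

definition measurable_operators ::
    "'a hilbert_space \<Rightarrow> 'a operator set \<Rightarrow> 'a operator set"
  where "measurable_operators K M = {x. closed_dense_affiliated K M x \<and>
    (\<exists>p. (\<forall>n. p n \<in> projections K M) \<and> increases_to_one K p \<and>
      (\<forall>n. Range (p n) \<subseteq> Domain x \<and> finite_projection K M (proj_perp K (p n))))}"

definition locally_measurable_operators ::
    "'a hilbert_space \<Rightarrow> 'a operator set \<Rightarrow> 'a operator set"
  where "locally_measurable_operators K M = {x. closed_dense_affiliated K M x \<and>
    (\<exists>p. (\<forall>n. p n \<in> projections K (center K M)) \<and> increases_to_one K p \<and>
      (\<forall>n. p n O x \<in> measurable_operators K M))}"

text \<open>
  Strong operations. The closure in the scalar multiplication matters for the scalar 0 only.
\<close>

definition LS_algebra ::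
    "'a hilbert_space \<Rightarrow> 'a operator set \<Rightarrow> 'a operator star_algebra"
  where "LS_algebra K M = \<lparr>
    carrier = locally_measurable_operators K M,
    monoid.mult = (\<lambda>x y. op_closure K (y O x)),
    one = op_one K,
    zero = op_zero K,
    add = (\<lambda>x y. op_closure K (op_add K x y)),
    smult = (\<lambda>c x. op_closure K (op_scale K c x)),
    star = op_adj K\<rparr>"

section \<open>Almost everywhere equivalence classes\<close>

definition ae_rel :: "'s measure \<Rightarrow> ('s \<Rightarrow> 'b) set \<Rightarrow> (('s \<Rightarrow> 'b) \<times> ('s \<Rightarrow> 'b)) set"
  where "ae_rel \<nu> V = {(f, g). f \<in> V \<and> g \<in> V \<and> (AE s in \<nu>. f s = g s)}"

definition ae_class :: "'s measure \<Rightarrow> ('s \<Rightarrow> 'b) set \<Rightarrow> ('s \<Rightarrow> 'b) \<Rightarrow> ('s \<Rightarrow> 'b) set"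
  where "ae_class \<nu> V f = ae_rel \<nu> V `` {f}"

definition rep :: "'b set \<Rightarrow> 'b"
  where "rep A = (SOME f. f \<in> A)"

text \<open>
  Square integrable Bochner measurable functions; since \<open>H\<close> is separable, strong
  measurability is Borel measurability.
\<close>

definition L2_functions ::
    "'s measure \<Rightarrow> ('s \<Rightarrow> 'h::{complex_hilbert, second_countable_topology}) set"
  where "L2_functions \<nu> = {F \<in> borel_measurable \<nu>. integrable \<nu> (\<lambda>s. (norm (F s))\<^sup>2)}"

abbreviation L2_class ::
    "'s measure \<Rightarrow> ('s \<Rightarrow> 'h::{complex_hilbert, second_countable_topology}) \<Rightarrow> ('s \<Rightarrow> 'h) set"
  where "L2_class \<nu> \<equiv> ae_class \<nu> (L2_functions \<nu>)"

definition L2_space ::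
    "'s measure \<Rightarrow> ('s \<Rightarrow> 'h::{complex_hilbert, second_countable_topology}) set hilbert_space"
  where "L2_space \<nu> = \<lparr>
    hcarrier = L2_functions \<nu> // ae_rel \<nu> (L2_functions \<nu>),
    hzero = L2_class \<nu> (\<lambda>s. 0),
    hadd = (\<lambda>A B. L2_class \<nu> (\<lambda>s. rep A s + rep B s)),
    hscale = (\<lambda>c A. L2_class \<nu> (\<lambda>s. c *\<^sub>C rep A s)),
    hinner = (\<lambda>A B. integral\<^sup>L \<nu> (\<lambda>s. cinner (rep A s) (rep B s)))\<rparr>"

definition L0wo_functions :: "'s measure \<Rightarrow> ('s \<Rightarrow> 'h::complex_hilbert \<Rightarrow>\<^sub>L 'h) set"
  where "L0wo_functions \<nu> = {f. (\<forall>s\<in>space \<nu>. f s \<in> BH) \<and>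
    (\<forall>\<xi> \<eta>. (\<lambda>s. cinner (blinfun_apply (f s) \<xi>) \<eta>) \<in> borel_measurable \<nu>)}"

abbreviation L0wo_class ::
    "'s measure \<Rightarrow> ('s \<Rightarrow> 'h::complex_hilbert \<Rightarrow>\<^sub>L 'h) \<Rightarrow> ('s \<Rightarrow> 'h \<Rightarrow>\<^sub>L 'h) set"
  where "L0wo_class \<nu> \<equiv> ae_class \<nu> (L0wo_functions \<nu>)"

definition L0wo_algebra ::
    "'s measure \<Rightarrow> ('s \<Rightarrow> 'h::complex_hilbert \<Rightarrow>\<^sub>L 'h) set star_algebra"
  where "L0wo_algebra \<nu> = \<lparr>
    carrier = L0wo_functions \<nu> // ae_rel \<nu> (L0wo_functions \<nu>),
    monoid.mult = (\<lambda>A B. L0wo_class \<nu> (\<lambda>s. rep A s o\<^sub>L rep B s)),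
    one = L0wo_class \<nu> (\<lambda>s. id_blinfun),
    zero = L0wo_class \<nu> (\<lambda>s. 0),
    add = (\<lambda>A B. L0wo_class \<nu> (\<lambda>s. rep A s + rep B s)),
    smult = (\<lambda>c A. L0wo_class \<nu> (\<lambda>s. BH_scale c (rep A s))),
    star = (\<lambda>A. L0wo_class \<nu> (\<lambda>s. BH_adj (rep A s)))\<rparr>"

section \<open>Multiplication operators\<close>

definition mult_operator ::
    "'s measure \<Rightarrow> ('s \<Rightarrow> 'h::{complex_hilbert, second_countable_topology} \<Rightarrow>\<^sub>L 'h)
      \<Rightarrow> ('s \<Rightarrow> 'h) set operator"
  where "mult_operator \<nu> f =
    {(L2_class \<nu> F, L2_class \<nu> (\<lambda>s. blinfun_apply (f s) (F s))) | F.
      F \<in> L2_functions \<nu> \<and> (\<lambda>s. blinfun_apply (f s) (F s)) \<in> L2_functions \<nu>}"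

text \<open>The operator does not depend on the representative of the class.\<close>

definition x_op ::
    "'s measure \<Rightarrow> ('s \<Rightarrow> 'h::{complex_hilbert, second_countable_topology} \<Rightarrow>\<^sub>L 'h) set
      \<Rightarrow> ('s \<Rightarrow> 'h) set operator"
  where "x_op \<nu> A = mult_operator \<nu> (rep A)"

definition Linf_functions :: "'s measure \<Rightarrow> ('s \<Rightarrow> complex) set"
  where "Linf_functions \<nu> = {g \<in> borel_measurable \<nu>. \<exists>C. AE s in \<nu>. cmod (g s) \<le> C}"

text \<open>
  The von Neumann algebra tensor product of \<open>L\<^sub>\<infinity>(\<nu>)\<close> and \<open>B(H)\<close> is generated by the elementary
  tensors \<open>g \<otimes> a\<close>. On \<open>L\<^sub>2(\<nu>;H)\<close>, identified with the Hilbert space tensor product of \<open>L\<^sub>2(\<nu>)\<close>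
  and \<open>H\<close>, \<open>g \<otimes> a\<close> is multiplication by the function \<open>s \<mapsto> g(s) a\<close>.
\<close>

definition Linf_tensor_BH ::
    "'s measure \<Rightarrow> ('s \<Rightarrow> 'h::{complex_hilbert, second_countable_topology}) set operator set"
  where "Linf_tensor_BH \<nu> = generated_vN (L2_space \<nu>)
    {mult_operator \<nu> (\<lambda>s. BH_scale (g s) a) | g a. g \<in> Linf_functions \<nu> \<and> a \<in> BH}"

end

theory Submission
  imports Defs
begin

text \<open>
  The commutant of the elementary tensors consists of the multiplications by scalar functions: an
  operator commuting with them is determined by its value at a single function \<open>h e\<close> with a
  unit vector \<open>e\<close> and a positive square integrable weight \<open>h\<close> (\<open>commutant_elementary_tensors\<close>).
  Scalar functions commute pointwise with every field \<open>f\<close> of operators, so multiplication by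
  \<open>f\<close> is affiliated with the algebra. In the other direction, a bounded operator that commutes
  with the indicators of measurable sets is multiplication by a bounded field of operators
  (\<open>decomposable_operator\<close>). The elements of the algebra are therefore the bounded
  multiplication operators, and its projections are the measurable fields of projections.

  Multiplication by \<open>f\<close> is locally measurable because it becomes bounded after restriction to the
  set where \<open>norm (f s) \<le> n\<close>, and indicators are central projections that increase to 1.

  Conversely, let \<open>x\<close> be locally measurable. Suppose that fields of projections increase to 1 and
  that the first complement is finite. Then at almost every point they reach 1 after finitely
  many steps: otherwise the increments supply an orthonormal sequence over a set of positive
  measure, and the shift along it makes the complement equivalent to a proper part of itself
  (\<open>finite_perp_exhausts\<close>). A central projection only takes the values 0 and 1, so an increasing
  sequence of central projections reaches 1 as well. Hence countably many sets cover the space up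
  to a null set, such that all functions supported on one of them lie in the domain of \<open>x\<close>. On
  each of these sets \<open>x\<close> is closed and everywhere defined, hence bounded by the closed graph
  theorem (\<open>closed_graph_L2\<close>); being affiliated, it commutes with indicators and is thus
  multiplication by a bounded field. The fields are glued to a field \<open>f\<close> with \<open>x\<close> contained in
  multiplication by \<open>f\<close>. Equality holds since \<open>x\<close> is closed and truncations to finitely many
  pieces form a core of every multiplication operator (\<open>mult_operator_core\<close>).

  The same core argument identifies the strong sum, product and scalar multiple of multiplication
  operators with the pointwise ones, and the adjoint is computed by testing on sets where \<open>f\<close> is
  bounded (\<open>mult_operator_adj\<close>). The axioms of a unital *-algebra hold in B(H) at every point,
  hence for the classes of fields, and the bijection transports them to the locally measurable
  operators.
\<close>

section \<open>Complex Hilbert spaces\<close>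

lemma cinner_add_right: "cinner x (y + z) = cinner x y + cinner x z"
  by (metis cinner_commute cinner_add_left complex_cnj_add)

lemma cinner_scaleC_right: "cinner x (c *\<^sub>C y) = cnj c * cinner x y"
  by (metis cinner_commute cinner_scaleC_left complex_cnj_mult)

lemma scaleC_one [simp]: "1 *\<^sub>C x = (x :: 'h::complex_hilbert)"
  using scaleR_scaleC[of 1 x] by simp

lemma scaleC_minus_one: "(- 1) *\<^sub>C x = - (x :: 'h::complex_hilbert)"
  using scaleR_scaleC[of "-1" x] by simp

lemma norm_scaleC: "norm (c *\<^sub>C x) = cmod c * norm (x :: 'h::complex_hilbert)"
proof -
  have "complex_of_real ((norm (c *\<^sub>C x))\<^sup>2) = c * cnj c * complex_of_real ((norm x)\<^sup>2)"
    by (simp only: cinner_self[symmetric] cinner_scaleC_left cinner_scaleC_right ac_simps)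
  also have "\<dots> = complex_of_real ((cmod c * norm x)\<^sup>2)"
    by (simp only: complex_norm_square[symmetric] power_mult_distrib of_real_mult of_real_power)
  finally have "(norm (c *\<^sub>C x))\<^sup>2 = (cmod c * norm x)\<^sup>2"
    using of_real_eq_iff by blast
  then show ?thesis
    by (simp add: power2_eq_iff_nonneg)
qed

lemma norm_add_square:
  "(norm (x + y :: 'h::complex_hilbert))\<^sup>2 = (norm x)\<^sup>2 + 2 * Re (cinner x y) + (norm y)\<^sup>2"
proof -
  have "complex_of_real ((norm (x + y))\<^sup>2)
      = complex_of_real ((norm x)\<^sup>2) + (cinner x y + cnj (cinner x y)) + complex_of_real ((norm y)\<^sup>2)"
    using cinner_commute[of y x]
    by (simp only: cinner_self[symmetric] cinner_add_left cinner_add_right) (simp add: algebra_simps)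
  also have "\<dots> = complex_of_real ((norm x)\<^sup>2 + 2 * Re (cinner x y) + (norm y)\<^sup>2)"
    by (simp add: complex_add_cnj)
  finally show ?thesis
    using of_real_eq_iff by blast
qed

lemma cmod_cinner_le: "cmod (cinner x y) \<le> norm x * norm (y :: 'h::complex_hilbert)"
proof (cases "y = 0")
  case True
  have "cinner x 0 = 0"
    using cinner_add_right[of x 0 0] by simp
  with True show ?thesis by simp
next
  case False
  \<comment> \<open>the coefficient for which \<open>norm (x + t y)\<close> is minimal\<close>
  define t where "t = - cinner x y / complex_of_real ((norm y)\<^sup>2)"
  have pos: "(norm y)\<^sup>2 > 0" using False by simp
  have "Re (cinner x (t *\<^sub>C y)) = - (cmod (cinner x y))\<^sup>2 / (norm y)\<^sup>2"
  proof -
    have "cinner x (t *\<^sub>C y) = - (cinner x y * cnj (cinner x y)) / complex_of_real ((norm y)\<^sup>2)"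
      by (simp add: cinner_scaleC_right t_def)
    also have "\<dots> = complex_of_real (- (cmod (cinner x y))\<^sup>2 / (norm y)\<^sup>2)"
      by (simp add: complex_norm_square[symmetric] del: of_real_power)
    finally show ?thesis by simp
  qed
  moreover have "(norm (t *\<^sub>C y))\<^sup>2 = (cmod (cinner x y))\<^sup>2 / (norm y)\<^sup>2"
  proof -
    have "cmod t = cmod (cinner x y) / (norm y)\<^sup>2"
      by (simp add: t_def norm_divide norm_power)
    then show ?thesis
      using pos by (simp add: norm_scaleC power_mult_distrib power_divide field_simps eval_nat_numeral)
  qed
  moreover have "0 \<le> (norm (x + t *\<^sub>C y))\<^sup>2" by simp
  ultimately have "(cmod (cinner x y))\<^sup>2 / (norm y)\<^sup>2 \<le> (norm x)\<^sup>2"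
    using norm_add_square[of x "t *\<^sub>C y"] by simp
  then have "(cmod (cinner x y))\<^sup>2 \<le> (norm x * norm y)\<^sup>2"
    using pos by (simp add: pos_divide_le_eq power_mult_distrib)
  then show ?thesis
    by (rule power2_le_imp_le) simp
qed

interpretation cinner: bounded_bilinear "cinner :: 'h::complex_hilbert \<Rightarrow> 'h \<Rightarrow> complex"
proof
  show "\<exists>K. \<forall>a b. norm (cinner a b) \<le> norm (a::'h) * norm b * K"
    by (intro exI[of _ 1]) (simp add: cmod_cinner_le)
qed (auto simp: cinner_add_left cinner_add_right scaleR_scaleC cinner_scaleC_left
      cinner_scaleC_right scaleC_complex_def)

interpretation scaleC: bounded_bilinear "scaleC :: complex \<Rightarrow> 'h::complex_hilbert \<Rightarrow> 'h"
proof
  show "\<exists>K. \<forall>a b. norm (a *\<^sub>C (b::'h)) \<le> norm a * norm b * K"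
    by (intro exI[of _ 1]) (simp add: norm_scaleC)
qed (auto simp: scaleC_add_left scaleC_add_right scaleR_scaleC scaleC_scaleC scaleC_complex_def mult.commute)

lemma cinner_eq_zero_iff [simp]: "cinner x x = 0 \<longleftrightarrow> x = (0 :: 'h::complex_hilbert)"
  by (simp add: cinner_self)

lemma cinner_ext: "x = (y :: 'h::complex_hilbert)" if "\<And>\<xi>. cinner \<xi> x = cinner \<xi> y"
proof -
  have "cinner (x - y) (x - y) = 0"
    using that by (simp add: cinner.diff_right)
  then show ?thesis by simp
qed

lemma cinner_ext_left: "x = (y :: 'h::complex_hilbert)" if "\<And>\<xi>. cinner x \<xi> = cinner y \<xi>"
  by (rule cinner_ext) (metis cinner_commute that)

lemma parallelogram:
  "(norm (x + y))\<^sup>2 + (norm (x - y :: 'h::complex_hilbert))\<^sup>2 = 2 * (norm x)\<^sup>2 + 2 * (norm y)\<^sup>2"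
  using norm_add_square[of x y] norm_add_square[of x "- y"] by (simp add: cinner.minus_right)

text \<open>
  A bounded functional \<open>\<phi>\<close> is represented by the point where \<open>norm x\<^sup>2 - 2 Re (\<phi> x)\<close> is minimal.
  By the parallelogram law minimizing sequences are Cauchy, and the first-order condition at the
  minimum is the representation.
\<close>

lemma riesz_representation:
  fixes \<phi> :: "'h::complex_hilbert \<Rightarrow> complex"
  assumes lin: "bounded_linear \<phi>" and hom: "\<And>c x. \<phi> (c *\<^sub>C x) = c * \<phi> x"
  shows "\<exists>b. \<forall>x. \<phi> x = cinner x b"
proof -
  interpret \<phi>: bounded_linear \<phi> by (rule lin)
  obtain B where B: "\<And>x. cmod (\<phi> x) \<le> norm x * B"
    using \<phi>.bounded by blast
  define J where "J x = (norm x)\<^sup>2 - 2 * Re (\<phi> x)" for x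
  have J_ge: "J x \<ge> - B\<^sup>2" for x
  proof -
    have "Re (\<phi> x) \<le> norm x * B"
      using B[of x] complex_Re_le_cmod[of "\<phi> x"] by linarith
    moreover have "0 \<le> (norm x - B)\<^sup>2" by simp
    ultimately show ?thesis
      unfolding J_def power2_diff by linarith
  qed
  define m where "m = Inf (range J)"
  have bdd: "bdd_below (range J)"
    using J_ge by (intro bdd_belowI2)
  have m_le: "m \<le> J x" for x
    unfolding m_def using bdd by (simp add: cInf_lower)
  have "\<exists>x. J x < m + 1 / real (Suc n)" for n
    using cInf_lessD[of "range J" "m + 1 / real (Suc n)"] by (auto simp: m_def)
  then obtain u where u: "\<And>n. J (u n) < m + 1 / real (Suc n)" by metis
  define half where "half x = (1/2) *\<^sub>R x" for x :: 'h
  have J_par: "(norm (x - y))\<^sup>2 = 2 * J x + 2 * J y - 4 * J (half (x + y))" for x y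
  proof -
    have "4 * (norm (half (x + y)))\<^sup>2 = (norm (x + y))\<^sup>2"
      by (simp add: half_def power_divide)
    moreover have "4 * Re (\<phi> (half (x + y))) = 2 * Re (\<phi> x) + 2 * Re (\<phi> y)"
      by (simp add: half_def \<phi>.scaleR \<phi>.add)
    ultimately show ?thesis
      using parallelogram[of x y] unfolding J_def by (simp add: algebra_simps)
  qed
  have dist_u: "(norm (u i - u j))\<^sup>2 \<le> 2 / real (Suc i) + 2 / real (Suc j)" for i j
    using J_par[of "u i" "u j"] u[of i] u[of j] m_le[of "half (u i + u j)"] by simp
  have "Cauchy u"
  proof (rule metric_CauchyI)
    fix e :: real assume e: "0 < e"
    obtain N0 where "4 / e\<^sup>2 < real N0"
      using reals_Archimedean2 by blast
    then obtain N where N: "4 / e\<^sup>2 < real (Suc N)"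
      by (intro that[of N0]) simp
    have "dist (u i) (u j) < e" if "i \<ge> N" "j \<ge> N" for i j
    proof -
      have "2 / real (Suc i) \<le> 2 / real (Suc N)" "2 / real (Suc j) \<le> 2 / real (Suc N)"
        using that by (auto intro!: divide_left_mono)
      then have "(norm (u i - u j))\<^sup>2 \<le> 4 / real (Suc N)"
        using dist_u[of i j] by simp
      also have "\<dots> < e\<^sup>2"
        using N e by (simp add: field_simps)
      finally show ?thesis
        using e by (simp add: dist_norm power2_less_imp_less)
    qed
    then show "\<exists>M. \<forall>i\<ge>M. \<forall>j\<ge>M. dist (u i) (u j) < e" by blast
  qed
  then obtain b where b: "u \<longlonglongrightarrow> b"
    using Cauchy_convergent convergent_def by blast
  have "(\<lambda>n. J (u n)) \<longlonglongrightarrow> J b"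
    unfolding J_def by (intro tendsto_intros b \<phi>.tendsto)
  moreover have "(\<lambda>n. m + 1 / real (Suc n)) \<longlonglongrightarrow> m + 0"
    by (intro tendsto_intros LIMSEQ_inverse_real_of_nat[unfolded inverse_eq_divide])
  ultimately have "J b \<le> m + 0"
    by (rule LIMSEQ_le) (use u less_imp_le in blast)
  then have J_b: "J b \<le> J x" for x
    using m_le[of x] by simp
  have Re_eq: "Re (\<phi> z) = Re (cinner z b)" for z
  proof -
    define d where "d = Re (cinner b z) - Re (\<phi> z)"
    have ineq: "0 \<le> 2 * t * d + t\<^sup>2 * (norm z)\<^sup>2" for t :: real
      using J_b[of "b + t *\<^sub>R z"] unfolding J_def d_def
      by (simp add: norm_add_square \<phi>.add \<phi>.scaleR cinner.scaleR_right power_mult_distrib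
          algebra_simps)
    have "d = 0"
    proof (rule ccontr)
      assume "d \<noteq> 0"
      define t where "t = - d / ((norm z)\<^sup>2 + 1)"
      have "2 * t * d + t\<^sup>2 * (norm z)\<^sup>2 \<le> 2 * t * d + t\<^sup>2 * ((norm z)\<^sup>2 + 1)"
        by (simp add: algebra_simps)
      also have "\<dots> = - d\<^sup>2 / ((norm z)\<^sup>2 + 1)"
      proof -
        have "2 * (- d / k) * d + (- d / k)\<^sup>2 * k = - d\<^sup>2 / k" if "k > 0" for k :: real
          using that by (simp add: field_simps power2_eq_square)
        then show ?thesis
          unfolding t_def by (simp add: add_nonneg_pos)
      qed
      also have "\<dots> < 0"
        using \<open>d \<noteq> 0\<close> by (simp add: add_nonneg_pos divide_neg_pos)
      finally show False using ineq[of t] by simp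
    qed
    then show ?thesis
      unfolding d_def using cinner_commute[of b z] by simp
  qed
  have "\<phi> z = cinner z b" for z
  proof (rule complex_eqI)
    show "Re (\<phi> z) = Re (cinner z b)" by (rule Re_eq)
    show "Im (\<phi> z) = Im (cinner z b)"
      using Re_eq[of "\<i> *\<^sub>C z"] by (simp add: hom cinner_scaleC_left)
  qed
  then show ?thesis by blast
qed

section \<open>Bounded operators on a Hilbert space\<close>

lemma BH_I: "(\<And>c \<xi>. blinfun_apply a (c *\<^sub>C \<xi>) = c *\<^sub>C blinfun_apply a \<xi>) \<Longrightarrow> a \<in> BH"
  by (simp add: BH_def)

lemma BH_D: "a \<in> BH \<Longrightarrow> blinfun_apply a (c *\<^sub>C \<xi>) = c *\<^sub>C blinfun_apply a \<xi>"
  by (simp add: BH_def)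

lemma norm_adjoint_le:
  assumes "\<And>\<xi> \<eta>. cinner (blinfun_apply a \<xi>) \<eta> = cinner \<xi> (b \<eta>)"
  shows "norm (b x) \<le> norm a * norm x"
proof -
  have "(norm (b x))\<^sup>2 = cmod (cinner (b x) (b x))"
    by (simp add: cinner_self norm_power)
  also have "\<dots> = cmod (cinner (blinfun_apply a (b x)) x)"
    by (simp add: assms)
  also have "\<dots> \<le> norm a * norm (b x) * norm x"
    by (rule order_trans[OF cmod_cinner_le]) (intro mult_right_mono norm_blinfun, simp)
  finally have "norm (b x) * norm (b x) \<le> norm (b x) * (norm a * norm x)"
    unfolding power2_eq_square by (simp only: ac_simps)
  then show ?thesis
    by (cases "norm (b x) = 0") (auto simp: mult_le_cancel_left)
qed

text \<open>Riesz representation of the functionals \<open>\<xi> \<mapsto> \<langle>a \<xi>, \<eta>\<rangle>\<close>.\<close>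

lemma BH_adj_exists:
  assumes "a \<in> BH"
  shows "\<exists>b. \<forall>\<xi> \<eta>. cinner (blinfun_apply a \<xi>) \<eta> = cinner \<xi> (blinfun_apply b \<eta>)"
proof -
  have "\<exists>b. \<forall>\<xi>. cinner (blinfun_apply a \<xi>) \<eta> = cinner \<xi> b" for \<eta>
  proof (rule riesz_representation)
    show "bounded_linear (\<lambda>\<xi>. cinner (blinfun_apply a \<xi>) \<eta>)"
      by (intro bounded_linear_compose[OF cinner.bounded_linear_left] blinfun.bounded_linear_right)
  qed (simp add: BH_D[OF assms] cinner_scaleC_left)
  then obtain b where b: "\<And>\<eta> \<xi>. cinner (blinfun_apply a \<xi>) \<eta> = cinner \<xi> (b \<eta>)" by metis
  have "bounded_linear b"
  proof (rule bounded_linear_intro)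
    show "b (x + y) = b x + b y" for x y
      by (rule cinner_ext) (simp add: b[symmetric] cinner_add_right)
    show "b (r *\<^sub>R x) = r *\<^sub>R b x" for r x
      by (rule cinner_ext) (simp add: b[symmetric] cinner.scaleR_right)
    show "norm (b x) \<le> norm x * norm a" for x
      using norm_adjoint_le[OF b, of x] by (simp only: mult.commute)
  qed
  then have "blinfun_apply (Blinfun b) = b"
    by (rule bounded_linear_Blinfun_apply)
  then show ?thesis
    using b by metis
qed

lemma BH_adj_eqI:
  assumes "\<And>\<xi> \<eta>. cinner (blinfun_apply a \<xi>) \<eta> = cinner \<xi> (blinfun_apply b \<eta>)"
  shows "BH_adj a = b"
  unfolding BH_adj_def
proof (rule the_equality)
  fix b' assume "\<forall>\<xi> \<eta>. cinner (blinfun_apply a \<xi>) \<eta> = cinner \<xi> (blinfun_apply b' \<eta>)"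
  then show "b' = b"
    by (intro blinfun_eqI cinner_ext[of "blinfun_apply b' _"]) (simp flip: assms)
qed (simp add: assms)

lemma cinner_BH_adj:
  assumes "a \<in> BH"
  shows "cinner (blinfun_apply a \<xi>) \<eta> = cinner \<xi> (blinfun_apply (BH_adj a) \<eta>)"
  using BH_adj_exists[OF assms] BH_adj_eqI by metis

lemma cinner_BH_adj':
  assumes "a \<in> BH"
  shows "cinner (blinfun_apply (BH_adj a) \<xi>) \<eta> = cinner \<xi> (blinfun_apply a \<eta>)"
  using cinner_BH_adj[OF assms, of \<eta> \<xi>] by (metis cinner_commute)

lemma BH_adj_in_BH:
  assumes "a \<in> BH" shows "BH_adj a \<in> BH"
  by (rule BH_I, rule cinner_ext)
    (simp add: cinner_BH_adj[OF assms, symmetric] cinner_scaleC_right)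

lemma BH_adj_adj: "a \<in> BH \<Longrightarrow> BH_adj (BH_adj a) = a"
  by (intro BH_adj_eqI cinner_BH_adj')

lemma norm_BH_adj_le:
  assumes "a \<in> BH" shows "norm (BH_adj a) \<le> norm a"
  by (rule norm_blinfun_bound) (simp_all add: norm_adjoint_le[OF cinner_BH_adj[OF assms]])

lemma BH_scale_apply: "blinfun_apply (BH_scale c a) \<xi> = c *\<^sub>C blinfun_apply a \<xi>"
  unfolding BH_scale_def
  by (simp add: bounded_linear_Blinfun_apply
      bounded_linear_compose[OF scaleC.bounded_linear_right blinfun.bounded_linear_right])

lemma BH_closed:
  shows BH_id: "id_blinfun \<in> BH" and BH_zero: "0 \<in> BH"
    and BH_add: "a \<in> BH \<Longrightarrow> b \<in> BH \<Longrightarrow> a + b \<in> BH"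
    and BH_diff: "a \<in> BH \<Longrightarrow> b \<in> BH \<Longrightarrow> a - b \<in> BH"
    and BH_compose: "a \<in> BH \<Longrightarrow> b \<in> BH \<Longrightarrow> a o\<^sub>L b \<in> BH"
    and BH_scale_in: "a \<in> BH \<Longrightarrow> BH_scale c a \<in> BH"
  by (auto simp: BH_def blinfun.add_left blinfun.diff_left scaleC_add_right
      scaleC.diff_right BH_scale_apply scaleC_scaleC mult.commute scaleC.zero_right)

text \<open>
  A Lipschitz map extends continuously to the closure, and continuity carries additivity over from
  \<open>D\<close> and homogeneity over from \<open>Q\<close>. In this way an operator can be built from its values at
  countably many vectors.
\<close>

lemma BH_extend_dense:
  fixes D :: "'h::complex_hilbert set" and g :: "'h \<Rightarrow> 'h"
  assumes dense: "closure D = UNIV"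
    and add: "\<And>x y. x \<in> D \<Longrightarrow> y \<in> D \<Longrightarrow> x + y \<in> D \<and> g (x + y) = g x + g y"
    and scale: "\<And>q x. q \<in> Q \<Longrightarrow> x \<in> D \<Longrightarrow> q *\<^sub>C x \<in> D \<and> g (q *\<^sub>C x) = q *\<^sub>C g x"
    and Q: "closure Q = UNIV" "- 1 \<in> Q"
    and bound: "\<And>x. x \<in> D \<Longrightarrow> norm (g x) \<le> C * norm x"
  shows "\<exists>a\<in>BH. (\<forall>x\<in>D. blinfun_apply a x = g x) \<and> norm a \<le> max C 0"
proof -
  have diff: "x - y \<in> D \<and> g (x - y) = g x - g y" if "x \<in> D" "y \<in> D" for x y
    using add[of x "- y"] scale[OF Q(2), of y] that by (simp add: scaleC_minus_one)
  have lip: "dist (g x) (g y) \<le> max C 0 * dist x y" if "x \<in> D" "y \<in> D" for x y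
    using bound[of "x - y"] diff[OF that] 
    by (simp add: dist_norm) (smt (verit, best) mult_right_mono norm_ge_zero)
  have uc: "uniformly_continuous_on D g"
    by (rule lipschitz_on_uniformly_continuous[of "max C 0"]) (auto intro!: lipschitz_onI lip)
  obtain h where h: "uniformly_continuous_on (closure D) h" "\<And>x. x \<in> D \<Longrightarrow> g x = h x"
    using uniformly_continuous_on_extension_on_closure[OF uc] by metis
  have cont: "continuous_on UNIV h"
    using uniformly_continuous_imp_continuous[OF h(1)] dense by simp
  have cont': "continuous_on A (\<lambda>z. h (k z))" if "continuous_on A k" for A :: "'c::topological_space set" and k
    using continuous_on_compose2[OF cont that] by simp
  have eq_on_dense: "F z = G z" if "continuous_on UNIV F" "continuous_on UNIV G" "closure E = UNIV"
    "\<And>z. z \<in> E \<Longrightarrow> F z = (G z :: 'h)" for F G :: "'c::metric_space \<Rightarrow> 'h" and E z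
  proof -
    have "continuous_on UNIV (\<lambda>z. F z - G z)" by (intro continuous_intros that)
    then have "closed ((\<lambda>z. F z - G z) -` {0})"
      by (intro continuous_closed_vimage closed_singleton) (simp add: continuous_on_eq_continuous_at)
    moreover have "E \<subseteq> (\<lambda>z. F z - G z) -` {0}" using that(4) by auto
    ultimately have "closure E \<subseteq> (\<lambda>z. F z - G z) -` {0}" by (rule closure_minimal[rotated])
    then show ?thesis using that(3) by auto
  qed
  have hadd: "h (x + y) = h x + h y" for x y
  proof -
    have 1: "h (x + y) = h x + h y" if "y \<in> D" for x y
      by (rule eq_on_dense[OF _ _ dense, of "\<lambda>x. h (x + y)" "\<lambda>x. h x + h y"])
        (use h(2) add that in \<open>auto intro!: continuous_intros cont' simp: h(2)[symmetric]\<close>)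
    show ?thesis
      by (rule eq_on_dense[OF _ _ dense, of "\<lambda>y. h (x + y)" "\<lambda>y. h x + h y"])
        (use 1 in \<open>auto intro!: continuous_intros cont'\<close>)
  qed
  have cs: "continuous_on A (\<lambda>z. k z *\<^sub>C l z)" if "continuous_on A k" "continuous_on A l" for
    A :: "'c::topological_space set" and k and l :: "'c \<Rightarrow> 'h"
    using scaleC.continuous_on[OF that] .
  have hscale: "h (c *\<^sub>C x) = c *\<^sub>C h x" for c x
  proof -
    have 1: "h (q *\<^sub>C x) = q *\<^sub>C h x" if "q \<in> Q" for q x
      by (rule eq_on_dense[OF _ _ dense, of "\<lambda>x. h (q *\<^sub>C x)" "\<lambda>x. q *\<^sub>C h x"])
        (use h(2) scale that in \<open>auto intro!: continuous_intros cont' cs simp: h(2)[symmetric]\<close>)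
    show ?thesis
      by (rule eq_on_dense[OF _ _ Q(1), of "\<lambda>c. h (c *\<^sub>C x)" "\<lambda>c. c *\<^sub>C h x"])
        (use 1 in \<open>auto intro!: continuous_intros cont' cs\<close>)
  qed
  have hbound: "norm (h x) \<le> max C 0 * norm x" for x
  proof -
    have "continuous_on UNIV (\<lambda>x. max C 0 * norm x - norm (h x))"
      by (intro continuous_intros cont)
    then have "closed ((\<lambda>x. max C 0 * norm x - norm (h x)) -` {0..})"
      by (intro continuous_closed_vimage closed_atLeast) (simp add: continuous_on_eq_continuous_at)
    moreover have "D \<subseteq> (\<lambda>x. max C 0 * norm x - norm (h x)) -` {0..}"
      using bound h(2) by (auto) (smt (verit, best) mult_right_mono norm_ge_zero)
    ultimately have "closure D \<subseteq> (\<lambda>x. max C 0 * norm x - norm (h x)) -` {0..}"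
      by (rule closure_minimal[rotated])
    then show ?thesis using dense by auto
  qed
  have bl: "bounded_linear h"
    by (rule bounded_linear_intro[of _ "max C 0"])
      (use hbound in \<open>auto simp: hadd scaleR_scaleC hscale mult.commute\<close>)
  show ?thesis
  proof (intro bexI[of _ "Blinfun h"] conjI ballI)
    show "norm (Blinfun h) \<le> max C 0"
      by (rule norm_blinfun_bound) (simp_all add: bounded_linear_Blinfun_apply[OF bl] hbound)
  qed (auto simp: BH_def bounded_linear_Blinfun_apply[OF bl] hscale h(2))
qed

definition gaussian_rationals :: "complex set"
  where "gaussian_rationals = {Complex a b | a b. a \<in> \<rat> \<and> b \<in> \<rat>}"

lemma closure_gaussian_rationals: "closure gaussian_rationals = UNIV"
proof (rule UNIV_eq_I[symmetric])
  fix z :: complex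
  show "z \<in> closure gaussian_rationals"
    unfolding closure_approachable
  proof (intro allI impI)
    fix e :: real assume e: "e > 0"
    obtain a where a: "a \<in> \<rat>" "Re z - e/2 < a" "a < Re z"
      using Rats_dense_in_real[of "Re z - e/2" "Re z"] e by auto
    obtain b where b: "b \<in> \<rat>" "Im z - e/2 < b" "b < Im z"
      using Rats_dense_in_real[of "Im z - e/2" "Im z"] e by auto
    have "dist (Complex a b) z < e"
      using cmod_le[of "Complex a b - z"] a b by (simp add: dist_norm)
    then show "\<exists>y\<in>gaussian_rationals. dist y z < e"
      using a b unfolding gaussian_rationals_def by blast
  qed
qed

lemma countable_gaussian_rationals: "countable gaussian_rationals"
proof -
  have "gaussian_rationals = (\<lambda>(a, b). Complex a b) ` (\<rat> \<times> \<rat>)"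
    by (auto simp: gaussian_rationals_def)
  moreover have "countable ((\<lambda>(a, b). Complex a b) ` (\<rat> \<times> \<rat>))"
    by (intro countable_image countable_SIGMA countable_rat)
  ultimately show ?thesis by simp
qed

lemma minus_one_gaussian_rational: "- 1 \<in> gaussian_rationals"
proof -
  have "- 1 = Complex (- 1) 0" by (simp add: complex_eq_iff)
  then show ?thesis unfolding gaussian_rationals_def by fastforce
qed

lemma countable_dense_closure:
  obtains D :: "'h::second_countable_topology set" where "countable D" "closure D = UNIV"
proof -
  obtain D :: "'h set" where D: "countable D" "\<And>V. open V \<Longrightarrow> V \<noteq> {} \<Longrightarrow> \<exists>d\<in>D. d \<in> V"
    using countable_dense_setE by blast
  have "x \<in> closure D" for x
  proof (rule ccontr)
    assume "x \<notin> closure D"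
    then have "\<exists>d\<in>D. d \<in> - closure D" by (intro D(2)) auto
    then show False using closure_subset[of D] by blast
  qed
  with D(1) show ?thesis by (intro that) auto
qed

text \<open>
  Closing a countable dense set repeatedly under sums and rational multiples keeps it countable,
  so that linearity on it is a countable family of conditions and holds almost everywhere as soon
  as each of them does.
\<close>

lemma countable_dense_gaussian_subspace:
  obtains D :: "'h::{complex_hilbert, second_countable_topology} set"
  where "countable D" "closure D = UNIV" 
    "\<And>x y. x \<in> D \<Longrightarrow> y \<in> D \<Longrightarrow> x + y \<in> D"
    "\<And>q x. q \<in> gaussian_rationals \<Longrightarrow> x \<in> D \<Longrightarrow> q *\<^sub>C x \<in> D"
proof -
  obtain D0 :: "'h set" where D0: "countable D0" "closure D0 = UNIV"
    by (rule countable_dense_closure)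
  define step where "step A = A \<union> (\<lambda>(x, y). x + y) ` (A \<times> A) \<union> (\<lambda>(q, x). q *\<^sub>C x) ` (gaussian_rationals \<times> A)"
    for A :: "'h set"
  define E where "E n = (step ^^ n) D0" for n
  have E_Suc: "E (Suc n) = step (E n)" for n by (simp add: E_def)
  have mono: "E n \<subseteq> E m" if "n \<le> m" for n m
    using that by (rule lift_Suc_mono_le[rotated]) (auto simp: E_Suc step_def)
  have E0: "D0 \<subseteq> (\<Union>n. E n)"
    by (rule order_trans[OF _ UN_upper[of 0]]) (simp_all add: E_def)
  show ?thesis
  proof (rule that[of "\<Union>n. E n"])
    have "countable (E n)" for n
      by (induction n)
        (auto simp: E_Suc step_def countable_gaussian_rationals E_def[of 0] D0(1))
    then show "countable (\<Union>n. E n)" by simp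
    show "closure (\<Union>n. E n) = UNIV" using closure_mono[OF E0] D0(2) by auto
    show "x + y \<in> (\<Union>n. E n)" if xy: "x \<in> (\<Union>n. E n)" "y \<in> (\<Union>n. E n)" for x y
    proof -
      obtain n m where "x \<in> E n" "y \<in> E m" using xy by auto
      then have "x \<in> E (max n m)" "y \<in> E (max n m)"
        using mono[of n "max n m"] mono[of m "max n m"] by auto
      then have "x + y \<in> E (Suc (max n m))" by (force simp: E_Suc step_def)
      then show ?thesis by blast
    qed
    show "q *\<^sub>C x \<in> (\<Union>n. E n)" if qx: "q \<in> gaussian_rationals" "x \<in> (\<Union>n. E n)" for q x
    proof -
      obtain n where "x \<in> E n" using qx by auto
      then have "q *\<^sub>C x \<in> E (Suc n)" using qx by (force simp: E_Suc step_def)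
      then show ?thesis by blast
    qed
  qed
qed

section \<open>Weak and strong measurability\<close>

lemma borel_measurable_cinner [measurable (raw)]:
  fixes f g :: "'s \<Rightarrow> 'h::{complex_hilbert, second_countable_topology}"
  assumes "f \<in> borel_measurable M" "g \<in> borel_measurable M"
  shows "(\<lambda>s. cinner (f s) (g s)) \<in> borel_measurable M"
  using assms by (rule borel_measurable_continuous_Pair)
    (intro cinner.continuous_on continuous_on_fst continuous_on_snd continuous_on_id)

lemma borel_measurable_scaleC [measurable (raw)]:
  fixes g :: "'s \<Rightarrow> 'h::{complex_hilbert, second_countable_topology}"
  assumes "f \<in> borel_measurable M" "g \<in> borel_measurable M"
  shows "(\<lambda>s. f s *\<^sub>C g s) \<in> borel_measurable M"
  using assms by (rule borel_measurable_continuous_Pair)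
    (intro scaleC.continuous_on continuous_on_fst continuous_on_snd continuous_on_id)

lemma le_on_closure:
  fixes F G :: "'a::topological_space \<Rightarrow> real"
  assumes "continuous_on UNIV F" "continuous_on UNIV G" "closure D = UNIV"
    and "\<And>x. x \<in> D \<Longrightarrow> F x \<le> G x"
  shows "F x \<le> G x"
proof -
  have "closed {x. F x \<le> G x}"
    using assms(1,2) by (rule closed_Collect_le)
  then have "closure D \<subseteq> {x. F x \<le> G x}"
    using assms(4) by (intro closure_minimal) auto
  with assms(3) show ?thesis by auto
qed

text \<open>
  Pettis: by separability the distance to a point is computed by countably many functionals, so
  preimages of closed balls are measurable.
\<close>

lemma borel_measurable_weak:
  fixes g :: "'s \<Rightarrow> 'h::{complex_hilbert, second_countable_topology}"
  assumes weak: "\<And>\<eta>. (\<lambda>s. cinner (g s) \<eta>) \<in> borel_measurable M"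
  shows "g \<in> borel_measurable M"
proof -
  note [measurable] = weak
  obtain D :: "'h set" where D: "countable D" "closure D = UNIV"
    by (rule countable_dense_closure)
  have ball: "g -` cball a r \<inter> space M \<in> sets M" if "0 \<le> r" for a r
  proof -
    have "norm (g s - a) \<le> r \<longleftrightarrow> (\<forall>d\<in>D. cmod (cinner (g s) d - cinner a d) \<le> r * norm d)" for s
    proof
      assume "norm (g s - a) \<le> r"
      then show "\<forall>d\<in>D. cmod (cinner (g s) d - cinner a d) \<le> r * norm d"
        unfolding cinner.diff_left[symmetric]
        by (intro ballI order_trans[OF cmod_cinner_le] mult_right_mono) auto
    next
      assume *: "\<forall>d\<in>D. cmod (cinner (g s) d - cinner a d) \<le> r * norm d"
      have "cmod (cinner (g s - a) x) \<le> r * norm x" for x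
        by (rule le_on_closure[OF _ _ D(2)])
          (use * in \<open>auto simp: cinner.diff_left intro!: continuous_intros cinner.continuous_on\<close>)
      from this[of "g s - a"] have "norm (g s - a) * norm (g s - a) \<le> r * norm (g s - a)"
        by (simp add: cinner_self norm_power power2_eq_square[symmetric] del: of_real_power)
      with \<open>0 \<le> r\<close> show "norm (g s - a) \<le> r"
        by (cases "norm (g s - a) = 0") auto
    qed
    then have "g -` cball a r \<inter> space M
        = {s\<in>space M. \<forall>d\<in>D. cmod (cinner (g s) d - cinner a d) \<le> r * norm d}"
      by (auto simp: dist_norm norm_minus_commute)
    also have "\<dots> \<in> sets M"
      using D(1) by measurable
    finally show ?thesis .
  qed
  show ?thesis
  proof (rule borel_measurableI)
    fix V :: "'h set" assume V: "open V"
    define I where "I = {(d, n). d \<in> D \<and> cball d (1 / real (Suc n)) \<subseteq> V}"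
    have "countable I"
      by (rule countable_subset[of _ "D \<times> (UNIV :: nat set)"]) (auto simp: I_def D(1))
    have "V = (\<Union>(d, n)\<in>I. cball d (1 / real (Suc n)))"
    proof (intro equalityI subsetI)
      fix x assume "x \<in> V"
      then obtain e where e: "e > 0" "ball x e \<subseteq> V"
        using V openE by blast
      obtain n where n: "inverse (real (Suc n)) < e / 2"
        using reals_Archimedean[of "e / 2"] e by auto
      obtain d where d: "d \<in> D" "dist d x < 1 / real (Suc n)"
        using closure_approachable[of x D] D(2)
        by (metis UNIV_I divide_pos_pos of_nat_0_less_iff zero_less_Suc zero_less_one)
      have "cball d (1 / real (Suc n)) \<subseteq> V"
      proof
        fix y assume "y \<in> cball d (1 / real (Suc n))"
        then have "dist x y < e"
          using d(2) n dist_triangle[of x y d]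
          by (simp add: inverse_eq_divide dist_commute)
        then show "y \<in> V" using e by auto
      qed
      then show "x \<in> (\<Union>(d, n)\<in>I. cball d (1 / real (Suc n)))"
        using d by (force simp: I_def)
    qed (auto simp: I_def)
    then have "g -` V \<inter> space M = (\<Union>(d, n)\<in>I. g -` cball d (1 / real (Suc n)) \<inter> space M)"
      by auto
    also have "\<dots> \<in> sets M"
      using \<open>countable I\<close> by (intro sets.countable_UN') (auto intro!: ball)
    finally show "g -` V \<inter> space M \<in> sets M" .
  qed
qed

text \<open>The bound \<open>norm (f s) \<le> r\<close> need only be tested on a countable dense set of vectors.\<close>

lemma borel_measurable_norm_blinfun:
  fixes f :: "'s \<Rightarrow> 'h::{complex_hilbert, second_countable_topology} \<Rightarrow>\<^sub>L 'h"
  assumes [measurable]: "\<And>\<xi>. (\<lambda>s. blinfun_apply (f s) \<xi>) \<in> borel_measurable M"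
  shows "(\<lambda>s. norm (f s)) \<in> borel_measurable M"
  unfolding borel_measurable_iff_le
proof
  fix r :: real
  obtain D :: "'h set" where D: "countable D" "closure D = UNIV"
    by (rule countable_dense_closure)
  show "{s\<in>space M. norm (f s) \<le> r} \<in> sets M"
  proof (cases "0 \<le> r")
    case True
    have "norm (f s) \<le> r \<longleftrightarrow> (\<forall>d\<in>D. norm (blinfun_apply (f s) d) \<le> r * norm d)" for s
    proof
      assume "norm (f s) \<le> r"
      then show "\<forall>d\<in>D. norm (blinfun_apply (f s) d) \<le> r * norm d"
        by (intro ballI order_trans[OF norm_blinfun] mult_right_mono) auto
    next
      assume *: "\<forall>d\<in>D. norm (blinfun_apply (f s) d) \<le> r * norm d"
      have "norm (blinfun_apply (f s) x) \<le> r * norm x" for x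
        by (rule le_on_closure[OF _ _ D(2)])
          (use * in \<open>auto intro!: continuous_intros\<close>)
      then show "norm (f s) \<le> r"
        using True by (intro norm_blinfun_bound)
    qed
    then have "{s\<in>space M. norm (f s) \<le> r}
        = {s\<in>space M. \<forall>d\<in>D. norm (blinfun_apply (f s) d) \<le> r * norm d}"
      by auto
    also have "\<dots> \<in> sets M"
      using D(1) by measurable
    finally show ?thesis .
  next
    case False
    then have "{s\<in>space M. norm (f s) \<le> r} = {}"
      using norm_ge_zero[of "f _"] by (auto simp: not_le intro: less_le_trans)
    then show ?thesis by (simp only: sets.empty_sets)
  qed
qed

lemma L0wo_iff:
  fixes f :: "'s \<Rightarrow> 'h::{complex_hilbert, second_countable_topology} \<Rightarrow>\<^sub>L 'h"
  shows "f \<in> L0wo_functions \<nu> \<longleftrightarrow> (\<forall>s\<in>space \<nu>. f s \<in> BH) \<and>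
    (\<forall>\<xi>. (\<lambda>s. blinfun_apply (f s) \<xi>) \<in> borel_measurable \<nu>)"
  unfolding L0wo_functions_def
  by (auto intro: borel_measurable_weak intro!: borel_measurable_cinner)

lemma L0woI:
  fixes f :: "'s \<Rightarrow> 'h::{complex_hilbert, second_countable_topology} \<Rightarrow>\<^sub>L 'h"
  assumes "\<And>s. s \<in> space \<nu> \<Longrightarrow> f s \<in> BH"
    and "\<And>\<xi>. (\<lambda>s. blinfun_apply (f s) \<xi>) \<in> borel_measurable \<nu>"
  shows "f \<in> L0wo_functions \<nu>"
  using assms by (simp add: L0wo_iff)

lemma L0wo_BH: "f \<in> L0wo_functions \<nu> \<Longrightarrow> s \<in> space \<nu> \<Longrightarrow> f s \<in> BH"
  by (simp add: L0wo_functions_def)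

lemma L0wo_apply_const [measurable (raw)]:
  fixes f :: "'s \<Rightarrow> 'h::{complex_hilbert, second_countable_topology} \<Rightarrow>\<^sub>L 'h"
  shows "f \<in> L0wo_functions \<nu> \<Longrightarrow> (\<lambda>s. blinfun_apply (f s) \<xi>) \<in> borel_measurable \<nu>"
  by (simp add: L0wo_iff)

lemma L0wo_norm [measurable (raw)]:
  fixes f :: "'s \<Rightarrow> 'h::{complex_hilbert, second_countable_topology} \<Rightarrow>\<^sub>L 'h"
  shows "f \<in> L0wo_functions \<nu> \<Longrightarrow> (\<lambda>s. norm (f s)) \<in> borel_measurable \<nu>"
  by (intro borel_measurable_norm_blinfun) measurable

lemma L0wo_adj:
  fixes f :: "'s \<Rightarrow> 'h::{complex_hilbert, second_countable_topology} \<Rightarrow>\<^sub>L 'h"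
  assumes f: "f \<in> L0wo_functions \<nu>"
  shows "(\<lambda>s. BH_adj (f s)) \<in> L0wo_functions \<nu>"
proof (rule L0woI)
  show "BH_adj (f s) \<in> BH" if "s \<in> space \<nu>" for s
    using L0wo_BH[OF f that] by (rule BH_adj_in_BH)
  fix \<xi>
  show "(\<lambda>s. blinfun_apply (BH_adj (f s)) \<xi>) \<in> borel_measurable \<nu>"
  proof (rule borel_measurable_weak)
    fix \<eta>
    have "(\<lambda>s. cinner \<xi> (blinfun_apply (f s) \<eta>)) \<in> borel_measurable \<nu>"
      by (intro borel_measurable_cinner borel_measurable_const L0wo_apply_const f)
    also have "?this \<longleftrightarrow> (\<lambda>s. cinner (blinfun_apply (BH_adj (f s)) \<xi>) \<eta>) \<in> borel_measurable \<nu>"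
      by (intro measurable_cong) (simp add: cinner_BH_adj' L0wo_BH[OF f])
    finally show "(\<lambda>s. cinner (blinfun_apply (BH_adj (f s)) \<xi>) \<eta>) \<in> borel_measurable \<nu>" .
  qed
qed

text \<open>Moving \<open>f s\<close> to the other side of the inner product leaves only a constant argument.\<close>

lemma L0wo_apply [measurable (raw)]:
  fixes f :: "'s \<Rightarrow> 'h::{complex_hilbert, second_countable_topology} \<Rightarrow>\<^sub>L 'h"
  assumes f: "f \<in> L0wo_functions \<nu>" and F [measurable]: "F \<in> borel_measurable \<nu>"
  shows "(\<lambda>s. blinfun_apply (f s) (F s)) \<in> borel_measurable \<nu>"
proof (rule borel_measurable_weak)
  fix \<eta>
  have "(\<lambda>s. cinner (F s) (blinfun_apply (BH_adj (f s)) \<eta>)) \<in> borel_measurable \<nu>"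
    using L0wo_adj[OF f] by measurable
  also have "?this \<longleftrightarrow> (\<lambda>s. cinner (blinfun_apply (f s) (F s)) \<eta>) \<in> borel_measurable \<nu>"
    by (intro measurable_cong) (simp add: cinner_BH_adj L0wo_BH[OF f])
  finally show "(\<lambda>s. cinner (blinfun_apply (f s) (F s)) \<eta>) \<in> borel_measurable \<nu>" .
qed

lemma
  fixes f g :: "'s \<Rightarrow> 'h::{complex_hilbert, second_countable_topology} \<Rightarrow>\<^sub>L 'h"
  assumes f: "f \<in> L0wo_functions \<nu>" and g: "g \<in> L0wo_functions \<nu>"
  shows L0wo_add: "(\<lambda>s. f s + g s) \<in> L0wo_functions \<nu>"
    and L0wo_diff: "(\<lambda>s. f s - g s) \<in> L0wo_functions \<nu>"
    and L0wo_compose: "(\<lambda>s. f s o\<^sub>L g s) \<in> L0wo_functions \<nu>"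
    and L0wo_If: "Measurable.pred \<nu> P \<Longrightarrow> (\<lambda>s. if P s then f s else g s) \<in> L0wo_functions \<nu>"
proof -
  have f': "(\<lambda>s. blinfun_apply (f s) \<xi>) \<in> borel_measurable \<nu>"
    and g': "(\<lambda>s. blinfun_apply (g s) \<xi>) \<in> borel_measurable \<nu>" for \<xi>
    using f g by (simp_all add: L0wo_apply_const)
  note BHs = L0wo_BH[OF f] L0wo_BH[OF g]
  show "(\<lambda>s. f s + g s) \<in> L0wo_functions \<nu>"
    by (rule L0woI) (use f' g' in \<open>auto simp: blinfun.add_left intro: BH_add BHs\<close>)
  show "(\<lambda>s. f s - g s) \<in> L0wo_functions \<nu>"
    by (rule L0woI) (use f' g' in \<open>auto simp: blinfun.diff_left intro: BH_diff BHs\<close>)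
  show "(\<lambda>s. f s o\<^sub>L g s) \<in> L0wo_functions \<nu>"
    by (rule L0woI) (use L0wo_apply[OF f g'] in \<open>auto intro: BH_compose BHs\<close>)
  show "(\<lambda>s. if P s then f s else g s) \<in> L0wo_functions \<nu>" if [measurable]: "Measurable.pred \<nu> P"
  proof (rule L0woI)
    fix \<xi>
    have "(\<lambda>s. if P s then blinfun_apply (f s) \<xi> else blinfun_apply (g s) \<xi>) \<in> borel_measurable \<nu>"
      using f' g' that by (intro measurable_If) (auto simp: pred_def)
    then show "(\<lambda>s. blinfun_apply (if P s then f s else g s) \<xi>) \<in> borel_measurable \<nu>"
      by (simp add: if_distrib[of blinfun_apply] if_distribR)
  qed (use BHs in auto)
qed

lemma L0wo_scale:
  fixes f :: "'s \<Rightarrow> 'h::{complex_hilbert, second_countable_topology} \<Rightarrow>\<^sub>L 'h"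
  assumes "h \<in> borel_measurable \<nu>" and f: "f \<in> L0wo_functions \<nu>"
  shows "(\<lambda>s. BH_scale (h s) (f s)) \<in> L0wo_functions \<nu>"
  by (rule L0woI) (use assms L0wo_apply_const[OF f] L0wo_BH[OF f] in
    \<open>auto simp: BH_scale_apply intro: BH_scale_in borel_measurable_scaleC\<close>)

lemma L0wo_const: "a \<in> BH \<Longrightarrow> (\<lambda>s. a) \<in> L0wo_functions \<nu>"
  by (simp add: L0wo_functions_def)

lemma L0wo_eq_pred [measurable (raw)]:
  fixes f g :: "'s \<Rightarrow> 'h::{complex_hilbert, second_countable_topology} \<Rightarrow>\<^sub>L 'h"
  assumes f: "f \<in> L0wo_functions \<nu>" and g: "g \<in> L0wo_functions \<nu>"
  shows "Measurable.pred \<nu> (\<lambda>s. f s = g s)"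
proof -
  have [measurable]: "(\<lambda>s. f s - g s) \<in> L0wo_functions \<nu>"
    using f g by (rule L0wo_diff)
  have "Measurable.pred \<nu> (\<lambda>s. norm (f s - g s) = 0)"
    by measurable
  then show ?thesis by simp
qed

section \<open>The space of square integrable functions\<close>

definition L2_norm :: "'s measure \<Rightarrow> ('s \<Rightarrow> 'h::{complex_hilbert, second_countable_topology}) \<Rightarrow> real"
  where "L2_norm \<nu> F = sqrt (\<integral>s. (norm (F s))\<^sup>2 \<partial>\<nu>)"

lemma L2_measurable [measurable_dest]: "F \<in> L2_functions \<nu> \<Longrightarrow> F \<in> borel_measurable \<nu>"
  by (simp add: L2_functions_def)

lemma L2_integrable: "F \<in> L2_functions \<nu> \<Longrightarrow> integrable \<nu> (\<lambda>s. (norm (F s))\<^sup>2)"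
  by (simp add: L2_functions_def)

lemma L2_norm_nonneg [simp]: "0 \<le> L2_norm \<nu> F"
  by (simp add: L2_norm_def)

lemma L2_norm_square: "(L2_norm \<nu> F)\<^sup>2 = (\<integral>s. (norm (F s))\<^sup>2 \<partial>\<nu>)"
  by (simp add: L2_norm_def)

lemma L2_nn_integral:
  "F \<in> L2_functions \<nu> \<Longrightarrow> (\<integral>\<^sup>+s. ennreal ((norm (F s))\<^sup>2) \<partial>\<nu>) = ennreal ((L2_norm \<nu> F)\<^sup>2)"
  unfolding L2_norm_square by (intro nn_integral_eq_integral L2_integrable) auto

lemma L2_bounded_by:
  fixes F :: "'s \<Rightarrow> 'h::{complex_hilbert, second_countable_topology}"
    and G :: "'s \<Rightarrow> 'k::{complex_hilbert, second_countable_topology}"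
  assumes F: "F \<in> L2_functions \<nu>" and G [measurable]: "G \<in> borel_measurable \<nu>"
    and le: "AE s in \<nu>. norm (G s) \<le> C * norm (F s)"
  shows "G \<in> L2_functions \<nu>" "0 \<le> C \<Longrightarrow> L2_norm \<nu> G \<le> C * L2_norm \<nu> F"
proof -
  have le': "AE s in \<nu>. (norm (G s))\<^sup>2 \<le> C\<^sup>2 * (norm (F s))\<^sup>2"
    using le by eventually_elim (metis norm_ge_zero power_mono power_mult_distrib)
  have int: "integrable \<nu> (\<lambda>s. C\<^sup>2 * (norm (F s))\<^sup>2)"
    using L2_integrable[OF F] by simp
  have int_G: "integrable \<nu> (\<lambda>s. (norm (G s))\<^sup>2)"
    by (rule Bochner_Integration.integrable_bound[OF int]) (use le' in auto)
  then show "G \<in> L2_functions \<nu>"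
    by (simp add: L2_functions_def)
  have "(L2_norm \<nu> G)\<^sup>2 \<le> (C * L2_norm \<nu> F)\<^sup>2"
    using integral_mono_AE[OF int_G int le'] by (simp add: L2_norm_square power_mult_distrib)
  then show "0 \<le> C \<Longrightarrow> L2_norm \<nu> G \<le> C * L2_norm \<nu> F"
    by (rule power2_le_imp_le) simp
qed

lemma L2_norm_cong_AE:
  assumes "F \<in> borel_measurable \<nu>" "G \<in> borel_measurable \<nu>" "AE s in \<nu>. F s = G s"
  shows "L2_norm \<nu> F = L2_norm \<nu> G"
  unfolding L2_norm_def
  by (rule arg_cong[where f = sqrt], rule integral_cong_AE) (use assms in auto)

lemma L2_cong_AE:
  assumes "F \<in> L2_functions \<nu>" "G \<in> borel_measurable \<nu>" "AE s in \<nu>. F s = G s"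
  shows "G \<in> L2_functions \<nu>"
  by (rule L2_bounded_by(1)[OF assms(1,2), of 1]) (use assms(3) in auto)

lemma L2_norm_eq_0:
  assumes "F \<in> L2_functions \<nu>"
  shows "L2_norm \<nu> F = 0 \<longleftrightarrow> (AE s in \<nu>. F s = 0)"
  unfolding L2_norm_def real_sqrt_eq_0_iff
  using integral_nonneg_eq_0_iff_AE[OF L2_integrable[OF assms]] by simp

lemma L2_norm_zero [simp]: "L2_norm \<nu> (\<lambda>s. 0) = 0"
  by (simp add: L2_norm_def)

lemma L2_zero [simp]: "(\<lambda>s. 0) \<in> L2_functions \<nu>"
  by (simp add: L2_functions_def)

lemma L2_scale:
  assumes "F \<in> L2_functions \<nu>"
  shows "(\<lambda>s. c *\<^sub>C F s) \<in> L2_functions \<nu>"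
  using assms by (intro L2_bounded_by(1)[OF assms, of _ "cmod c"]) (auto simp: norm_scaleC)

lemma L2_norm_scale: "L2_norm \<nu> (\<lambda>s. c *\<^sub>C F s) = cmod c * L2_norm \<nu> F"
  by (simp add: L2_norm_def norm_scaleC power_mult_distrib real_sqrt_mult)

lemma L2_mult:
  fixes f :: "'s \<Rightarrow> 'h::{complex_hilbert, second_countable_topology} \<Rightarrow>\<^sub>L 'h"
  assumes f: "f \<in> L0wo_functions \<nu>" and F: "F \<in> L2_functions \<nu>"
    and le: "AE s in \<nu>. norm (f s) \<le> C"
  shows "(\<lambda>s. blinfun_apply (f s) (F s)) \<in> L2_functions \<nu>"
    and "0 \<le> C \<Longrightarrow> L2_norm \<nu> (\<lambda>s. blinfun_apply (f s) (F s)) \<le> C * L2_norm \<nu> F"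
proof -
  have *: "AE s in \<nu>. norm (blinfun_apply (f s) (F s)) \<le> C * norm (F s)"
    using le by eventually_elim (meson mult_right_mono norm_blinfun norm_ge_zero order_trans)
  have **: "(\<lambda>s. blinfun_apply (f s) (F s)) \<in> borel_measurable \<nu>"
    using f F by measurable
  show "(\<lambda>s. blinfun_apply (f s) (F s)) \<in> L2_functions \<nu>"
    "0 \<le> C \<Longrightarrow> L2_norm \<nu> (\<lambda>s. blinfun_apply (f s) (F s)) \<le> C * L2_norm \<nu> F"
    using L2_bounded_by[OF F ** *] by auto
qed

lemma L2_If:
  assumes F: "F \<in> L2_functions \<nu>" and [measurable]: "Measurable.pred \<nu> P"
  shows "(\<lambda>s. if P s then F s else 0) \<in> L2_functions \<nu>"
    and "L2_norm \<nu> (\<lambda>s. if P s then F s else 0) \<le> L2_norm \<nu> F"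
proof -
  note L2_measurable[OF F, measurable]
  have **: "(\<lambda>s. if P s then F s else 0) \<in> borel_measurable \<nu>"
    by measurable
  show "(\<lambda>s. if P s then F s else 0) \<in> L2_functions \<nu>"
    "L2_norm \<nu> (\<lambda>s. if P s then F s else 0) \<le> L2_norm \<nu> F"
    using L2_bounded_by[OF F **, of 1] by auto
qed

lemma L2_norm_product_integrable:
  assumes F: "F \<in> L2_functions \<nu>" and G: "G \<in> L2_functions \<nu>"
  shows "integrable \<nu> (\<lambda>s. norm (F s) * norm (G s))"
proof (rule Bochner_Integration.integrable_bound)
  show "integrable \<nu> (\<lambda>s. (norm (F s))\<^sup>2 + (norm (G s))\<^sup>2)"
    using F G by (simp add: L2_functions_def)
  have "norm (F s) * norm (G s) \<le> (norm (F s))\<^sup>2 + (norm (G s))\<^sup>2" for s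
  proof -
    have "0 \<le> norm (F s) * norm (G s)" by simp
    then show ?thesis
      using sum_squares_bound[of "norm (F s)" "norm (G s)"] by (simp only: mult.assoc)
  qed
  then show "AE s in \<nu>. norm (norm (F s) * norm (G s)) \<le> norm ((norm (F s))\<^sup>2 + (norm (G s))\<^sup>2)"
    by simp
qed (use F G in measurable)

lemma L2_Cauchy_Schwarz:
  assumes F: "F \<in> L2_functions \<nu>" and G: "G \<in> L2_functions \<nu>"
  shows "(\<integral>s. norm (F s) * norm (G s) \<partial>\<nu>) \<le> L2_norm \<nu> F * L2_norm \<nu> G"
proof (rule power2_le_imp_le)
  have [measurable]: "F \<in> borel_measurable \<nu>" "G \<in> borel_measurable \<nu>"
    using F G by measurable
  have "ennreal ((\<integral>s. norm (F s) * norm (G s) \<partial>\<nu>)\<^sup>2)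
      = (\<integral>\<^sup>+s. ennreal (norm (F s)) * ennreal (norm (G s)) \<partial>\<nu>)\<^sup>2"
    using L2_norm_product_integrable[OF F G]
    by (simp add: ennreal_mult[symmetric] ennreal_power[symmetric] nn_integral_eq_integral)
  also have "\<dots> \<le> (\<integral>\<^sup>+s. ennreal (norm (F s)) ^ 2 \<partial>\<nu>) * (\<integral>\<^sup>+s. ennreal (norm (G s)) ^ 2 \<partial>\<nu>)"
    by (rule Cauchy_Schwarz_nn_integral) measurable
  also have "\<dots> = ennreal ((L2_norm \<nu> F * L2_norm \<nu> G)\<^sup>2)"
    using L2_nn_integral[OF F] L2_nn_integral[OF G]
    by (simp add: ennreal_power ennreal_mult power_mult_distrib)
  finally show "(\<integral>s. norm (F s) * norm (G s) \<partial>\<nu>)\<^sup>2 \<le> (L2_norm \<nu> F * L2_norm \<nu> G)\<^sup>2"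
    by (simp add: ennreal_le_iff)
qed simp

lemma
  assumes F: "F \<in> L2_functions \<nu>" and G: "G \<in> L2_functions \<nu>"
  shows L2_add: "(\<lambda>s. F s + G s) \<in> L2_functions \<nu>"
    and L2_norm_triangle: "L2_norm \<nu> (\<lambda>s. F s + G s) \<le> L2_norm \<nu> F + L2_norm \<nu> G"
proof -
  let ?B = "\<lambda>s. (norm (F s))\<^sup>2 + (2 * (norm (F s) * norm (G s)) + (norm (G s))\<^sup>2)"
  have int: "integrable \<nu> ?B"
    using F G L2_norm_product_integrable[OF F G] by (simp add: L2_functions_def)
  have le: "(norm (F s + G s))\<^sup>2 \<le> ?B s" for s
  proof -
    have "(norm (F s + G s))\<^sup>2 \<le> (norm (F s) + norm (G s))\<^sup>2"
      by (intro power_mono norm_triangle_ineq) simp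
    then show ?thesis by (simp add: power2_sum)
  qed
  have int_FG: "integrable \<nu> (\<lambda>s. (norm (F s + G s))\<^sup>2)"
    by (rule Bochner_Integration.integrable_bound[OF int]) (use F G le in \<open>auto intro!: borel_measurable_power\<close>)
  then show "(\<lambda>s. F s + G s) \<in> L2_functions \<nu>"
    using L2_measurable[OF F] L2_measurable[OF G] by (simp add: L2_functions_def)
  have "(L2_norm \<nu> (\<lambda>s. F s + G s))\<^sup>2 \<le> (\<integral>s. ?B s \<partial>\<nu>)"
    unfolding L2_norm_square by (intro integral_mono int int_FG le)
  also have "\<dots> = (L2_norm \<nu> F)\<^sup>2 + (2 * (\<integral>s. norm (F s) * norm (G s) \<partial>\<nu>) + (L2_norm \<nu> G)\<^sup>2)"
    using L2_integrable[OF F] L2_integrable[OF G] L2_norm_product_integrable[OF F G]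
    by (simp add: L2_norm_square)
  also have "\<dots> \<le> (L2_norm \<nu> F + L2_norm \<nu> G)\<^sup>2"
    using L2_Cauchy_Schwarz[OF F G] by (simp add: power2_sum)
  finally show "L2_norm \<nu> (\<lambda>s. F s + G s) \<le> L2_norm \<nu> F + L2_norm \<nu> G"
    by (rule power2_le_imp_le) simp
qed

lemma L2_norm_minus [simp]: "L2_norm \<nu> (\<lambda>s. - F s) = L2_norm \<nu> F"
  by (simp add: L2_norm_def)

lemma L2_minus: "F \<in> L2_functions \<nu> \<Longrightarrow> (\<lambda>s. - F s) \<in> L2_functions \<nu>"
  by (simp add: L2_functions_def)

lemma
  assumes F: "F \<in> L2_functions \<nu>" and G: "G \<in> L2_functions \<nu>"
  shows L2_diff: "(\<lambda>s. F s - G s) \<in> L2_functions \<nu>"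
    and L2_norm_diff_le: "L2_norm \<nu> (\<lambda>s. F s - G s) \<le> L2_norm \<nu> F + L2_norm \<nu> G"
  using L2_add[OF F L2_minus[OF G]] L2_norm_triangle[OF F L2_minus[OF G]] by simp_all

lemma L2_norm_diff_commute: "L2_norm \<nu> (\<lambda>s. F s - G s) = L2_norm \<nu> (\<lambda>s. G s - F s)"
  by (simp add: L2_norm_def norm_minus_commute)

lemma L2_norm_diff_triangle:
  assumes "F \<in> L2_functions \<nu>" "G \<in> L2_functions \<nu>" "H \<in> L2_functions \<nu>"
  shows "L2_norm \<nu> (\<lambda>s. F s - H s) \<le> L2_norm \<nu> (\<lambda>s. F s - G s) + L2_norm \<nu> (\<lambda>s. G s - H s)"
  using L2_norm_triangle[OF L2_diff[OF assms(1,2)] L2_diff[OF assms(2,3)]] by simp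

lemma L2_norm_le_diff:
  assumes "F \<in> L2_functions \<nu>" "G \<in> L2_functions \<nu>"
  shows "L2_norm \<nu> F \<le> L2_norm \<nu> (\<lambda>s. F s - G s) + L2_norm \<nu> G"
  using L2_norm_triangle[OF L2_diff[OF assms] assms(2)] by simp

lemma L2_limit_unique:
  assumes "\<And>n. F n \<in> L2_functions \<nu>" "G \<in> L2_functions \<nu>" "H \<in> L2_functions \<nu>"
    and "(\<lambda>n. L2_norm \<nu> (\<lambda>s. F n s - G s)) \<longlonglongrightarrow> 0" "(\<lambda>n. L2_norm \<nu> (\<lambda>s. F n s - H s)) \<longlonglongrightarrow> 0"
  shows "AE s in \<nu>. G s = H s"
proof -
  have "(\<lambda>n. L2_norm \<nu> (\<lambda>s. F n s - G s) + L2_norm \<nu> (\<lambda>s. F n s - H s)) \<longlonglongrightarrow> 0 + 0"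
    by (intro tendsto_add assms)
  moreover have "L2_norm \<nu> (\<lambda>s. G s - H s) \<le> L2_norm \<nu> (\<lambda>s. F n s - G s) + L2_norm \<nu> (\<lambda>s. F n s - H s)" for n
    using L2_norm_diff_triangle[OF assms(2) assms(1)[of n] assms(3)] L2_norm_diff_commute by metis
  ultimately have "L2_norm \<nu> (\<lambda>s. G s - H s) \<le> 0 + 0"
    by (intro LIMSEQ_le_const) auto
  then have "L2_norm \<nu> (\<lambda>s. G s - H s) = 0"
    using L2_norm_nonneg[of \<nu> "\<lambda>s. G s - H s"] by linarith
  then show ?thesis
    using L2_norm_eq_0[OF L2_diff[OF assms(2,3)]] by simp
qed

text \<open>
  Riesz--Fischer for rapidly converging sequences: \<open>\<Sum>n. 2\<^sup>n (norm (F (Suc n) s - F n s))\<^sup>2\<close> has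
  finite integral, so the increments are summable at almost every point, and Fatou's lemma
  turns the pointwise limit into a limit in the norm.
\<close>

lemma L2_complete:
  fixes F :: "nat \<Rightarrow> 's \<Rightarrow> 'h::{complex_hilbert, second_countable_topology}"
  assumes F: "\<And>n. F n \<in> L2_functions \<nu>"
    and step: "\<And>n. L2_norm \<nu> (\<lambda>s. F (Suc n) s - F n s) \<le> C / 2 ^ n"
  obtains G where "G \<in> L2_functions \<nu>" "\<And>n. L2_norm \<nu> (\<lambda>s. F n s - G s) \<le> 2 * C / 2 ^ n"
    "(\<lambda>n. L2_norm \<nu> (\<lambda>s. F n s - G s)) \<longlonglongrightarrow> 0"
proof -
  have [measurable]: "\<And>n. F n \<in> borel_measurable \<nu>"
    using F by measurable
  have C: "0 \<le> C"
    using order_trans[OF L2_norm_nonneg step[of 0]] by simp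
  define D where "D n s = norm (F (Suc n) s - F n s)" for n s
  have [measurable]: "\<And>n. D n \<in> borel_measurable \<nu>"
    unfolding D_def[abs_def] by measurable
  have D_int: "(\<integral>\<^sup>+s. ennreal (2 ^ n * (D n s)\<^sup>2) \<partial>\<nu>) \<le> ennreal (C\<^sup>2 * (1/2) ^ n)" for n
  proof -
    have "(\<integral>\<^sup>+s. ennreal (2 ^ n * (D n s)\<^sup>2) \<partial>\<nu>)
        = ennreal (2 ^ n) * (\<integral>\<^sup>+s. ennreal ((D n s)\<^sup>2) \<partial>\<nu>)"
      by (simp add: ennreal_mult nn_integral_cmult)
    also have "\<dots> = ennreal (2 ^ n * (L2_norm \<nu> (\<lambda>s. F (Suc n) s - F n s))\<^sup>2)"
      unfolding D_def by (subst L2_nn_integral) (auto simp: L2_diff F ennreal_mult)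
    also have "\<dots> \<le> ennreal (2 ^ n * (C / 2 ^ n)\<^sup>2)"
      by (intro ennreal_leI mult_left_mono power_mono step) auto
    also have "2 ^ n * (C / 2 ^ n)\<^sup>2 = C\<^sup>2 * (1/2) ^ n"
      by (simp add: power2_eq_square field_simps)
    finally show ?thesis .
  qed
  have "(\<integral>\<^sup>+s. (\<Sum>n. ennreal (2 ^ n * (D n s)\<^sup>2)) \<partial>\<nu>) = (\<Sum>n. \<integral>\<^sup>+s. ennreal (2 ^ n * (D n s)\<^sup>2) \<partial>\<nu>)"
    by (intro nn_integral_suminf) measurable
  also have "\<dots> \<le> (\<Sum>n. ennreal (C\<^sup>2 * (1/2) ^ n))"
    by (intro suminf_le D_int) auto
  also have "\<dots> = ennreal (\<Sum>n. C\<^sup>2 * (1/2) ^ n)"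
    by (rule suminf_ennreal2) (auto intro!: summable_mult summable_geometric)
  finally have "(\<integral>\<^sup>+s. (\<Sum>n. ennreal (2 ^ n * (D n s)\<^sup>2)) \<partial>\<nu>) \<noteq> \<infinity>"
    by (auto simp: top_unique)
  then have AE_fin: "AE s in \<nu>. (\<Sum>n. ennreal (2 ^ n * (D n s)\<^sup>2)) \<noteq> \<infinity>"
    by (intro nn_integral_PInf_AE) measurable
  have conv: "AE s in \<nu>. convergent (\<lambda>n. F n s)"
    using AE_fin
  proof eventually_elim
    case (elim s)
    have "summable (\<lambda>n. 2 ^ n * (D n s)\<^sup>2)"
      using elim by (intro summable_suminf_not_top) auto
    then have *: "summable (\<lambda>n. 2 ^ n * (D n s)\<^sup>2 + (1/2) ^ n)"
      by (intro summable_add summable_geometric) auto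
    have "D n s \<le> 2 ^ n * (D n s)\<^sup>2 + (1/2) ^ n" for n
    proof -
      define t :: real where "t = 2 ^ n"
      have t: "t > 0" and r: "(1/2) ^ n = 1 / t" by (simp_all add: t_def power_divide)
      have "0 \<le> (t * D n s - 1)\<^sup>2" by simp
      then have "2 * t * D n s \<le> t * (t * (D n s)\<^sup>2 + 1 / t)"
        using t by (simp add: power2_eq_square algebra_simps)
      moreover have "0 \<le> t * D n s" using t by (simp add: D_def)
      ultimately have "t * D n s \<le> t * (t * (D n s)\<^sup>2 + 1 / t)" by linarith
      then show ?thesis using t unfolding r t_def[symmetric] by simp
    qed
    then have "summable (\<lambda>n. D n s)"
      by (intro summable_comparison_test'[OF *]) (auto simp: D_def)
    then have "summable (\<lambda>n. F (Suc n) s - F n s)"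
      unfolding D_def by (rule summable_norm_cancel)
    then have "convergent (\<lambda>n. \<Sum>i<n. F (Suc i) s - F i s)"
      by (simp add: summable_iff_convergent)
    then have "convergent (\<lambda>n. F n s - F 0 s)"
      by (subst (asm) sum_lessThan_telescope)
    then have "convergent (\<lambda>n. F n s - F 0 s + F 0 s)"
      by (intro convergent_add convergent_const)
    then show ?case by simp
  qed
  define G where "G s = lim (\<lambda>n. F n s)" for s
  have [measurable]: "G \<in> borel_measurable \<nu>"
    unfolding G_def[abs_def] by measurable
  have dist_F: "L2_norm \<nu> (\<lambda>s. F n s - F (n + k) s) \<le> 2 * C / 2 ^ n" for n k
  proof -
    have "L2_norm \<nu> (\<lambda>s. F n s - F (n + k) s) \<le> 2 * C / 2 ^ n - 2 * C / 2 ^ (n + k)"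
    proof (induction k)
      case (Suc k)
      have "L2_norm \<nu> (\<lambda>s. F n s - F (n + Suc k) s)
          \<le> L2_norm \<nu> (\<lambda>s. F n s - F (n + k) s) + L2_norm \<nu> (\<lambda>s. F (n + k) s - F (Suc (n + k)) s)"
        using L2_norm_diff_triangle[OF F[of n] F[of "n + k"] F[of "Suc (n + k)"]] by simp
      also have "L2_norm \<nu> (\<lambda>s. F (n + k) s - F (Suc (n + k)) s) \<le> C / 2 ^ (n + k)"
        using step[of "n + k"] by (subst L2_norm_diff_commute)
      finally have "L2_norm \<nu> (\<lambda>s. F n s - F (n + Suc k) s)
          \<le> L2_norm \<nu> (\<lambda>s. F n s - F (n + k) s) + C / 2 ^ (n + k)" by simp
      moreover have "C / 2 ^ (n + k) - 2 * C / 2 ^ (n + k) = - (2 * C / 2 ^ (n + Suc k))"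
        by (simp add: field_simps)
      ultimately show ?case
        using Suc.IH by linarith
    qed simp
    moreover have "0 \<le> 2 * C / 2 ^ (n + k)" using C by simp
    ultimately show ?thesis by linarith
  qed
  have main: "(\<lambda>s. F n s - G s) \<in> L2_functions \<nu> \<and> L2_norm \<nu> (\<lambda>s. F n s - G s) \<le> 2 * C / 2 ^ n" for n
  proof -
    have "(\<integral>\<^sup>+s. ennreal ((norm (F n s - G s))\<^sup>2) \<partial>\<nu>)
        = (\<integral>\<^sup>+s. liminf (\<lambda>k. ennreal ((norm (F n s - F (n + k) s))\<^sup>2)) \<partial>\<nu>)"
    proof (rule nn_integral_cong_AE)
      show "AE s in \<nu>. ennreal ((norm (F n s - G s))\<^sup>2)
          = liminf (\<lambda>k. ennreal ((norm (F n s - F (n + k) s))\<^sup>2))"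
        using conv
      proof eventually_elim
        case (elim s)
        then have "(\<lambda>k. F k s) \<longlonglongrightarrow> G s"
          by (simp add: G_def convergent_LIMSEQ_iff)
        then have "(\<lambda>k. F (n + k) s) \<longlonglongrightarrow> G s"
          using LIMSEQ_ignore_initial_segment[of "\<lambda>k. F k s" "G s" n] by (simp add: add.commute)
        then have "(\<lambda>k. ennreal ((norm (F n s - F (n + k) s))\<^sup>2)) \<longlonglongrightarrow> ennreal ((norm (F n s - G s))\<^sup>2)"
          by (intro tendsto_intros)
        then show ?case
          by (rule lim_imp_Liminf[OF sequentially_bot, symmetric])
      qed
    qed
    also have "\<dots> \<le> liminf (\<lambda>k. \<integral>\<^sup>+s. ennreal ((norm (F n s - F (n + k) s))\<^sup>2) \<partial>\<nu>)"
      by (intro nn_integral_liminf) measurable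
    also have "\<dots> \<le> ennreal ((2 * C / 2 ^ n)\<^sup>2)"
    proof (rule Liminf_le)
      show "eventually (\<lambda>k. (\<integral>\<^sup>+s. ennreal ((norm (F n s - F (n + k) s))\<^sup>2) \<partial>\<nu>) \<le> ennreal ((2 * C / 2 ^ n)\<^sup>2)) sequentially"
        using dist_F by (auto simp: L2_nn_integral L2_diff F intro!: always_eventually ennreal_leI power_mono)
    qed simp
    finally have le: "(\<integral>\<^sup>+s. ennreal ((norm (F n s - G s))\<^sup>2) \<partial>\<nu>) \<le> ennreal ((2 * C / 2 ^ n)\<^sup>2)" .
    then have "integrable \<nu> (\<lambda>s. (norm (F n s - G s))\<^sup>2)"
      by (intro integrableI_bounded) (auto simp: le_less_trans)
    then have L2: "(\<lambda>s. F n s - G s) \<in> L2_functions \<nu>"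
      by (simp add: L2_functions_def)
    from le have "(L2_norm \<nu> (\<lambda>s. F n s - G s))\<^sup>2 \<le> (2 * C / 2 ^ n)\<^sup>2"
      by (simp add: L2_nn_integral[OF L2] ennreal_le_iff)
    then have "L2_norm \<nu> (\<lambda>s. F n s - G s) \<le> 2 * C / 2 ^ n"
      by (rule power2_le_imp_le) (simp add: C)
    with L2 show ?thesis by blast
  qed
  have G: "G \<in> L2_functions \<nu>"
    using L2_diff[OF F[of 0] conjunct1[OF main[of 0]]] by simp
  have "(\<lambda>n. 2 * C * (1 / 2) ^ n) \<longlonglongrightarrow> 2 * C * 0"
    by (intro tendsto_intros LIMSEQ_realpow_zero) auto
  then have "(\<lambda>n. 2 * C / 2 ^ n) \<longlonglongrightarrow> 0"
    by (simp add: power_divide)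
  then have "(\<lambda>n. L2_norm \<nu> (\<lambda>s. F n s - G s)) \<longlonglongrightarrow> 0"
    by (rule tendsto_sandwich[OF _ _ tendsto_const, rotated -1]) (use main in auto)
  then show thesis
    using that[OF G] main by blast
qed

section \<open>Almost everywhere classes\<close>

lemma equiv_ae_rel: "equiv V (ae_rel \<nu> V)"
proof (rule equivI)
  show "sym (ae_rel \<nu> V)"
    by (auto simp: sym_def ae_rel_def eq_commute)
  show "trans (ae_rel \<nu> V)"
    unfolding trans_def ae_rel_def by auto
qed (auto simp: refl_on_def ae_rel_def)

lemma ae_class_eq_iff:
  "F \<in> V \<Longrightarrow> G \<in> V \<Longrightarrow> ae_class \<nu> V F = ae_class \<nu> V G \<longleftrightarrow> (AE s in \<nu>. F s = G s)"
  unfolding ae_class_def by (subst eq_equiv_class_iff[OF equiv_ae_rel]) (auto simp: ae_rel_def)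

lemma ae_class_cases:
  assumes "A \<in> V // ae_rel \<nu> V"
  obtains F where "F \<in> V" "A = ae_class \<nu> V F"
  using assms by (auto simp: quotient_def ae_class_def)

lemma ae_class_in: "F \<in> V \<Longrightarrow> ae_class \<nu> V F \<in> V // ae_rel \<nu> V"
  unfolding ae_class_def by (rule quotientI)

lemma rep_ae_class:
  assumes "F \<in> V"
  shows rep_in: "rep (ae_class \<nu> V F) \<in> V"
    and AE_rep: "AE s in \<nu>. rep (ae_class \<nu> V F) s = F s"
proof -
  have "F \<in> ae_class \<nu> V F"
    using assms by (simp add: ae_class_def ae_rel_def)
  then have "rep (ae_class \<nu> V F) \<in> ae_class \<nu> V F"
    unfolding rep_def by (rule someI[of "\<lambda>f. f \<in> ae_class \<nu> V F"])
  then show "rep (ae_class \<nu> V F) \<in> V" "AE s in \<nu>. rep (ae_class \<nu> V F) s = F s"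
    by (auto simp: ae_class_def ae_rel_def eq_commute)
qed

lemma L2_class_eq_iff:
  "F \<in> L2_functions \<nu> \<Longrightarrow> G \<in> L2_functions \<nu> \<Longrightarrow>
    L2_class \<nu> F = L2_class \<nu> G \<longleftrightarrow> (AE s in \<nu>. F s = G s)"
  by (rule ae_class_eq_iff)

lemma L2_carrier_iff: "a \<in> hcarrier (L2_space \<nu>) \<longleftrightarrow> (\<exists>F\<in>L2_functions \<nu>. a = L2_class \<nu> F)"
  unfolding L2_space_def by (auto intro: ae_class_in elim: ae_class_cases)

lemma L2_class_in_carrier [simp]: "F \<in> L2_functions \<nu> \<Longrightarrow> L2_class \<nu> F \<in> hcarrier (L2_space \<nu>)"
  by (auto simp: L2_carrier_iff)

lemma hzero_L2: "hzero (L2_space \<nu>) = L2_class \<nu> (\<lambda>s. 0)"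
  by (simp add: L2_space_def)

lemma hadd_L2:
  assumes F: "F \<in> L2_functions \<nu>" and G: "G \<in> L2_functions \<nu>"
  shows "hadd (L2_space \<nu>) (L2_class \<nu> F) (L2_class \<nu> G) = L2_class \<nu> (\<lambda>s. F s + G s)"
  unfolding L2_space_def hilbert_space.simps
  by (subst L2_class_eq_iff)
    (use AE_rep[OF F, of \<nu>] AE_rep[OF G, of \<nu>] in
      \<open>auto intro: L2_add rep_in F G elim: eventually_elim2\<close>)

lemma hscale_L2:
  assumes F: "F \<in> L2_functions \<nu>"
  shows "hscale (L2_space \<nu>) c (L2_class \<nu> F) = L2_class \<nu> (\<lambda>s. c *\<^sub>C F s)"
  unfolding L2_space_def hilbert_space.simps
  by (subst L2_class_eq_iff)
    (use AE_rep[OF F, of \<nu>] in \<open>auto intro: L2_scale rep_in F elim: eventually_mono\<close>)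

lemma hinner_L2:
  assumes F: "F \<in> L2_functions \<nu>" and G: "G \<in> L2_functions \<nu>"
  shows "hinner (L2_space \<nu>) (L2_class \<nu> F) (L2_class \<nu> G) = (\<integral>s. cinner (F s) (G s) \<partial>\<nu>)"
  unfolding L2_space_def hilbert_space.simps
proof (rule integral_cong_AE)
  show "AE s in \<nu>. cinner (rep (L2_class \<nu> F) s) (rep (L2_class \<nu> G) s) = cinner (F s) (G s)"
    using AE_rep[OF F, of \<nu>] AE_rep[OF G, of \<nu>] by eventually_elim simp
qed (use L2_measurable[OF F] L2_measurable[OF G] L2_measurable[OF rep_in[OF F]]
  L2_measurable[OF rep_in[OF G]] in \<open>auto intro: borel_measurable_cinner\<close>)

lemma hnorm_L2:
  assumes F: "F \<in> L2_functions \<nu>"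
  shows "hnorm (L2_space \<nu>) (L2_class \<nu> F) = L2_norm \<nu> F"
proof -
  have "(\<integral>s. cinner (F s) (F s) \<partial>\<nu>) = complex_of_real (\<integral>s. (norm (F s))\<^sup>2 \<partial>\<nu>)"
    unfolding cinner_self by (rule integral_complex_of_real)
  then show ?thesis
    by (simp add: hnorm_def hinner_L2[OF F F] L2_norm_def)
qed

lemma hdist_L2:
  assumes F: "F \<in> L2_functions \<nu>" and G: "G \<in> L2_functions \<nu>"
  shows "hdist (L2_space \<nu>) (L2_class \<nu> F) (L2_class \<nu> G) = L2_norm \<nu> (\<lambda>s. F s - G s)"
  unfolding hdist_def hscale_L2[OF G] hadd_L2[OF F L2_scale[OF G]]
  by (simp add: scaleC_minus_one hnorm_L2 L2_diff F G)

lemma hconv_L2: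
  assumes "\<And>n. F n \<in> L2_functions \<nu>" "G \<in> L2_functions \<nu>"
  shows "hconv (L2_space \<nu>) (\<lambda>n. L2_class \<nu> (F n)) (L2_class \<nu> G)
    \<longleftrightarrow> (\<lambda>n. L2_norm \<nu> (\<lambda>s. F n s - G s)) \<longlonglongrightarrow> 0"
  unfolding hconv_def by (simp add: hdist_L2 assms)

lemma L2_inner_integrable:
  assumes F: "F \<in> L2_functions \<nu>" and G: "G \<in> L2_functions \<nu>"
  shows "integrable \<nu> (\<lambda>s. cinner (F s) (G s))"
  by (rule Bochner_Integration.integrable_bound[OF L2_norm_product_integrable[OF F G]])
    (use L2_measurable[OF F] L2_measurable[OF G] cmod_cinner_le in
      \<open>auto intro: borel_measurable_cinner\<close>)

text \<open>
  Convergence of classes is convergence of representatives in \<^const>\<open>L2_norm\<close>, so closures can be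
  computed with sequences of functions.
\<close>

lemma L2_op_closure_cases:
  assumes x: "x \<subseteq> hcarrier (L2_space \<nu>) \<times> hcarrier (L2_space \<nu>)"
    and ab: "(a, b) \<in> op_closure (L2_space \<nu>) x"
  obtains F G U V where "F \<in> L2_functions \<nu>" "G \<in> L2_functions \<nu>" "a = L2_class \<nu> F" "b = L2_class \<nu> G"
    "\<And>n. U n \<in> L2_functions \<nu>" "\<And>n. V n \<in> L2_functions \<nu>"
    "\<And>n. (L2_class \<nu> (U n), L2_class \<nu> (V n)) \<in> x"
    "(\<lambda>n. L2_norm \<nu> (\<lambda>s. U n s - F s)) \<longlonglongrightarrow> 0" "(\<lambda>n. L2_norm \<nu> (\<lambda>s. V n s - G s)) \<longlonglongrightarrow> 0"
proof -
  obtain F G where F: "F \<in> L2_functions \<nu>" "G \<in> L2_functions \<nu>" "a = L2_class \<nu> F" "b = L2_class \<nu> G"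
    using ab unfolding op_closure_def L2_carrier_iff by blast
  obtain u v where uv: "\<And>n. (u n, v n) \<in> x" "hconv (L2_space \<nu>) u a" "hconv (L2_space \<nu>) v b"
    using ab unfolding op_closure_def by blast
  have "\<forall>n. \<exists>U\<in>L2_functions \<nu>. u n = L2_class \<nu> U" "\<forall>n. \<exists>V\<in>L2_functions \<nu>. v n = L2_class \<nu> V"
    using uv(1) x unfolding L2_carrier_iff[symmetric] by blast+
  then obtain U V where U: "\<And>n. U n \<in> L2_functions \<nu>" "\<And>n. u n = L2_class \<nu> (U n)"
    and V: "\<And>n. V n \<in> L2_functions \<nu>" "\<And>n. v n = L2_class \<nu> (V n)"
    by metis
  have u: "u = (\<lambda>n. L2_class \<nu> (U n))" and v: "v = (\<lambda>n. L2_class \<nu> (V n))"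
    using U(2) V(2) by auto
  show thesis
  proof (rule that[of F G U V, OF F U(1) V(1)])
    show "(L2_class \<nu> (U n), L2_class \<nu> (V n)) \<in> x" for n
      using uv(1)[of n] unfolding u v .
    show "(\<lambda>n. L2_norm \<nu> (\<lambda>s. U n s - F s)) \<longlonglongrightarrow> 0"
      using uv(2)[unfolded u F(3)] by (rule hconv_L2[THEN iffD1, rotated -1]) (rule U(1) F(1))+
    show "(\<lambda>n. L2_norm \<nu> (\<lambda>s. V n s - G s)) \<longlonglongrightarrow> 0"
      using uv(3)[unfolded v F(4)] by (rule hconv_L2[THEN iffD1, rotated -1]) (rule V(1) F(2))+
  qed
qed

lemma L2_op_closureI:
  assumes "F \<in> L2_functions \<nu>" "G \<in> L2_functions \<nu>"
    "\<And>n. U n \<in> L2_functions \<nu>" "\<And>n. V n \<in> L2_functions \<nu>"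
    "\<And>n. (L2_class \<nu> (U n), L2_class \<nu> (V n)) \<in> x"
    "(\<lambda>n. L2_norm \<nu> (\<lambda>s. U n s - F s)) \<longlonglongrightarrow> 0" "(\<lambda>n. L2_norm \<nu> (\<lambda>s. V n s - G s)) \<longlonglongrightarrow> 0"
  shows "(L2_class \<nu> F, L2_class \<nu> G) \<in> op_closure (L2_space \<nu>) x"
proof -
  have "hconv (L2_space \<nu>) (\<lambda>n. L2_class \<nu> (U n)) (L2_class \<nu> F)"
    using assms(6) by (rule hconv_L2[THEN iffD2, rotated -1]) (rule assms)+
  moreover have "hconv (L2_space \<nu>) (\<lambda>n. L2_class \<nu> (V n)) (L2_class \<nu> G)"
    using assms(7) by (rule hconv_L2[THEN iffD2, rotated -1]) (rule assms)+
  ultimately show ?thesis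
    unfolding op_closure_def mem_Collect_eq case_prod_conv using assms(1,2,5)
    by (intro conjI exI[of _ "\<lambda>n. L2_class \<nu> (U n)"] exI[of _ "\<lambda>n. L2_class \<nu> (V n)"])
      (auto intro: L2_class_in_carrier)
qed

lemma linear_operator_L2_add:
  assumes "linear_operator (L2_space \<nu>) x"
    and "F \<in> L2_functions \<nu>" "G \<in> L2_functions \<nu>" "F' \<in> L2_functions \<nu>" "G' \<in> L2_functions \<nu>"
    and "(L2_class \<nu> F, L2_class \<nu> G) \<in> x" "(L2_class \<nu> F', L2_class \<nu> G') \<in> x"
  shows "(L2_class \<nu> (\<lambda>s. F s + F' s), L2_class \<nu> (\<lambda>s. G s + G' s)) \<in> x"
proof -
  have "(hadd (L2_space \<nu>) (L2_class \<nu> F) (L2_class \<nu> F'), hadd (L2_space \<nu>) (L2_class \<nu> G) (L2_class \<nu> G')) \<in> x"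
    using assms(1,6,7) unfolding linear_operator_def by blast
  then show ?thesis by (simp add: hadd_L2 assms)
qed

lemma linear_operator_L2_scale:
  assumes "linear_operator (L2_space \<nu>) x"
    and "F \<in> L2_functions \<nu>" "G \<in> L2_functions \<nu>" "(L2_class \<nu> F, L2_class \<nu> G) \<in> x"
  shows "(L2_class \<nu> (\<lambda>s. c *\<^sub>C F s), L2_class \<nu> (\<lambda>s. c *\<^sub>C G s)) \<in> x"
proof -
  have "(hscale (L2_space \<nu>) c (L2_class \<nu> F), hscale (L2_space \<nu>) c (L2_class \<nu> G)) \<in> x"
    using assms(1,4) unfolding linear_operator_def by blast
  then show ?thesis by (simp add: hscale_L2 assms)
qed

lemma linear_operator_L2_unique:
  assumes "linear_operator (L2_space \<nu>) x"
    and "G \<in> L2_functions \<nu>" "G' \<in> L2_functions \<nu>"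
    and "(L2_class \<nu> F, L2_class \<nu> G) \<in> x" "(L2_class \<nu> F, L2_class \<nu> G') \<in> x"
  shows "AE s in \<nu>. G s = G' s"
proof -
  have "single_valued x" using assms(1) unfolding linear_operator_def by blast
  then have "L2_class \<nu> G = L2_class \<nu> G'" using assms(4,5) by (rule single_valuedD)
  then show ?thesis by (simp add: L2_class_eq_iff assms)
qed

lemma L2_cut_tendsto:
  assumes U: "\<And>n. U n \<in> L2_functions \<nu>" and F: "F \<in> L2_functions \<nu>" and P: "Measurable.pred \<nu> P"
    and lim: "(\<lambda>n. L2_norm \<nu> (\<lambda>s. U n s - F s)) \<longlonglongrightarrow> 0"
  shows "(\<lambda>n. L2_norm \<nu> (\<lambda>s. (if P s then U n s else 0) - (if P s then F s else 0))) \<longlonglongrightarrow> 0"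
proof (rule tendsto_sandwich[OF _ _ tendsto_const lim])
  have "L2_norm \<nu> (\<lambda>s. if P s then U n s - F s else 0) \<le> L2_norm \<nu> (\<lambda>s. U n s - F s)" for n
    by (rule L2_If(2)[OF L2_diff[OF U F] P])
  moreover have "(\<lambda>s. if P s then U n s - F s else 0)
      = (\<lambda>s. (if P s then U n s else 0) - (if P s then F s else 0))" for n
    by auto
  ultimately show "\<forall>\<^sub>F n in sequentially.
      L2_norm \<nu> (\<lambda>s. (if P s then U n s else 0) - (if P s then F s else 0)) \<le> L2_norm \<nu> (\<lambda>s. U n s - F s)"
    by simp
qed simp

lemma L2_truncation_tendsto:
  assumes F: "F \<in> L2_functions \<nu>" and [measurable]: "\<And>n. Measurable.pred \<nu> (P n)"
    and P: "AE s in \<nu>. eventually (\<lambda>n. P n s) sequentially"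
  shows "(\<lambda>n. L2_norm \<nu> (\<lambda>s. (if P n s then F s else 0) - F s)) \<longlonglongrightarrow> 0"
proof -
  have [measurable]: "F \<in> borel_measurable \<nu>"
    using F by (rule L2_measurable)
  have "(\<lambda>n. \<integral>s. (norm ((if P n s then F s else 0) - F s))\<^sup>2 \<partial>\<nu>) \<longlonglongrightarrow> (\<integral>s. 0 \<partial>\<nu>)"
  proof (rule integral_dominated_convergence)
    show "integrable \<nu> (\<lambda>s. (norm (F s))\<^sup>2)"
      using F by (rule L2_integrable)
    show "AE s in \<nu>. (\<lambda>n. (norm ((if P n s then F s else 0) - F s))\<^sup>2) \<longlonglongrightarrow> 0"
      using P
    proof eventually_elim
      case (elim s)
      show ?case
        by (rule tendsto_eventually, rule eventually_mono[OF elim]) simp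
    qed
  qed auto
  then have "(\<lambda>n. sqrt (\<integral>s. (norm ((if P n s then F s else 0) - F s))\<^sup>2 \<partial>\<nu>)) \<longlonglongrightarrow> sqrt 0"
    by (intro tendsto_real_sqrt) simp
  then show ?thesis
    by (simp add: L2_norm_def)
qed

section \<open>Multiplication operators\<close>

lemma mult_operator_cases:
  assumes "(a, b) \<in> mult_operator \<nu> f"
  obtains F where "F \<in> L2_functions \<nu>" "(\<lambda>s. blinfun_apply (f s) (F s)) \<in> L2_functions \<nu>"
    "a = L2_class \<nu> F" "b = L2_class \<nu> (\<lambda>s. blinfun_apply (f s) (F s))"
  using assms unfolding mult_operator_def by blast

text \<open>
  Square integrability of \<open>f F\<close> is implied on the right, since \<open>f F\<close> agrees with \<open>G\<close> almost
  everywhere.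
\<close>

lemma mult_operator_iff:
  fixes f :: "'s \<Rightarrow> 'h::{complex_hilbert, second_countable_topology} \<Rightarrow>\<^sub>L 'h"
  assumes f: "f \<in> L0wo_functions \<nu>" and F: "F \<in> L2_functions \<nu>" and G: "G \<in> L2_functions \<nu>"
  shows "(L2_class \<nu> F, L2_class \<nu> G) \<in> mult_operator \<nu> f \<longleftrightarrow> (AE s in \<nu>. G s = blinfun_apply (f s) (F s))"
proof
  assume "(L2_class \<nu> F, L2_class \<nu> G) \<in> mult_operator \<nu> f"
  then obtain F' where F': "F' \<in> L2_functions \<nu>" "(\<lambda>s. blinfun_apply (f s) (F' s)) \<in> L2_functions \<nu>"
    "L2_class \<nu> F = L2_class \<nu> F'" "L2_class \<nu> G = L2_class \<nu> (\<lambda>s. blinfun_apply (f s) (F' s))"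
    by (rule mult_operator_cases)
  have "AE s in \<nu>. F s = F' s" "AE s in \<nu>. G s = blinfun_apply (f s) (F' s)"
    using F' F G by (simp_all add: L2_class_eq_iff)
  then show "AE s in \<nu>. G s = blinfun_apply (f s) (F s)"
    by eventually_elim simp
next
  assume *: "AE s in \<nu>. G s = blinfun_apply (f s) (F s)"
  have **: "(\<lambda>s. blinfun_apply (f s) (F s)) \<in> L2_functions \<nu>"
    by (rule L2_cong_AE[OF G L0wo_apply[OF f L2_measurable[OF F]] *])
  then have "L2_class \<nu> G = L2_class \<nu> (\<lambda>s. blinfun_apply (f s) (F s))"
    using * G by (simp add: L2_class_eq_iff)
  then show "(L2_class \<nu> F, L2_class \<nu> G) \<in> mult_operator \<nu> f"
    unfolding mult_operator_def using F ** by auto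
qed

lemma mult_operator_cases_AE:
  assumes "(a, b) \<in> mult_operator \<nu> f"
  obtains F G where "F \<in> L2_functions \<nu>" "G \<in> L2_functions \<nu>" "a = L2_class \<nu> F" "b = L2_class \<nu> G"
    "AE s in \<nu>. G s = blinfun_apply (f s) (F s)"
proof -
  obtain F where "F \<in> L2_functions \<nu>" "(\<lambda>s. blinfun_apply (f s) (F s)) \<in> L2_functions \<nu>"
    "a = L2_class \<nu> F" "b = L2_class \<nu> (\<lambda>s. blinfun_apply (f s) (F s))"
    using assms by (rule mult_operator_cases)
  then show thesis by (rule that) simp
qed

lemma mult_operator_carrier:
  "mult_operator \<nu> f \<subseteq> hcarrier (L2_space \<nu>) \<times> hcarrier (L2_space \<nu>)"
  by (auto elim!: mult_operator_cases)

lemma L2_operator_eqI: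
  assumes "x \<subseteq> hcarrier (L2_space \<nu>) \<times> hcarrier (L2_space \<nu>)"
    and "y \<subseteq> hcarrier (L2_space \<nu>) \<times> hcarrier (L2_space \<nu>)"
    and "\<And>F G. F \<in> L2_functions \<nu> \<Longrightarrow> G \<in> L2_functions \<nu> \<Longrightarrow>
      (L2_class \<nu> F, L2_class \<nu> G) \<in> x \<longleftrightarrow> (L2_class \<nu> F, L2_class \<nu> G) \<in> y"
  shows "x = y"
proof -
  have "(a, b) \<in> x \<longleftrightarrow> (a, b) \<in> y" if "a \<in> hcarrier (L2_space \<nu>)" "b \<in> hcarrier (L2_space \<nu>)" for a b
    using that assms(3) by (auto simp: L2_carrier_iff)
  then show ?thesis using assms(1,2) by blast
qed

lemma mult_operator_cong:
  fixes f :: "'s \<Rightarrow> 'h::{complex_hilbert, second_countable_topology} \<Rightarrow>\<^sub>L 'h"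
  assumes "f \<in> L0wo_functions \<nu>" "g \<in> L0wo_functions \<nu>" "AE s in \<nu>. f s = g s"
  shows "mult_operator \<nu> f = mult_operator \<nu> g"
proof (rule L2_operator_eqI[OF mult_operator_carrier mult_operator_carrier])
  fix F G :: "'s \<Rightarrow> 'h" assume "F \<in> L2_functions \<nu>" "G \<in> L2_functions \<nu>"
  moreover have "(AE s in \<nu>. G s = blinfun_apply (f s) (F s)) \<longleftrightarrow> (AE s in \<nu>. G s = blinfun_apply (g s) (F s))"
    by (rule eventually_subst) (use assms(3) in \<open>auto elim: eventually_mono\<close>)
  ultimately show "(L2_class \<nu> F, L2_class \<nu> G) \<in> mult_operator \<nu> f \<longleftrightarrow>
      (L2_class \<nu> F, L2_class \<nu> G) \<in> mult_operator \<nu> g"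
    using assms by (simp add: mult_operator_iff)
qed

lemma mult_operator_linear:
  fixes f :: "'s \<Rightarrow> 'h::{complex_hilbert, second_countable_topology} \<Rightarrow>\<^sub>L 'h"
  assumes f: "f \<in> L0wo_functions \<nu>"
  shows "linear_operator (L2_space \<nu>) (mult_operator \<nu> f)"
  unfolding linear_operator_def
proof (intro conjI allI impI)
  show "mult_operator \<nu> f \<subseteq> hcarrier (L2_space \<nu>) \<times> hcarrier (L2_space \<nu>)"
    by (rule mult_operator_carrier)
  show "(hzero (L2_space \<nu>), hzero (L2_space \<nu>)) \<in> mult_operator \<nu> f"
    by (simp add: hzero_L2 mult_operator_iff[OF f])
  show "single_valued (mult_operator \<nu> f)"
  proof (rule single_valuedI)
    fix a b c assume "(a, b) \<in> mult_operator \<nu> f" "(a, c) \<in> mult_operator \<nu> f"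
    then obtain F where ab: "(a, b) \<in> mult_operator \<nu> f" and F: "F \<in> L2_functions \<nu>" "a = L2_class \<nu> F"
      and ac: "(L2_class \<nu> F, c) \<in> mult_operator \<nu> f"
      by (auto elim: mult_operator_cases)
    obtain G G' where G: "G \<in> L2_functions \<nu>" "b = L2_class \<nu> G" "G' \<in> L2_functions \<nu>" "c = L2_class \<nu> G'"
      using ab ac by (auto elim!: mult_operator_cases)
    have "AE s in \<nu>. G s = blinfun_apply (f s) (F s)" "AE s in \<nu>. G' s = blinfun_apply (f s) (F s)"
      using ab ac by (simp_all add: F(2) G(2,4) mult_operator_iff[OF f F(1)] G(1,3))
    then have "AE s in \<nu>. G s = G' s"
      by eventually_elim simp
    then show "b = c"
      using G by (simp add: L2_class_eq_iff)
  qed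
  show "(hadd (L2_space \<nu>) a a', hadd (L2_space \<nu>) b b') \<in> mult_operator \<nu> f"
    if ab: "(a, b) \<in> mult_operator \<nu> f" and ab': "(a', b') \<in> mult_operator \<nu> f" for a b a' b'
  proof -
    obtain F G where *: "F \<in> L2_functions \<nu>" "G \<in> L2_functions \<nu>" "a = L2_class \<nu> F" "b = L2_class \<nu> G"
      "AE s in \<nu>. G s = blinfun_apply (f s) (F s)"
      using ab by (rule mult_operator_cases_AE)
    obtain F' G' where **: "F' \<in> L2_functions \<nu>" "G' \<in> L2_functions \<nu>" "a' = L2_class \<nu> F'" "b' = L2_class \<nu> G'"
      "AE s in \<nu>. G' s = blinfun_apply (f s) (F' s)"
      using ab' by (rule mult_operator_cases_AE)
    have "AE s in \<nu>. G s + G' s = blinfun_apply (f s) (F s + F' s)"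
      using *(5) **(5) by eventually_elim (simp add: blinfun.add_right)
    then show ?thesis
      using * ** by (simp add: hadd_L2 mult_operator_iff[OF f] L2_add)
  qed
  show "(hscale (L2_space \<nu>) c a, hscale (L2_space \<nu>) c b) \<in> mult_operator \<nu> f"
    if ab: "(a, b) \<in> mult_operator \<nu> f" for c a b
  proof -
    obtain F G where *: "F \<in> L2_functions \<nu>" "G \<in> L2_functions \<nu>" "a = L2_class \<nu> F" "b = L2_class \<nu> G"
      "AE s in \<nu>. G s = blinfun_apply (f s) (F s)"
      using ab by (rule mult_operator_cases_AE)
    have "AE s in \<nu>. c *\<^sub>C G s = blinfun_apply (f s) (c *\<^sub>C F s)"
      using *(5) AE_space by eventually_elim (simp add: BH_D[OF L0wo_BH[OF f]])
    then show ?thesis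
      using * by (simp add: hscale_L2 mult_operator_iff[OF f] L2_scale)
  qed
qed

lemma L2_mult_supported:
  fixes f :: "'s \<Rightarrow> 'h::{complex_hilbert, second_countable_topology} \<Rightarrow>\<^sub>L 'h"
  assumes f: "f \<in> L0wo_functions \<nu>" and F: "F \<in> L2_functions \<nu>"
    and le: "AE s in \<nu>. F s \<noteq> 0 \<longrightarrow> norm (f s) \<le> C"
  shows "(\<lambda>s. blinfun_apply (f s) (F s)) \<in> L2_functions \<nu>"
proof (rule L2_bounded_by(1)[OF F L0wo_apply[OF f L2_measurable[OF F]]])
  show "AE s in \<nu>. norm (blinfun_apply (f s) (F s)) \<le> C * norm (F s)"
    using le
  proof eventually_elim
    case (elim s)
    show ?case
    proof (cases "F s = 0")
      case False
      with elim show ?thesis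
        by (intro order_trans[OF norm_blinfun] mult_right_mono) auto
    qed simp
  qed
qed

lemma AE_bounded_levels: "AE s in \<nu>. eventually (\<lambda>n. (h s :: real) \<le> real n) sequentially"
proof (intro AE_I2)
  fix s
  obtain N where "h s \<le> real N" using real_arch_simple by blast
  then have "h s \<le> real n" if "n \<ge> N" for n
    using that by linarith
  then show "eventually (\<lambda>n. h s \<le> real n) sequentially"
    by (rule eventually_sequentiallyI)
qed

text \<open>
  On the set where \<open>norm (f s) \<le> m\<close> multiplication by \<open>f\<close> is continuous, and these sets exhaust
  the measure space.
\<close>

lemma mult_operator_closed:
  fixes f :: "'s \<Rightarrow> 'h::{complex_hilbert, second_countable_topology} \<Rightarrow>\<^sub>L 'h"
  assumes f: "f \<in> L0wo_functions \<nu>"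
  shows "closed_operator (L2_space \<nu>) (mult_operator \<nu> f)"
  unfolding closed_operator_def
proof (rule subrelI)
  fix a b assume "(a, b) \<in> op_closure (L2_space \<nu>) (mult_operator \<nu> f)"
  from L2_op_closure_cases[OF mult_operator_carrier this]
  obtain F G U V where FG: "F \<in> L2_functions \<nu>" "G \<in> L2_functions \<nu>" "a = L2_class \<nu> F" "b = L2_class \<nu> G"
    and UV: "\<And>n. U n \<in> L2_functions \<nu>" "\<And>n. V n \<in> L2_functions \<nu>"
    "\<And>n. (L2_class \<nu> (U n), L2_class \<nu> (V n)) \<in> mult_operator \<nu> f"
    and lim: "(\<lambda>n. L2_norm \<nu> (\<lambda>s. U n s - F s)) \<longlonglongrightarrow> 0" "(\<lambda>n. L2_norm \<nu> (\<lambda>s. V n s - G s)) \<longlonglongrightarrow> 0"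
    by blast
  have V_eq: "AE s in \<nu>. V n s = blinfun_apply (f s) (U n s)" for n
    using UV(3)[of n] by (simp add: mult_operator_iff[OF f UV(1,2)])
  have "AE s in \<nu>. norm (f s) \<le> real m \<longrightarrow> G s = blinfun_apply (f s) (F s)" for m
  proof -
    define P where "P s \<longleftrightarrow> norm (f s) \<le> real m" for s
    have P: "Measurable.pred \<nu> P"
      unfolding P_def[abs_def] using L0wo_norm[OF f] by measurable
    define g where "g s = (if P s then f s else 0)" for s
    have g: "g \<in> L0wo_functions \<nu>"
      unfolding g_def[abs_def] by (intro L0wo_If f L0wo_const BH_zero P)
    have g_le: "AE s in \<nu>. norm (g s) \<le> real m"
      by (auto simp: g_def P_def)
    let ?cut = "\<lambda>W s. if P s then W s else 0 :: 'h"
    have gF: "(\<lambda>s. blinfun_apply (g s) (F s)) \<in> L2_functions \<nu>"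
      by (rule L2_mult(1)[OF g FG(1) g_le])
    have lim1: "(\<lambda>n. L2_norm \<nu> (\<lambda>s. ?cut (V n) s - ?cut G s)) \<longlonglongrightarrow> 0"
      by (rule L2_cut_tendsto[OF UV(2) FG(2) P lim(2)])
    have lim2: "(\<lambda>n. L2_norm \<nu> (\<lambda>s. ?cut (V n) s - blinfun_apply (g s) (F s))) \<longlonglongrightarrow> 0"
    proof (rule tendsto_sandwich[OF _ _ tendsto_const])
      show "(\<lambda>n. real m * L2_norm \<nu> (\<lambda>s. U n s - F s)) \<longlonglongrightarrow> 0"
        using tendsto_mult_right_zero[OF lim(1)] by simp
      have "L2_norm \<nu> (\<lambda>s. ?cut (V n) s - blinfun_apply (g s) (F s)) \<le> real m * L2_norm \<nu> (\<lambda>s. U n s - F s)" for n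
      proof -
        have "L2_norm \<nu> (\<lambda>s. ?cut (V n) s - blinfun_apply (g s) (F s))
            = L2_norm \<nu> (\<lambda>s. blinfun_apply (g s) (U n s - F s))"
        proof (rule L2_norm_cong_AE)
          show "AE s in \<nu>. ?cut (V n) s - blinfun_apply (g s) (F s) = blinfun_apply (g s) (U n s - F s)"
            using V_eq[of n] by eventually_elim (auto simp: g_def blinfun.diff_right)
          show "(\<lambda>s. ?cut (V n) s - blinfun_apply (g s) (F s)) \<in> borel_measurable \<nu>"
            by (intro L2_measurable L2_diff L2_If gF UV P)
          show "(\<lambda>s. blinfun_apply (g s) (U n s - F s)) \<in> borel_measurable \<nu>"
            by (intro L2_measurable L2_mult(1)[OF g _ g_le] L2_diff UV FG)
        qed
        also have "\<dots> \<le> real m * L2_norm \<nu> (\<lambda>s. U n s - F s)"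
          by (rule L2_mult(2)[OF g L2_diff[OF UV(1) FG(1)] g_le]) simp
        finally show ?thesis .
      qed
      then show "\<forall>\<^sub>F n in sequentially. L2_norm \<nu> (\<lambda>s. ?cut (V n) s - blinfun_apply (g s) (F s)) \<le> real m * L2_norm \<nu> (\<lambda>s. U n s - F s)"
        by simp
    qed simp
    have "AE s in \<nu>. ?cut G s = blinfun_apply (g s) (F s)"
      by (rule L2_limit_unique[OF _ _ gF lim1 lim2]) (intro L2_If UV FG P)+
    then show ?thesis
      by eventually_elim (auto simp: g_def P_def)
  qed
  then have "AE s in \<nu>. \<forall>m. norm (f s) \<le> real m \<longrightarrow> G s = blinfun_apply (f s) (F s)"
    by (intro AE_all_countable[THEN iffD2] allI)
  then have "AE s in \<nu>. G s = blinfun_apply (f s) (F s)"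
    by eventually_elim (meson real_arch_simple)
  then show "(a, b) \<in> mult_operator \<nu> f"
    using FG by (simp add: mult_operator_iff[OF f])
qed

lemma op_closure_mono: "x \<subseteq> y \<Longrightarrow> op_closure K x \<subseteq> op_closure K y"
  unfolding op_closure_def by blast

text \<open>
  Truncation commutes with multiplication by \<open>f\<close>, so the truncations of \<open>F\<close> converge to \<open>F\<close> and
  their images to \<open>f F\<close>. A restriction that contains all of them is therefore a core.
\<close>

lemma mult_operator_core:
  fixes f :: "'s \<Rightarrow> 'h::{complex_hilbert, second_countable_topology} \<Rightarrow>\<^sub>L 'h"
  assumes f: "f \<in> L0wo_functions \<nu>" and sub: "x \<subseteq> mult_operator \<nu> f"
    and P: "\<And>n. Measurable.pred \<nu> (P n)" "AE s in \<nu>. eventually (\<lambda>n. P n s) sequentially"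
    and core: "\<And>F n. F \<in> L2_functions \<nu> \<Longrightarrow> (\<lambda>s. blinfun_apply (f s) (F s)) \<in> L2_functions \<nu> \<Longrightarrow>
      (L2_class \<nu> (\<lambda>s. if P n s then F s else 0),
       L2_class \<nu> (\<lambda>s. if P n s then blinfun_apply (f s) (F s) else 0)) \<in> x"
  shows "op_closure (L2_space \<nu>) x = mult_operator \<nu> f"
proof
  show "op_closure (L2_space \<nu>) x \<subseteq> mult_operator \<nu> f"
    using op_closure_mono[OF sub] mult_operator_closed[OF f] unfolding closed_operator_def by blast
  show "mult_operator \<nu> f \<subseteq> op_closure (L2_space \<nu>) x"
  proof (rule subrelI)
    fix a b assume "(a, b) \<in> mult_operator \<nu> f"
    then obtain F where F: "F \<in> L2_functions \<nu>" "(\<lambda>s. blinfun_apply (f s) (F s)) \<in> L2_functions \<nu>"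
      "a = L2_class \<nu> F" "b = L2_class \<nu> (\<lambda>s. blinfun_apply (f s) (F s))"
      by (rule mult_operator_cases)
    show "(a, b) \<in> op_closure (L2_space \<nu>) x"
      unfolding F(3,4)
      by (rule L2_op_closureI[where U = "\<lambda>n s. if P n s then F s else 0"
            and V = "\<lambda>n s. if P n s then blinfun_apply (f s) (F s) else 0"])
        (intro core F L2_truncation_tendsto L2_If P)+
  qed
qed

lemma mult_operator_densely_defined:
  fixes f :: "'s \<Rightarrow> 'h::{complex_hilbert, second_countable_topology} \<Rightarrow>\<^sub>L 'h"
  assumes f: "f \<in> L0wo_functions \<nu>"
  shows "densely_defined (L2_space \<nu>) (mult_operator \<nu> f)"
  unfolding densely_defined_def
proof (intro ballI allI impI)
  fix a :: "('s \<Rightarrow> 'h) set" and e :: real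
  assume "a \<in> hcarrier (L2_space \<nu>)" and e: "e > 0"
  then obtain F where F: "F \<in> L2_functions \<nu>" "a = L2_class \<nu> F"
    by (auto simp: L2_carrier_iff)
  define P where "P n s \<longleftrightarrow> norm (f s) \<le> real n" for n s
  have P: "Measurable.pred \<nu> (P n)" for n
    unfolding P_def[abs_def] using L0wo_norm[OF f] by measurable
  let ?F = "\<lambda>n s. if P n s then F s else 0"
  have "(\<lambda>n. L2_norm \<nu> (\<lambda>s. ?F n s - F s)) \<longlonglongrightarrow> 0"
    by (rule L2_truncation_tendsto[OF F(1) P]) (simp add: P_def AE_bounded_levels)
  then have "\<forall>\<^sub>F n in sequentially. L2_norm \<nu> (\<lambda>s. ?F n s - F s) < e"
    using e by (rule order_tendstoD(2))
  then obtain n where n: "L2_norm \<nu> (\<lambda>s. ?F n s - F s) < e"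
    using eventually_happens'[OF sequentially_bot] by blast
  have FL: "?F n \<in> L2_functions \<nu>"
    by (rule L2_If(1)[OF F(1) P])
  have fF: "(\<lambda>s. blinfun_apply (f s) (?F n s)) \<in> L2_functions \<nu>"
    by (rule L2_mult_supported[OF f FL, of "real n"]) (simp add: P_def)
  have "(L2_class \<nu> (?F n), L2_class \<nu> (\<lambda>s. blinfun_apply (f s) (?F n s))) \<in> mult_operator \<nu> f"
    by (simp add: mult_operator_iff[OF f FL fF])
  moreover have "hdist (L2_space \<nu>) (L2_class \<nu> (?F n)) a < e"
    using n by (simp add: F(2) hdist_L2[OF FL F(1)])
  ultimately show "\<exists>b\<in>Domain (mult_operator \<nu> f). hdist (L2_space \<nu>) b a < e"
    by blast
qed

lemma mult_operator_bounded:
  fixes f :: "'s \<Rightarrow> 'h::{complex_hilbert, second_countable_topology} \<Rightarrow>\<^sub>L 'h"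
  assumes f: "f \<in> L0wo_functions \<nu>" and le: "AE s in \<nu>. norm (f s) \<le> C"
  shows "mult_operator \<nu> f \<in> bounded_operators (L2_space \<nu>)"
  unfolding bounded_operators_def
proof (intro CollectI conjI)
  show "linear_operator (L2_space \<nu>) (mult_operator \<nu> f)"
    by (rule mult_operator_linear[OF f])
  show "Domain (mult_operator \<nu> f) = hcarrier (L2_space \<nu>)"
  proof
    show "Domain (mult_operator \<nu> f) \<subseteq> hcarrier (L2_space \<nu>)"
      using mult_operator_carrier by auto
    show "hcarrier (L2_space \<nu>) \<subseteq> Domain (mult_operator \<nu> f)"
    proof
      fix a :: "('s \<Rightarrow> 'h) set" assume "a \<in> hcarrier (L2_space \<nu>)"
      then obtain F where F: "F \<in> L2_functions \<nu>" "a = L2_class \<nu> F"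
        by (auto simp: L2_carrier_iff)
      then show "a \<in> Domain (mult_operator \<nu> f)"
        using L2_mult(1)[OF f F(1) le] unfolding mult_operator_def by blast
    qed
  qed
  have le': "AE s in \<nu>. norm (f s) \<le> max C 0"
    using le by eventually_elim simp
  show "\<exists>C. \<forall>(a, b)\<in>mult_operator \<nu> f. hnorm (L2_space \<nu>) b \<le> C * hnorm (L2_space \<nu>) a"
  proof (intro exI[of _ "max C 0"] ballI, clarify)
    fix a b assume "(a, b) \<in> mult_operator \<nu> f"
    then show "hnorm (L2_space \<nu>) b \<le> max C 0 * hnorm (L2_space \<nu>) a"
      by (rule mult_operator_cases) (use L2_mult(2)[OF f _ le'] in \<open>auto simp: hnorm_L2\<close>)
  qed
qed

text \<open>
  If \<open>g\<close> multiplies every square integrable function to a square integrable one, then \<open>f (g F)\<close>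
  being square integrable is the only condition on both sides.
\<close>

lemma mult_operator_comp:
  fixes f :: "'s \<Rightarrow> 'h::{complex_hilbert, second_countable_topology} \<Rightarrow>\<^sub>L 'h"
  assumes f: "f \<in> L0wo_functions \<nu>" and g: "g \<in> L0wo_functions \<nu>"
    and bdd: "mult_operator \<nu> g \<in> bounded_operators (L2_space \<nu>)"
  shows "mult_operator \<nu> g O mult_operator \<nu> f = mult_operator \<nu> (\<lambda>s. f s o\<^sub>L g s)"
proof (rule L2_operator_eqI)
  show "mult_operator \<nu> g O mult_operator \<nu> f \<subseteq> hcarrier (L2_space \<nu>) \<times> hcarrier (L2_space \<nu>)"
    using mult_operator_carrier by blast
  fix F G :: "'s \<Rightarrow> 'h" assume F: "F \<in> L2_functions \<nu>" and G: "G \<in> L2_functions \<nu>"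
  show "(L2_class \<nu> F, L2_class \<nu> G) \<in> mult_operator \<nu> g O mult_operator \<nu> f \<longleftrightarrow>
      (L2_class \<nu> F, L2_class \<nu> G) \<in> mult_operator \<nu> (\<lambda>s. f s o\<^sub>L g s)"
  proof
    assume "(L2_class \<nu> F, L2_class \<nu> G) \<in> mult_operator \<nu> g O mult_operator \<nu> f"
    then obtain b where b: "(L2_class \<nu> F, b) \<in> mult_operator \<nu> g" "(b, L2_class \<nu> G) \<in> mult_operator \<nu> f"
      by blast
    then have "b \<in> hcarrier (L2_space \<nu>)"
      using mult_operator_carrier by blast
    then obtain B where B: "B \<in> L2_functions \<nu>" "b = L2_class \<nu> B"
      by (auto simp: L2_carrier_iff)
    have "AE s in \<nu>. B s = blinfun_apply (g s) (F s)" "AE s in \<nu>. G s = blinfun_apply (f s) (B s)"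
      using b by (simp_all add: B mult_operator_iff f g F G)
    then have "AE s in \<nu>. G s = blinfun_apply (f s o\<^sub>L g s) (F s)"
      by eventually_elim simp
    then show "(L2_class \<nu> F, L2_class \<nu> G) \<in> mult_operator \<nu> (\<lambda>s. f s o\<^sub>L g s)"
      by (simp add: mult_operator_iff L0wo_compose f g F G)
  next
    assume "(L2_class \<nu> F, L2_class \<nu> G) \<in> mult_operator \<nu> (\<lambda>s. f s o\<^sub>L g s)"
    then have *: "AE s in \<nu>. G s = blinfun_apply (f s) (blinfun_apply (g s) (F s))"
      by (simp add: mult_operator_iff L0wo_compose f g F G)
    have "L2_class \<nu> F \<in> Domain (mult_operator \<nu> g)"
      using bdd F by (simp add: bounded_operators_def)
    then obtain F' where F': "F' \<in> L2_functions \<nu>" "(\<lambda>s. blinfun_apply (g s) (F' s)) \<in> L2_functions \<nu>"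
      "L2_class \<nu> F = L2_class \<nu> F'"
      by (auto elim: mult_operator_cases)
    have "AE s in \<nu>. blinfun_apply (g s) (F' s) = blinfun_apply (g s) (F s)"
      using F' F by (auto simp: L2_class_eq_iff elim: eventually_mono)
    then have gF: "(\<lambda>s. blinfun_apply (g s) (F s)) \<in> L2_functions \<nu>"
      by (rule L2_cong_AE[OF F'(2) L0wo_apply[OF g L2_measurable[OF F]]])
    show "(L2_class \<nu> F, L2_class \<nu> G) \<in> mult_operator \<nu> g O mult_operator \<nu> f"
      by (rule relcompI[of _ "L2_class \<nu> (\<lambda>s. blinfun_apply (g s) (F s))"])
        (use * in \<open>simp_all add: mult_operator_iff f g F G gF\<close>)
  qed
qed (rule mult_operator_carrier)

text \<open>
  Testing against \<open>f\<^sup>* B - C\<close> cut down to the set where \<open>f\<close> is bounded shows that the adjoint is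
  no larger than multiplication by \<open>f\<^sup>*\<close>.
\<close>

lemma mult_operator_adj:
  fixes f :: "'s \<Rightarrow> 'h::{complex_hilbert, second_countable_topology} \<Rightarrow>\<^sub>L 'h"
  assumes f: "f \<in> L0wo_functions \<nu>"
  shows "op_adj (L2_space \<nu>) (mult_operator \<nu> f) = mult_operator \<nu> (\<lambda>s. BH_adj (f s))"
proof (rule L2_operator_eqI)
  show "op_adj (L2_space \<nu>) (mult_operator \<nu> f) \<subseteq> hcarrier (L2_space \<nu>) \<times> hcarrier (L2_space \<nu>)"
    by (auto simp: op_adj_def)
  fix B C :: "'s \<Rightarrow> 'h" assume B: "B \<in> L2_functions \<nu>" and C: "C \<in> L2_functions \<nu>"
  have af: "(\<lambda>s. BH_adj (f s)) \<in> L0wo_functions \<nu>"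
    by (rule L0wo_adj[OF f])
  have adj_iff: "(L2_class \<nu> B, L2_class \<nu> C) \<in> op_adj (L2_space \<nu>) (mult_operator \<nu> f) \<longleftrightarrow>
    (\<forall>F\<in>L2_functions \<nu>. (\<lambda>s. blinfun_apply (f s) (F s)) \<in> L2_functions \<nu> \<longrightarrow>
      (\<integral>s. cinner (blinfun_apply (f s) (F s)) (B s) \<partial>\<nu>) = (\<integral>s. cinner (F s) (C s) \<partial>\<nu>))"
    (is "_ \<longleftrightarrow> ?R")
  proof -
    have "(L2_class \<nu> B, L2_class \<nu> C) \<in> op_adj (L2_space \<nu>) (mult_operator \<nu> f) \<longleftrightarrow>
      (\<forall>(a, d)\<in>mult_operator \<nu> f. hinner (L2_space \<nu>) d (L2_class \<nu> B) = hinner (L2_space \<nu>) a (L2_class \<nu> C))"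
      by (simp add: op_adj_def B C)
    also have "\<dots> \<longleftrightarrow> (\<forall>F\<in>L2_functions \<nu>. (\<lambda>s. blinfun_apply (f s) (F s)) \<in> L2_functions \<nu> \<longrightarrow>
        hinner (L2_space \<nu>) (L2_class \<nu> (\<lambda>s. blinfun_apply (f s) (F s))) (L2_class \<nu> B)
          = hinner (L2_space \<nu>) (L2_class \<nu> F) (L2_class \<nu> C))"
      unfolding mult_operator_def by blast
    also have "\<dots> \<longleftrightarrow> ?R"
      by (simp add: hinner_L2 B C cong: ball_cong imp_cong)
    finally show ?thesis .
  qed
  show "(L2_class \<nu> B, L2_class \<nu> C) \<in> op_adj (L2_space \<nu>) (mult_operator \<nu> f) \<longleftrightarrow>
      (L2_class \<nu> B, L2_class \<nu> C) \<in> mult_operator \<nu> (\<lambda>s. BH_adj (f s))"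
    unfolding adj_iff mult_operator_iff[OF af B C]
  proof
    assume *: "AE s in \<nu>. C s = blinfun_apply (BH_adj (f s)) (B s)"
    show ?R
    proof (intro ballI impI)
      fix F assume F: "F \<in> L2_functions \<nu>" "(\<lambda>s. blinfun_apply (f s) (F s)) \<in> L2_functions \<nu>"
      show "(\<integral>s. cinner (blinfun_apply (f s) (F s)) (B s) \<partial>\<nu>) = (\<integral>s. cinner (F s) (C s) \<partial>\<nu>)"
      proof (rule integral_cong_AE)
        show "AE s in \<nu>. cinner (blinfun_apply (f s) (F s)) (B s) = cinner (F s) (C s)"
          using * AE_space by eventually_elim (simp add: cinner_BH_adj L0wo_BH[OF f])
      qed (intro borel_measurable_cinner L2_measurable F B C)+
    qed
  next
    assume R: ?R
    let ?E = "\<lambda>s. blinfun_apply (BH_adj (f s)) (B s) - C s"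
    have E: "?E \<in> borel_measurable \<nu>"
      by (intro borel_measurable_diff L0wo_apply af L2_measurable B C)
    have "AE s in \<nu>. norm (f s) \<le> real m \<longrightarrow> ?E s = 0" for m
    proof -
      define P where "P s \<longleftrightarrow> norm (f s) \<le> real m" for s
      have P: "Measurable.pred \<nu> P"
        unfolding P_def[abs_def] using L0wo_norm[OF f] by measurable
      define F where "F s = (if P s then ?E s else 0)" for s
      have F_meas: "F \<in> borel_measurable \<nu>"
        unfolding F_def[abs_def] using E P by measurable
      have "norm (if P s then blinfun_apply (BH_adj (f s)) (B s) else 0) \<le> real m * norm (B s)"
        if "s \<in> space \<nu>" for s
        using norm_BH_adj_le[OF L0wo_BH[OF f that]] 
        by (auto simp: P_def intro!: order_trans[OF norm_blinfun] mult_right_mono)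
      moreover have "(\<lambda>s. if P s then blinfun_apply (BH_adj (f s)) (B s) else 0) \<in> borel_measurable \<nu>"
        using L0wo_apply[OF af L2_measurable[OF B]] P by measurable
      ultimately have "(\<lambda>s. if P s then blinfun_apply (BH_adj (f s)) (B s) else 0) \<in> L2_functions \<nu>"
        by (intro L2_bounded_by(1)[OF B _ AE_I2])
      from L2_diff[OF this L2_If(1)[OF C P]] have F: "F \<in> L2_functions \<nu>"
        by (rule L2_cong_AE[OF _ F_meas]) (auto simp: F_def)
      have fF: "(\<lambda>s. blinfun_apply (f s) (F s)) \<in> L2_functions \<nu>"
        by (rule L2_mult_supported[OF f F, of "real m"]) (simp add: F_def P_def)
      have "(\<integral>s. complex_of_real ((norm (F s))\<^sup>2) \<partial>\<nu>)
          = (\<integral>s. cinner (blinfun_apply (f s) (F s)) (B s) - cinner (F s) (C s) \<partial>\<nu>)"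
      proof (rule Bochner_Integration.integral_cong[OF refl])
        fix s assume s: "s \<in> space \<nu>"
        have "cinner (blinfun_apply (f s) (F s)) (B s) - cinner (F s) (C s) = cinner (F s) (?E s)"
          by (simp add: cinner_BH_adj[OF L0wo_BH[OF f s]] cinner.diff_right)
        also have "\<dots> = cinner (F s) (F s)"
          by (simp add: F_def cinner.zero_left)
        finally show "complex_of_real ((norm (F s))\<^sup>2) = cinner (blinfun_apply (f s) (F s)) (B s) - cinner (F s) (C s)"
          by (simp add: cinner_self)
      qed
      also have "\<dots> = 0"
        using R F fF L2_inner_integrable[OF fF B] L2_inner_integrable[OF F C] by simp
      finally have "L2_norm \<nu> F = 0"
        unfolding integral_complex_of_real L2_norm_def by simp
      then have "AE s in \<nu>. F s = 0"
        by (simp add: L2_norm_eq_0[OF F])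
      then show ?thesis
        by eventually_elim (auto simp: F_def P_def)
    qed
    then have "AE s in \<nu>. \<forall>m. norm (f s) \<le> real m \<longrightarrow> ?E s = 0"
      by (intro AE_all_countable[THEN iffD2] allI)
    then show "AE s in \<nu>. C s = blinfun_apply (BH_adj (f s)) (B s)"
      by eventually_elim (metis eq_iff_diff_eq_0 real_arch_simple)
  qed
qed (rule mult_operator_carrier)

text \<open>
  Constant functions are not square integrable over a space of infinite measure. A positive weight
  \<open>h\<close> turns every vector \<open>\<xi>\<close> into a square integrable function \<open>h \<xi>\<close> that vanishes nowhere unless
  \<open>\<xi> = 0\<close>.
\<close>

lemma sigma_finite_weight:
  assumes "sigma_finite_measure \<nu>"
  obtains h :: "'s \<Rightarrow> real" where "h \<in> borel_measurable \<nu>" "\<forall>s. 0 < h s"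
    "integrable \<nu> (\<lambda>s. (h s)\<^sup>2)"
proof (rule sigma_finite_measure.obtain_positive_integrable_function[OF assms])
  fix g :: "'s \<Rightarrow> real"
  assume g: "g \<in> borel_measurable \<nu>" "\<And>s. 0 < g s" "\<And>s. g s \<le> 1" "integrable \<nu> g"
  show thesis
  proof (rule that[of "\<lambda>s. sqrt (g s)"])
    show "integrable \<nu> (\<lambda>s. (sqrt (g s))\<^sup>2)"
      using g(2,4) by (simp add: less_imp_le)
  qed (use g in auto)
qed

lemma L2_weight_const:
  fixes \<xi> :: "'h::{complex_hilbert, second_countable_topology}"
  assumes "h \<in> borel_measurable \<nu>" "integrable \<nu> (\<lambda>s. (h s)\<^sup>2)"
  shows "(\<lambda>s. h s *\<^sub>R \<xi>) \<in> L2_functions \<nu>"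
  using assms by (simp add: L2_functions_def power_mult_distrib)

text \<open>
  The values at \<open>h \<xi>\<close>, cut down to sets where \<open>f\<close> is bounded, determine \<open>f s \<xi>\<close> for almost every
  \<open>s\<close>; countably many \<open>\<xi>\<close> suffice.
\<close>

lemma mult_operator_inject:
  fixes f :: "'s \<Rightarrow> 'h::{complex_hilbert, second_countable_topology} \<Rightarrow>\<^sub>L 'h"
  assumes sf: "sigma_finite_measure \<nu>" and f: "f \<in> L0wo_functions \<nu>" and g: "g \<in> L0wo_functions \<nu>"
    and eq: "mult_operator \<nu> f = mult_operator \<nu> g"
  shows "AE s in \<nu>. f s = g s"
proof -
  obtain h :: "'s \<Rightarrow> real" where h: "h \<in> borel_measurable \<nu>" "\<forall>s. 0 < h s" "integrable \<nu> (\<lambda>s. (h s)\<^sup>2)"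
    by (rule sigma_finite_weight[OF sf])
  obtain D :: "'h set" where D: "countable D" "closure D = UNIV"
    by (rule countable_dense_closure)
  have "AE s in \<nu>. norm (f s) \<le> real m \<longrightarrow> blinfun_apply (f s) \<xi> = blinfun_apply (g s) \<xi>" for m \<xi>
  proof -
    define P where "P s \<longleftrightarrow> norm (f s) \<le> real m" for s
    have P: "Measurable.pred \<nu> P"
      unfolding P_def[abs_def] using L0wo_norm[OF f] by measurable
    let ?F = "\<lambda>s. if P s then h s *\<^sub>R \<xi> else 0"
    have F: "?F \<in> L2_functions \<nu>"
      by (intro L2_If(1) L2_weight_const h P)
    have fF: "(\<lambda>s. blinfun_apply (f s) (?F s)) \<in> L2_functions \<nu>"
      by (rule L2_mult_supported[OF f F, of "real m"]) (simp add: P_def)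
    have "(L2_class \<nu> ?F, L2_class \<nu> (\<lambda>s. blinfun_apply (f s) (?F s))) \<in> mult_operator \<nu> g"
      unfolding eq[symmetric] by (simp add: mult_operator_iff[OF f F fF])
    then have "AE s in \<nu>. blinfun_apply (f s) (?F s) = blinfun_apply (g s) (?F s)"
      by (simp add: mult_operator_iff[OF g F fF])
    then show ?thesis
      using AE_space
    proof eventually_elim
      case (elim s)
      then show ?case
        using h(2)[rule_format, of s] by (auto simp: P_def blinfun.scaleR_right)
    qed
  qed
  then have "AE s in \<nu>. \<forall>\<xi>\<in>D. \<forall>m. norm (f s) \<le> real m \<longrightarrow> blinfun_apply (f s) \<xi> = blinfun_apply (g s) \<xi>"
    by (intro AE_ball_countable[OF D(1), THEN iffD2] ballI AE_all_countable[THEN iffD2] allI)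
  then show ?thesis
  proof eventually_elim
    case (elim s)
    obtain m where m: "norm (f s) \<le> real m" using real_arch_simple by blast
    have "norm (blinfun_apply (f s) \<xi> - blinfun_apply (g s) \<xi>) \<le> 0" for \<xi>
      by (rule le_on_closure[OF _ _ D(2)])
        (use elim m in \<open>auto intro!: continuous_intros\<close>)
    then show ?case by (intro blinfun_eqI) simp
  qed
qed

section \<open>Everywhere defined operators on the space of square integrable functions\<close>

text \<open>
  An everywhere defined operator on classes is described by a map on functions, determined up to
  null sets.
\<close>

definition represents ::
    "'s measure \<Rightarrow> ('s \<Rightarrow> 'h::{complex_hilbert, second_countable_topology}) set operator
      \<Rightarrow> (('s \<Rightarrow> 'h) \<Rightarrow> ('s \<Rightarrow> 'h)) \<Rightarrow> bool"
  where "represents \<nu> y T \<longleftrightarrow> (\<forall>F\<in>L2_functions \<nu>. T F \<in> L2_functions \<nu> \<and>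
    (\<forall>G\<in>L2_functions \<nu>. (L2_class \<nu> F, L2_class \<nu> G) \<in> y \<longleftrightarrow> (AE s in \<nu>. G s = T F s)))"

lemma represents_exists:
  fixes y :: "('s \<Rightarrow> 'h::{complex_hilbert, second_countable_topology}) set operator"
  assumes lin: "linear_operator (L2_space \<nu>) y" and dom: "Domain y = hcarrier (L2_space \<nu>)"
  obtains T where "represents \<nu> y T"
proof -
  have "\<exists>G\<in>L2_functions \<nu>. (L2_class \<nu> F, L2_class \<nu> G) \<in> y" if F: "F \<in> L2_functions \<nu>" for F :: "'s \<Rightarrow> 'h"
  proof -
    have "L2_class \<nu> F \<in> Domain y"
      unfolding dom using F by simp
    then obtain b where b: "(L2_class \<nu> F, b) \<in> y"
      by blast
    moreover have "b \<in> hcarrier (L2_space \<nu>)"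
      using b lin unfolding linear_operator_def by blast
    ultimately show ?thesis
      by (auto simp: L2_carrier_iff)
  qed
  then obtain T where T: "\<forall>F\<in>L2_functions \<nu>. T F \<in> L2_functions \<nu> \<and> (L2_class \<nu> F, L2_class \<nu> (T F)) \<in> y"
    by metis
  show thesis
  proof (rule that[of T], unfold represents_def, intro ballI conjI)
    fix F :: "'s \<Rightarrow> 'h" assume F: "F \<in> L2_functions \<nu>"
    then show TF: "T F \<in> L2_functions \<nu>"
      using T by blast
    fix G :: "'s \<Rightarrow> 'h" assume G: "G \<in> L2_functions \<nu>"
    have *: "(L2_class \<nu> F, L2_class \<nu> (T F)) \<in> y"
      using T F by blast
    show "(L2_class \<nu> F, L2_class \<nu> G) \<in> y \<longleftrightarrow> (AE s in \<nu>. G s = T F s)"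
    proof
      assume "(L2_class \<nu> F, L2_class \<nu> G) \<in> y"
      then show "AE s in \<nu>. G s = T F s"
        using * by (rule linear_operator_L2_unique[OF lin G TF])
    next
      assume "AE s in \<nu>. G s = T F s"
      then have "L2_class \<nu> G = L2_class \<nu> (T F)"
        by (simp add: L2_class_eq_iff G TF)
      with * show "(L2_class \<nu> F, L2_class \<nu> G) \<in> y" by simp
    qed
  qed
qed

lemma represents_in: "represents \<nu> y T \<Longrightarrow> F \<in> L2_functions \<nu> \<Longrightarrow> T F \<in> L2_functions \<nu>"
  by (simp add: represents_def)

lemma represents_iff:
  "represents \<nu> y T \<Longrightarrow> F \<in> L2_functions \<nu> \<Longrightarrow> G \<in> L2_functions \<nu> \<Longrightarrow>
    (L2_class \<nu> F, L2_class \<nu> G) \<in> y \<longleftrightarrow> (AE s in \<nu>. G s = T F s)"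
  by (simp add: represents_def)

lemma represents_pair:
  "represents \<nu> y T \<Longrightarrow> F \<in> L2_functions \<nu> \<Longrightarrow> (L2_class \<nu> F, L2_class \<nu> (T F)) \<in> y"
  by (simp add: represents_def)

lemma represents_cong:
  assumes T: "represents \<nu> y T" and F: "F \<in> L2_functions \<nu>" "F' \<in> L2_functions \<nu>"
    and eq: "AE s in \<nu>. F s = F' s"
  shows "AE s in \<nu>. T F s = T F' s"
proof -
  have "L2_class \<nu> F = L2_class \<nu> F'"
    using F eq by (simp add: L2_class_eq_iff)
  then have "(L2_class \<nu> F', L2_class \<nu> (T F)) \<in> y"
    using represents_pair[OF T F(1)] by simp
  then show ?thesis
    using represents_iff[OF T F(2) represents_in[OF T F(1)]] by simp
qed

lemma represents_add:
  assumes lin: "linear_operator (L2_space \<nu>) y" and T: "represents \<nu> y T"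
    and F: "F \<in> L2_functions \<nu>" "G \<in> L2_functions \<nu>"
  shows "AE s in \<nu>. T (\<lambda>s. F s + G s) s = T F s + T G s"
proof -
  have "(L2_class \<nu> (\<lambda>s. F s + G s), L2_class \<nu> (\<lambda>s. T F s + T G s)) \<in> y"
    by (intro linear_operator_L2_add[OF lin] represents_pair[OF T] represents_in[OF T] F)
  then have "AE s in \<nu>. T F s + T G s = T (\<lambda>s. F s + G s) s"
    by (simp add: represents_iff[OF T] L2_add represents_in[OF T] F)
  then show ?thesis
    by eventually_elim simp
qed

lemma represents_scale:
  assumes lin: "linear_operator (L2_space \<nu>) y" and T: "represents \<nu> y T"
    and F: "F \<in> L2_functions \<nu>"
  shows "AE s in \<nu>. T (\<lambda>s. c *\<^sub>C F s) s = c *\<^sub>C T F s"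
proof -
  have "(L2_class \<nu> (\<lambda>s. c *\<^sub>C F s), L2_class \<nu> (\<lambda>s. c *\<^sub>C T F s)) \<in> y"
    by (intro linear_operator_L2_scale[OF lin] represents_pair[OF T] represents_in[OF T] F)
  then have "AE s in \<nu>. c *\<^sub>C T F s = T (\<lambda>s. c *\<^sub>C F s) s"
    by (simp add: represents_iff[OF T] L2_scale represents_in[OF T] F)
  then show ?thesis
    by eventually_elim simp
qed

lemma represents_diff:
  assumes lin: "linear_operator (L2_space \<nu>) y" and T: "represents \<nu> y T"
    and F: "F \<in> L2_functions \<nu>" "G \<in> L2_functions \<nu>"
  shows "AE s in \<nu>. T (\<lambda>s. F s - G s) s = T F s - T G s"
  using represents_add[OF lin T F(1) L2_minus[OF F(2)]] represents_scale[OF lin T F(2), of "- 1"]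
  by eventually_elim (simp add: scaleC_minus_one)

lemma represents_commute:
  fixes f :: "'s \<Rightarrow> 'h::{complex_hilbert, second_countable_topology} \<Rightarrow>\<^sub>L 'h"
  assumes T: "represents \<nu> y T" and f: "f \<in> L0wo_functions \<nu>" and le: "AE s in \<nu>. norm (f s) \<le> C"
    and comm: "mult_operator \<nu> f O y = y O mult_operator \<nu> f"
    and F: "F \<in> L2_functions \<nu>" and F': "F' \<in> L2_functions \<nu>"
    and eq: "AE s in \<nu>. F' s = blinfun_apply (f s) (F s)"
  shows "AE s in \<nu>. T F' s = blinfun_apply (f s) (T F s)"
proof -
  have "(L2_class \<nu> F, L2_class \<nu> F') \<in> mult_operator \<nu> f"
    using eq by (simp add: mult_operator_iff[OF f F F'])
  then have "(L2_class \<nu> F, L2_class \<nu> (T F')) \<in> y O mult_operator \<nu> f"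
    unfolding comm[symmetric] using represents_pair[OF T F'] by blast
  then obtain b where b: "(L2_class \<nu> F, b) \<in> y" "(b, L2_class \<nu> (T F')) \<in> mult_operator \<nu> f"
    by blast
  then have "b \<in> hcarrier (L2_space \<nu>)"
    using mult_operator_carrier by blast
  then obtain B where B: "B \<in> L2_functions \<nu>" "b = L2_class \<nu> B"
    by (auto simp: L2_carrier_iff)
  have "AE s in \<nu>. B s = T F s" "AE s in \<nu>. T F' s = blinfun_apply (f s) (B s)"
    using b by (simp_all add: B represents_iff[OF T F B(1)] mult_operator_iff[OF f B(1) represents_in[OF T F']])
  then show ?thesis
    by eventually_elim simp
qed

lemma represents_eq_mult_operator:
  fixes f :: "'s \<Rightarrow> 'h::{complex_hilbert, second_countable_topology} \<Rightarrow>\<^sub>L 'h"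
  assumes lin: "linear_operator (L2_space \<nu>) y" and T: "represents \<nu> y T" and f: "f \<in> L0wo_functions \<nu>"
    and eq: "\<And>F. F \<in> L2_functions \<nu> \<Longrightarrow> AE s in \<nu>. T F s = blinfun_apply (f s) (F s)"
  shows "y = mult_operator \<nu> f"
proof (rule L2_operator_eqI[OF _ mult_operator_carrier])
  show "y \<subseteq> hcarrier (L2_space \<nu>) \<times> hcarrier (L2_space \<nu>)"
    using lin unfolding linear_operator_def by blast
  fix F G :: "'s \<Rightarrow> 'h" assume F: "F \<in> L2_functions \<nu>" and G: "G \<in> L2_functions \<nu>"
  have "(AE s in \<nu>. G s = T F s) \<longleftrightarrow> (AE s in \<nu>. G s = blinfun_apply (f s) (F s))"
    by (rule eventually_subst) (use eq[OF F] in \<open>auto elim: eventually_mono\<close>)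
  then show "(L2_class \<nu> F, L2_class \<nu> G) \<in> y \<longleftrightarrow> (L2_class \<nu> F, L2_class \<nu> G) \<in> mult_operator \<nu> f"
    by (simp add: represents_iff[OF T F G] mult_operator_iff[OF f F G])
qed

lemma represents_bounded:
  fixes y :: "('s \<Rightarrow> 'h::{complex_hilbert, second_countable_topology}) set operator"
  assumes y: "y \<in> bounded_operators (L2_space \<nu>)" and T: "represents \<nu> y T"
  obtains C where "0 \<le> C" "\<And>F. F \<in> L2_functions \<nu> \<Longrightarrow> L2_norm \<nu> (T F) \<le> C * L2_norm \<nu> F"
proof -
  obtain C where C: "\<forall>(a, b)\<in>y. hnorm (L2_space \<nu>) b \<le> C * hnorm (L2_space \<nu>) a"
    using y unfolding bounded_operators_def by blast
  show thesis
  proof (rule that[of "max C 0"])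
    fix F :: "'s \<Rightarrow> 'h" assume F: "F \<in> L2_functions \<nu>"
    have "L2_norm \<nu> (T F) \<le> C * L2_norm \<nu> F"
      using C represents_pair[OF T F] by (fastforce simp: hnorm_L2 F represents_in[OF T F])
    also have "\<dots> \<le> max C 0 * L2_norm \<nu> F"
      by (intro mult_right_mono) auto
    finally show "L2_norm \<nu> (T F) \<le> max C 0 * L2_norm \<nu> F" .
  qed simp
qed

lemma bounded_operators_linear: "y \<in> bounded_operators K \<Longrightarrow> linear_operator K y"
  and bounded_operators_Domain: "y \<in> bounded_operators K \<Longrightarrow> Domain y = hcarrier K"
  by (simp_all add: bounded_operators_def)

section \<open>Elementary tensors and their commutant\<close>

definition elementary_tensors ::
    "'s measure \<Rightarrow> ('s \<Rightarrow> 'h::{complex_hilbert, second_countable_topology}) set operator set"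
  where "elementary_tensors \<nu> =
    {mult_operator \<nu> (\<lambda>s. BH_scale (g s) a) | g a. g \<in> Linf_functions \<nu> \<and> a \<in> BH}"

lemma norm_BH_scale_le: "norm (BH_scale c a) \<le> cmod c * norm a"
proof (rule norm_blinfun_bound)
  show "norm (blinfun_apply (BH_scale c a) x) \<le> cmod c * norm a * norm x" for x
    using mult_left_mono[OF norm_blinfun[of a x], of "cmod c"]
    by (simp add: BH_scale_apply norm_scaleC mult.assoc)
qed simp

lemma elementary_tensor_L0wo:
  fixes a :: "'h::{complex_hilbert, second_countable_topology} \<Rightarrow>\<^sub>L 'h"
  assumes g: "g \<in> Linf_functions \<nu>" and a: "a \<in> BH"
  shows "(\<lambda>s. BH_scale (g s) a) \<in> L0wo_functions \<nu>"
    and "\<exists>C. AE s in \<nu>. norm (BH_scale (g s) a) \<le> C"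
proof -
  have g': "g \<in> borel_measurable \<nu>"
    using g by (simp add: Linf_functions_def)
  then show "(\<lambda>s. BH_scale (g s) a) \<in> L0wo_functions \<nu>"
    by (intro L0wo_scale L0wo_const a)
  obtain C where "AE s in \<nu>. cmod (g s) \<le> C"
    using g by (auto simp: Linf_functions_def)
  then have "AE s in \<nu>. norm (BH_scale (g s) a) \<le> C * norm a"
    by eventually_elim (rule order_trans[OF norm_BH_scale_le mult_right_mono], auto)
  then show "\<exists>C. AE s in \<nu>. norm (BH_scale (g s) a) \<le> C" ..
qed

definition rank_one :: "'h::complex_hilbert \<Rightarrow> 'h \<Rightarrow> 'h \<Rightarrow>\<^sub>L 'h"
  where "rank_one \<eta> \<xi> = Blinfun (\<lambda>x. cinner x \<xi> *\<^sub>C \<eta>)"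

lemma rank_one_apply: "blinfun_apply (rank_one \<eta> \<xi>) x = cinner x \<xi> *\<^sub>C \<eta>"
  unfolding rank_one_def
  by (simp add: bounded_linear_Blinfun_apply
      bounded_linear_compose[OF scaleC.bounded_linear_left cinner.bounded_linear_left])

lemma rank_one_in_BH: "rank_one \<eta> \<xi> \<in> BH"
  by (simp add: BH_def rank_one_apply cinner_scaleC_left scaleC_scaleC)

text \<open>
  For a unit vector \<open>e\<close> and a positive square integrable weight \<open>h\<close>, the function \<open>\<phi>\<close> is read off
  from the image of \<open>h e\<close>. Rank one operators carry \<open>h e\<close> to all \<open>u \<eta>\<close> with \<open>u\<close> dominated by a
  multiple of \<open>h\<close>, and carry an arbitrary \<open>F\<close> back to functions of the form \<open>u e\<close>.
\<close>

lemma commutant_elementary_tensors: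
  fixes y :: "('s \<Rightarrow> 'h::{complex_hilbert, second_countable_topology}) set operator"
  assumes sf: "sigma_finite_measure \<nu>"
    and y: "y \<in> commutant (L2_space \<nu>) (elementary_tensors \<nu>)"
  obtains \<phi> where "\<phi> \<in> borel_measurable \<nu>" "y = mult_operator \<nu> (\<lambda>s. BH_scale (\<phi> s) id_blinfun)"
proof -
  have bdd: "y \<in> bounded_operators (L2_space \<nu>)"
    using y by (simp add: commutant_def)
  note lin = bounded_operators_linear[OF bdd]
  obtain T where T: "represents \<nu> y T"
    by (rule represents_exists[OF lin bounded_operators_Domain[OF bdd]])
  have comm: "AE s in \<nu>. T F' s = g s *\<^sub>C blinfun_apply a (T F s)"
    if g: "g \<in> Linf_functions \<nu>" and a: "a \<in> BH" and F: "F \<in> L2_functions \<nu>" "F' \<in> L2_functions \<nu>"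
      and eq: "\<And>s. F' s = g s *\<^sub>C blinfun_apply a (F s)" for g a F F'
  proof -
    let ?f = "\<lambda>s. BH_scale (g s) a"
    obtain C where C: "AE s in \<nu>. norm (?f s) \<le> C"
      using elementary_tensor_L0wo(2)[OF g a] by blast
    have "mult_operator \<nu> ?f \<in> elementary_tensors \<nu>"
      unfolding elementary_tensors_def using g a by blast
    then have "mult_operator \<nu> ?f O y = y O mult_operator \<nu> ?f"
      using y by (simp add: commutant_def)
    from represents_commute[OF T elementary_tensor_L0wo(1)[OF g a] C this F]
    show ?thesis by (simp add: BH_scale_apply eq)
  qed
  have fin: "y = mult_operator \<nu> (\<lambda>s. BH_scale (\<phi> s) id_blinfun)"
    if "\<phi> \<in> borel_measurable \<nu>" "\<And>F. F \<in> L2_functions \<nu> \<Longrightarrow> AE s in \<nu>. T F s = \<phi> s *\<^sub>C F s" for \<phi>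
    using that
    by (intro represents_eq_mult_operator[OF lin T] L0wo_scale L0wo_const BH_id)
      (simp_all add: BH_scale_apply)
  show thesis
  proof (cases "\<exists>x::'h. x \<noteq> 0")
    case False
    then have "AE s in \<nu>. T F s = 0 *\<^sub>C F s" for F
      by (intro AE_I2) metis
    then show thesis
      by (intro that[of "\<lambda>s. 0"] fin) auto
  next
    case True
    then obtain e :: 'h where e: "norm e = 1"
      by (metis norm_sgn)
    then have ee: "cinner e e = 1"
      by (simp add: cinner_self)
    obtain h :: "'s \<Rightarrow> real" where h: "h \<in> borel_measurable \<nu>" "\<forall>s. 0 < h s" "integrable \<nu> (\<lambda>s. (h s)\<^sup>2)"
      by (rule sigma_finite_weight[OF sf])
    have h0: "h s \<noteq> 0" for s
      using h(2) by (metis less_irrefl)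
    define he where "he s = h s *\<^sub>R e" for s
    have he: "he \<in> L2_functions \<nu>"
      unfolding he_def[abs_def] by (rule L2_weight_const[OF h(1,3)])
    define \<phi> where "\<phi> s = cinner (T he s) e / complex_of_real (h s)" for s
    have Y: "T he \<in> L2_functions \<nu>"
      by (rule represents_in[OF T he])
    have hc: "(\<lambda>s. complex_of_real (h s)) \<in> borel_measurable \<nu>"
      using h(1) by measurable
    have \<phi>: "\<phi> \<in> borel_measurable \<nu>"
      unfolding \<phi>_def[abs_def]
      by (intro borel_measurable_divide borel_measurable_cinner L2_measurable[OF Y]
          borel_measurable_const hc)
    have scalar: "AE s in \<nu>. T (\<lambda>s. u s *\<^sub>C \<eta>) s = (\<phi> s * u s) *\<^sub>C \<eta>"
      if u: "u \<in> borel_measurable \<nu>" and u\<eta>: "(\<lambda>s. u s *\<^sub>C \<eta>) \<in> L2_functions \<nu>" for u :: "'s \<Rightarrow> complex" and \<eta>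
    proof -
      have "AE s in \<nu>. cmod (u s) \<le> real n * h s \<longrightarrow> T (\<lambda>s. u s *\<^sub>C \<eta>) s = (\<phi> s * u s) *\<^sub>C \<eta>" for n
      proof -
        define P where "P s \<longleftrightarrow> cmod (u s) \<le> real n * h s" for s
        have P: "Measurable.pred \<nu> P"
          unfolding P_def[abs_def] using u h(1) by measurable
        define g1 g2 where "g1 s = (if P s then u s / complex_of_real (h s) else 0)"
          and "g2 s = (if P s then 1 else 0 :: complex)" for s
        have g1: "g1 \<in> Linf_functions \<nu>"
        proof -
          have "g1 \<in> borel_measurable \<nu>"
            unfolding g1_def[abs_def] using u h(1) P by measurable
          moreover have "cmod (g1 s) \<le> real n" for s
            using h(2)[rule_format, of s] by (auto simp: g1_def P_def norm_divide pos_divide_le_eq)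
          ultimately show ?thesis
            unfolding Linf_functions_def by blast
        qed
        have g2: "g2 \<in> Linf_functions \<nu>"
        proof -
          have "g2 \<in> borel_measurable \<nu>"
            unfolding g2_def[abs_def] using P by measurable
          moreover have "cmod (g2 s) \<le> 1" for s
            by (simp add: g2_def)
          ultimately show ?thesis
            unfolding Linf_functions_def by blast
        qed
        let ?F = "\<lambda>s. if P s then u s *\<^sub>C \<eta> else 0"
        have F: "?F \<in> L2_functions \<nu>"
          by (rule L2_If(1)[OF u\<eta> P])
        have "AE s in \<nu>. T ?F s = g1 s *\<^sub>C blinfun_apply (rank_one \<eta> e) (T he s)"
          by (rule comm[OF g1 rank_one_in_BH he F])
            (simp add: g1_def he_def rank_one_apply cinner_scaleC_left ee scaleR_scaleC scaleC_scaleC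
              h0 scaleC.zero_left)
        moreover have "AE s in \<nu>. T ?F s = g2 s *\<^sub>C blinfun_apply id_blinfun (T (\<lambda>s. u s *\<^sub>C \<eta>) s)"
          by (rule comm[OF g2 BH_id u\<eta> F]) (simp add: g2_def scaleC.zero_left)
        ultimately show ?thesis
        proof eventually_elim
          case (elim s)
          then show ?case
            by (auto simp: P_def[symmetric] g1_def g2_def rank_one_apply scaleC_scaleC \<phi>_def mult.commute)
        qed
      qed
      then have "AE s in \<nu>. \<forall>n. cmod (u s) \<le> real n * h s \<longrightarrow> T (\<lambda>s. u s *\<^sub>C \<eta>) s = (\<phi> s * u s) *\<^sub>C \<eta>"
        by (intro AE_all_countable[THEN iffD2] allI)
      then show ?thesis
      proof eventually_elim
        case (elim s)
        obtain n where "cmod (u s) / h s \<le> real n"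
          using real_arch_simple by blast
        then have "cmod (u s) \<le> real n * h s"
          using h(2) by (simp add: pos_divide_le_eq)
        with elim show ?case by blast
      qed
    qed
    have "AE s in \<nu>. T F s = \<phi> s *\<^sub>C F s" if F: "F \<in> L2_functions \<nu>" for F
    proof -
      obtain D :: "'h set" where D: "countable D" "closure D = UNIV"
        by (rule countable_dense_closure)
      have one: "(\<lambda>s. 1) \<in> Linf_functions \<nu>"
        by (auto simp: Linf_functions_def intro!: exI[of _ 1])
      have "AE s in \<nu>. cinner (T F s) \<xi> = \<phi> s * cinner (F s) \<xi>" for \<xi>
      proof -
        have u: "(\<lambda>s. cinner (F s) \<xi>) \<in> borel_measurable \<nu>"
          by (intro borel_measurable_cinner L2_measurable[OF F] borel_measurable_const)
        have "norm (cinner (F s) \<xi> *\<^sub>C e) \<le> norm \<xi> * norm (F s)" for s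
          using cmod_cinner_le[of "F s" \<xi>] by (simp add: norm_scaleC e mult.commute)
        then have ue: "(\<lambda>s. cinner (F s) \<xi> *\<^sub>C e) \<in> L2_functions \<nu>"
          by (intro L2_bounded_by(1)[OF F _ AE_I2] borel_measurable_scaleC u borel_measurable_const)
        have "AE s in \<nu>. T (\<lambda>s. cinner (F s) \<xi> *\<^sub>C e) s = 1 *\<^sub>C blinfun_apply (rank_one e \<xi>) (T F s)"
          by (rule comm[OF one rank_one_in_BH F ue]) (simp add: rank_one_apply)
        then have "AE s in \<nu>. (\<phi> s * cinner (F s) \<xi>) *\<^sub>C e = cinner (T F s) \<xi> *\<^sub>C e"
          using scalar[OF u ue] by eventually_elim (simp add: rank_one_apply)
        then show ?thesis
        proof eventually_elim
          case (elim s)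
          then have "cinner ((\<phi> s * cinner (F s) \<xi>) *\<^sub>C e) e = cinner (cinner (T F s) \<xi> *\<^sub>C e) e"
            by simp
          then show ?case by (simp add: cinner_scaleC_left ee)
        qed
      qed
      then have "AE s in \<nu>. \<forall>\<xi>\<in>D. cinner (T F s) \<xi> = \<phi> s * cinner (F s) \<xi>"
        by (intro AE_ball_countable[OF D(1), THEN iffD2] ballI)
      then show ?thesis
      proof eventually_elim
        case (elim s)
        have "cmod (cinner (T F s - \<phi> s *\<^sub>C F s) \<xi>) \<le> 0" for \<xi>
          by (rule le_on_closure[OF _ _ D(2)])
            (use elim in \<open>auto simp: cinner.diff_left cinner_scaleC_left intro!: continuous_intros
              cinner.continuous_on\<close>)
        from this[of "T F s - \<phi> s *\<^sub>C F s"] show ?case by simp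
      qed
    qed
    then show thesis
      by (intro that[OF \<phi>] fin \<phi>)
  qed
qed

section \<open>Decomposable operators\<close>

lemma indicator_L0wo:
  assumes "Measurable.pred \<nu> P"
  shows "(\<lambda>s. if P s then id_blinfun else 0 :: 'h::{complex_hilbert, second_countable_topology} \<Rightarrow>\<^sub>L 'h) \<in> L0wo_functions \<nu>"
    and "norm (if P s then id_blinfun else 0 :: 'h \<Rightarrow>\<^sub>L 'h) \<le> 1"
  using assms by (auto intro!: L0wo_If L0wo_const BH_id BH_zero norm_blinfun_bound)

text \<open>
  The values of a bounded operator commuting with the indicators at \<open>h \<xi>\<close>, for \<open>\<xi>\<close> in a countable
  dense rational subspace, define operators \<open>f s\<close>. Every square integrable function is a limit of
  functions that on each piece of a countable partition have the form \<open>h \<xi>\<close>.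
\<close>

lemma decomposable_operator:
  fixes y :: "('s \<Rightarrow> 'h::{complex_hilbert, second_countable_topology}) set operator"
  assumes sf: "sigma_finite_measure \<nu>" and bdd: "y \<in> bounded_operators (L2_space \<nu>)"
    and comm: "\<And>P. Measurable.pred \<nu> P \<Longrightarrow>
      mult_operator \<nu> (\<lambda>s. if P s then id_blinfun else 0) O y = y O mult_operator \<nu> (\<lambda>s. if P s then id_blinfun else 0)"
  obtains f C where "f \<in> L0wo_functions \<nu>" "\<And>s. norm (f s) \<le> C" "y = mult_operator \<nu> f"
proof -
  note lin = bounded_operators_linear[OF bdd]
  obtain T where T: "represents \<nu> y T"
    by (rule represents_exists[OF lin bounded_operators_Domain[OF bdd]])
  obtain C where C: "0 \<le> C" "\<And>F. F \<in> L2_functions \<nu> \<Longrightarrow> L2_norm \<nu> (T F) \<le> C * L2_norm \<nu> F"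
    by (rule represents_bounded[OF bdd T]) blast
  have local: "AE s in \<nu>. T (\<lambda>s. if P s then F s else 0) s = (if P s then T F s else 0)"
    if F: "F \<in> L2_functions \<nu>" and P: "Measurable.pred \<nu> P" for F P
    using represents_commute[OF T indicator_L0wo(1)[OF P] AE_I2[OF indicator_L0wo(2)[OF P]] comm[OF P] F L2_If(1)[OF F P]]
    by (auto simp: if_distrib[of blinfun_apply] if_distribR cong: if_cong)
  obtain h :: "'s \<Rightarrow> real" where h: "h \<in> borel_measurable \<nu>" "\<forall>s. 0 < h s" "integrable \<nu> (\<lambda>s. (h s)\<^sup>2)"
    by (rule sigma_finite_weight[OF sf])
  have h0: "h s \<noteq> 0" "0 \<le> h s" for s
    using h(2) by (metis less_irrefl, metis less_imp_le)
  obtain D :: "'h set" where D: "countable D" "closure D = UNIV"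
    and D_add: "\<And>x y. x \<in> D \<Longrightarrow> y \<in> D \<Longrightarrow> x + y \<in> D"
    and D_scale: "\<And>q x. q \<in> gaussian_rationals \<Longrightarrow> x \<in> D \<Longrightarrow> q *\<^sub>C x \<in> D"
    by (rule countable_dense_gaussian_subspace, rule that) (assumption | blast)+
  define Y where "Y d = T (\<lambda>s. h s *\<^sub>R d)" for d
  have hd: "(\<lambda>s. h s *\<^sub>R d) \<in> L2_functions \<nu>" for d :: 'h
    by (rule L2_weight_const[OF h(1,3)])
  have YL: "Y d \<in> L2_functions \<nu>" for d
    unfolding Y_def by (rule represents_in[OF T hd])
  note Ym = L2_measurable[OF YL]
  have Y_add: "AE s in \<nu>. Y (d + d') s = Y d s + Y d' s" for d d'
    using represents_add[OF lin T hd hd, of d d'] by (simp add: Y_def scaleR_add_right)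
  have Y_scale: "AE s in \<nu>. Y (q *\<^sub>C d) s = q *\<^sub>C Y d s" for q d
    using represents_scale[OF lin T hd, of q d]
    by (simp add: Y_def scaleR_scaleC scaleC_scaleC mult.commute)
  \<comment> \<open>By locality the norm bound for the operator holds pointwise: it can be integrated over the set
    where the pointwise bound fails.\<close>
  have Y_bound: "AE s in \<nu>. norm (Y d s) \<le> C * (h s * norm d)" for d
  proof -
    define P where "P s \<longleftrightarrow> \<not> norm (Y d s) \<le> C * (h s * norm d)" for s
    have P: "Measurable.pred \<nu> P"
      unfolding P_def[abs_def] using Ym[of d] h(1) by measurable
    let ?F = "\<lambda>s. if P s then h s *\<^sub>R d else 0"
    let ?G = "\<lambda>s. if P s then Y d s else 0"
    have F: "?F \<in> L2_functions \<nu>" and G: "?G \<in> L2_functions \<nu>"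
      by (rule L2_If(1)[OF hd P], rule L2_If(1)[OF YL P])
    have "L2_norm \<nu> ?G = L2_norm \<nu> (T ?F)"
      using local[OF hd P, of d] unfolding Y_def[symmetric]
      by (intro L2_norm_cong_AE L2_measurable[OF G] L2_measurable[OF represents_in[OF T F]])
        (auto elim: eventually_mono)
    also have "\<dots> \<le> C * L2_norm \<nu> ?F"
      by (rule C(2)[OF F])
    finally have "(L2_norm \<nu> ?G)\<^sup>2 \<le> (C * L2_norm \<nu> ?F)\<^sup>2"
      by (rule power_mono) simp
    then have le: "(\<integral>s. (norm (?G s))\<^sup>2 - C\<^sup>2 * (norm (?F s))\<^sup>2 \<partial>\<nu>) \<le> 0"
      using L2_integrable[OF F] L2_integrable[OF G]
      by (simp add: power_mult_distrib L2_norm_square)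
    have int: "integrable \<nu> (\<lambda>s. (norm (?G s))\<^sup>2 - C\<^sup>2 * (norm (?F s))\<^sup>2)"
      using L2_integrable[OF F] L2_integrable[OF G] by simp
    have pos: "0 < (norm (Y d s))\<^sup>2 - C\<^sup>2 * (norm (h s *\<^sub>R d))\<^sup>2" if "P s" for s
    proof -
      have "(C * (h s * norm d))\<^sup>2 < (norm (Y d s))\<^sup>2"
        using that C(1) h0(2)[of s] by (intro power_strict_mono) (auto simp: P_def)
      then show ?thesis by (simp add: power_mult_distrib)
    qed
    then have nn: "0 \<le> (norm (?G s))\<^sup>2 - C\<^sup>2 * (norm (?F s))\<^sup>2" for s
      by (cases "P s") (auto intro: less_imp_le)
    have nn_AE: "AE s in \<nu>. 0 \<le> (norm (?G s))\<^sup>2 - C\<^sup>2 * (norm (?F s))\<^sup>2"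
      by (intro AE_I2 nn)
    have "(\<integral>s. (norm (?G s))\<^sup>2 - C\<^sup>2 * (norm (?F s))\<^sup>2 \<partial>\<nu>) = 0"
      using le integral_nonneg_AE[OF nn_AE] by linarith
    then have "AE s in \<nu>. (norm (?G s))\<^sup>2 - C\<^sup>2 * (norm (?F s))\<^sup>2 = 0"
      using integral_nonneg_eq_0_iff_AE[OF int nn_AE] by blast
    then show ?thesis
    proof eventually_elim
      case (elim s)
      then show ?case
        using pos[of s] by (cases "P s") (auto simp: P_def)
    qed
  qed
  define good where "good s \<longleftrightarrow> (\<forall>d\<in>D. \<forall>d'\<in>D. Y (d + d') s = Y d s + Y d' s) \<and>
    (\<forall>q\<in>gaussian_rationals. \<forall>d\<in>D. Y (q *\<^sub>C d) s = q *\<^sub>C Y d s) \<and>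
    (\<forall>d\<in>D. norm (Y d s) \<le> C * (h s * norm d))" for s
  have AE_good: "AE s in \<nu>. good s"
    unfolding good_def
    by (intro AE_conjI AE_ball_countable[THEN iffD2] ballI Y_add Y_scale Y_bound D(1)
        countable_gaussian_rationals)
  have pred_good: "Measurable.pred \<nu> good"
  proof -
    have eq: "Measurable.pred \<nu> (\<lambda>s. F s = G s)" if [measurable]: "F \<in> borel_measurable \<nu>" "G \<in> borel_measurable \<nu>" for F G :: "'s \<Rightarrow> 'h"
      by measurable
    have le: "Measurable.pred \<nu> (\<lambda>s. norm (Y d s) \<le> C * (h s * norm d))" for d
      using Ym[of d] h(1) by measurable
    have ball: "Measurable.pred \<nu> (\<lambda>s. \<forall>i\<in>I. Q i s)" if "countable I" "\<And>i. i \<in> I \<Longrightarrow> Measurable.pred \<nu> (Q i)"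
      for I :: "'i set" and Q
      using that by (rule measurable_pred_countable(1))
    show ?thesis
      unfolding good_def[abs_def]
      by (intro pred_intros_logic ball eq le D(1) countable_gaussian_rationals borel_measurable_add
          borel_measurable_scaleC borel_measurable_const Ym)
  qed
  have ex: "\<exists>a\<in>BH. (\<forall>d\<in>D. blinfun_apply a d = (1 / h s) *\<^sub>R Y d s) \<and> norm a \<le> max C 0" if s: "good s" for s
  proof (rule BH_extend_dense[OF D(2), where Q = gaussian_rationals])
    show "x + z \<in> D \<and> (1 / h s) *\<^sub>R Y (x + z) s = (1 / h s) *\<^sub>R Y x s + (1 / h s) *\<^sub>R Y z s"
      if "x \<in> D" "z \<in> D" for x z
      using that s D_add by (simp add: good_def scaleR_add_right)
    show "q *\<^sub>C x \<in> D \<and> (1 / h s) *\<^sub>R Y (q *\<^sub>C x) s = q *\<^sub>C (1 / h s) *\<^sub>R Y x s"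
      if "q \<in> gaussian_rationals" "x \<in> D" for q x
      using that s D_scale by (simp add: good_def scaleR_scaleC scaleC_scaleC mult.commute)
    show "norm ((1 / h s) *\<^sub>R Y x s) \<le> C * norm x" if "x \<in> D" for x
    proof -
      have "norm (Y x s) \<le> C * (h s * norm x)"
        using that s by (simp add: good_def)
      then show ?thesis
        using h(2)[rule_format, of s] by (simp add: pos_divide_le_eq mult.commute mult.left_commute)
    qed
  qed (rule closure_gaussian_rationals minus_one_gaussian_rational)+
  define fits where "fits s a \<longleftrightarrow> a \<in> BH \<and> (\<forall>d\<in>D. blinfun_apply a d = (1 / h s) *\<^sub>R Y d s) \<and> norm a \<le> max C 0" for s a
  define f where "f s = (if good s then SOME a. fits s a else 0)" for s
  have f_good: "f s \<in> BH \<and> (\<forall>d\<in>D. blinfun_apply (f s) d = (1 / h s) *\<^sub>R Y d s) \<and> norm (f s) \<le> max C 0" if "good s" for s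
  proof -
    have "\<exists>a. fits s a"
      using ex[OF that] unfolding fits_def by blast
    then have "fits s (f s)"
      using that unfolding f_def by (simp add: someI_ex)
    then show ?thesis
      unfolding fits_def .
  qed
  have f_bad: "f s = 0" if "\<not> good s" for s
    using that by (simp add: f_def)
  have f_BH: "f s \<in> BH" for s
    using f_good f_bad BH_zero by metis
  have f_le: "norm (f s) \<le> C" for s
    using f_good[of s] f_bad[of s] C(1) by (cases "good s") auto
  have f_D: "(\<lambda>s. blinfun_apply (f s) d) \<in> borel_measurable \<nu>" if "d \<in> D" for d
  proof -
    have "(\<lambda>s. if good s then (1 / h s) *\<^sub>R Y d s else 0) \<in> borel_measurable \<nu>"
      using pred_good h(1) Ym[of d] by measurable
    also have "(\<lambda>s. if good s then (1 / h s) *\<^sub>R Y d s else 0) = (\<lambda>s. blinfun_apply (f s) d)"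
      using f_good f_bad that by (intro ext) auto
    finally show ?thesis .
  qed
  have f: "f \<in> L0wo_functions \<nu>"
  proof (rule L0woI)
    fix \<xi> :: 'h
    have "\<xi> \<in> closure D" using D(2) by simp
    then obtain d where d: "\<And>n. d n \<in> D" "d \<longlonglongrightarrow> \<xi>"
      unfolding closure_sequential by blast
    show "(\<lambda>s. blinfun_apply (f s) \<xi>) \<in> borel_measurable \<nu>"
    proof (rule borel_measurable_LIMSEQ_metric)
      show "(\<lambda>s. blinfun_apply (f s) (d n)) \<in> borel_measurable \<nu>" for n
        by (rule f_D[OF d(1)])
      show "(\<lambda>n. blinfun_apply (f s) (d n)) \<longlonglongrightarrow> blinfun_apply (f s) \<xi>" for s
        by (intro blinfun.tendsto tendsto_const d(2))
    qed
  qed (rule f_BH)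
  have "AE s in \<nu>. T F s = blinfun_apply (f s) (F s)" if F: "F \<in> L2_functions \<nu>" for F
  proof -
    have "D \<noteq> {}" using D(2) by auto
    define d where "d = from_nat_into D"
    have dD: "d j \<in> D" for j
      unfolding d_def by (rule from_nat_into[OF \<open>D \<noteq> {}\<close>])
    \<comment> \<open>The error of the approximation by \<open>h (d j)\<close> is at most \<open>h / (n + 1)\<close>, which is small in norm.\<close>
    define near where "near n s j \<longleftrightarrow> norm (h s *\<^sub>R d j - F s) \<le> h s / real (Suc n)" for n s j
    have ex_near: "\<exists>j. near n s j" for n s
    proof -
      have "(1 / h s) *\<^sub>R F s \<in> closure D" using D(2) by simp
      then obtain x where x: "x \<in> D" "dist x ((1 / h s) *\<^sub>R F s) < 1 / real (Suc n)"
        unfolding closure_approachable by (metis of_nat_0_less_iff zero_less_Suc zero_less_divide_1_iff)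
      obtain j where j: "d j = x"
        using from_nat_into_surj[OF D(1) x(1)] unfolding d_def by blast
      have "norm (h s *\<^sub>R x - F s) = norm (h s *\<^sub>R (x - (1 / h s) *\<^sub>R F s))"
        using h0(1)[of s] by (simp add: scaleR_diff_right)
      also have "\<dots> \<le> h s * (1 / real (Suc n))"
        using x(2) h0(2)[of s] unfolding norm_scaleR dist_norm by (intro mult_mono) auto
      finally show ?thesis
        unfolding near_def using j by auto
    qed
    define j where "j n s = (LEAST j. near n s j)" for n s
    have near_j: "near n s (j n s)" for n s
      unfolding j_def by (rule LeastI_ex[OF ex_near])
    have near_pred: "Measurable.pred \<nu> (\<lambda>s. near n s i)" for n i
      unfolding near_def[abs_def] using h(1) L2_measurable[OF F] by measurable
    have j_meas: "j n \<in> measurable \<nu> (count_space UNIV)" for n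
      unfolding j_def[abs_def] using near_pred by (intro measurable_Least)
    define Fn where "Fn n s = h s *\<^sub>R d (j n s)" for n s
    have Fn_meas: "Fn n \<in> borel_measurable \<nu>" for n
      unfolding Fn_def[abs_def]
    proof (rule measurable_compose_countable[OF _ j_meas])
      show "(\<lambda>s. h s *\<^sub>R d i) \<in> borel_measurable \<nu>" for i
        using h(1) by measurable
    qed
    have hL2: "(\<lambda>s. complex_of_real (h s)) \<in> L2_functions \<nu>"
      using h by (simp add: L2_functions_def)
    have diff: "(\<lambda>s. Fn n s - F s) \<in> L2_functions \<nu> \<and>
        L2_norm \<nu> (\<lambda>s. Fn n s - F s) \<le> 1 / real (Suc n) * L2_norm \<nu> (\<lambda>s. complex_of_real (h s))" for n
    proof -
      have meas: "(\<lambda>s. Fn n s - F s) \<in> borel_measurable \<nu>"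
        by (intro borel_measurable_diff Fn_meas L2_measurable[OF F])
      have le: "AE s in \<nu>. norm (Fn n s - F s) \<le> 1 / real (Suc n) * norm (complex_of_real (h s))"
        using near_j[of n] h0(2) by (auto simp: near_def Fn_def)
      show ?thesis
        using L2_bounded_by[OF hL2 meas le] by simp
    qed
    have FnL: "Fn n \<in> L2_functions \<nu>" for n
      using L2_add[OF conjunct1[OF diff[of n]] F] by simp
    have lim: "(\<lambda>n. L2_norm \<nu> (\<lambda>s. Fn n s - F s)) \<longlonglongrightarrow> 0"
    proof (rule tendsto_sandwich[OF _ _ tendsto_const])
      show "(\<lambda>n. 1 / real (Suc n) * L2_norm \<nu> (\<lambda>s. complex_of_real (h s))) \<longlonglongrightarrow> 0"
        using LIMSEQ_inverse_real_of_nat unfolding inverse_eq_divide by (rule tendsto_mult_left_zero)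
    qed (use diff in auto)
    have T_Fn: "AE s in \<nu>. T (Fn n) s = blinfun_apply (f s) (Fn n s)" for n
    proof -
      have "AE s in \<nu>. j n s = i \<longrightarrow> T (Fn n) s = blinfun_apply (f s) (Fn n s)" for i
      proof -
        have P: "Measurable.pred \<nu> (\<lambda>s. j n s = i)"
          using j_meas[of n] by measurable
        have eq: "(\<lambda>s. if j n s = i then Fn n s else 0) = (\<lambda>s. if j n s = i then h s *\<^sub>R d i else 0)"
          by (auto simp: Fn_def)
        have "AE s in \<nu>. (if j n s = i then T (Fn n) s else 0) = (if j n s = i then Y (d i) s else 0)"
          using local[OF FnL[of n] P] local[OF hd P, of "d i"] unfolding eq Y_def
          by eventually_elim simp
        then show ?thesis
          using AE_good
        proof eventually_elim
          case (elim s)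
          then show ?case
            using f_good[of s] dD[of i] h0(1)[of s] by (auto simp: Fn_def blinfun.scaleR_right)
        qed
      qed
      then have "AE s in \<nu>. \<forall>i. j n s = i \<longrightarrow> T (Fn n) s = blinfun_apply (f s) (Fn n s)"
        by (intro AE_all_countable[THEN iffD2] allI)
      then show ?thesis by eventually_elim blast
    qed
    have fL: "(\<lambda>s. blinfun_apply (f s) (G s)) \<in> L2_functions \<nu>" if "G \<in> L2_functions \<nu>" for G
      by (rule L2_mult(1)[OF f that]) (use f_le in auto)
    show ?thesis
    proof (rule L2_limit_unique[of "\<lambda>n. T (Fn n)"])
      show "T (Fn n) \<in> L2_functions \<nu>" for n
        by (rule represents_in[OF T FnL])
      show "T F \<in> L2_functions \<nu>" "(\<lambda>s. blinfun_apply (f s) (F s)) \<in> L2_functions \<nu>"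
        by (rule represents_in[OF T F], rule fL[OF F])
      have limC: "(\<lambda>n. C * L2_norm \<nu> (\<lambda>s. Fn n s - F s)) \<longlonglongrightarrow> 0"
        using lim by (rule tendsto_mult_right_zero)
      have "L2_norm \<nu> (\<lambda>s. T (Fn n) s - T F s) \<le> C * L2_norm \<nu> (\<lambda>s. Fn n s - F s)" for n
      proof -
        have "L2_norm \<nu> (\<lambda>s. T (Fn n) s - T F s) = L2_norm \<nu> (T (\<lambda>s. Fn n s - F s))"
          using represents_diff[OF lin T FnL[of n] F]
          by (intro L2_norm_cong_AE L2_measurable L2_diff represents_in[OF T] FnL F)
            (auto elim: eventually_mono)
        also have "\<dots> \<le> C * L2_norm \<nu> (\<lambda>s. Fn n s - F s)"
          by (rule C(2)[OF L2_diff[OF FnL F]])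
        finally show ?thesis .
      qed
      then show "(\<lambda>n. L2_norm \<nu> (\<lambda>s. T (Fn n) s - T F s)) \<longlonglongrightarrow> 0"
        by (intro tendsto_sandwich[OF _ _ tendsto_const limC]) auto
      have "L2_norm \<nu> (\<lambda>s. T (Fn n) s - blinfun_apply (f s) (F s)) \<le> C * L2_norm \<nu> (\<lambda>s. Fn n s - F s)" for n
      proof -
        have "L2_norm \<nu> (\<lambda>s. T (Fn n) s - blinfun_apply (f s) (F s)) = L2_norm \<nu> (\<lambda>s. blinfun_apply (f s) (Fn n s - F s))"
          using T_Fn[of n]
          by (intro L2_norm_cong_AE L2_measurable L2_diff represents_in[OF T] FnL F fL)
            (auto elim!: eventually_mono simp: blinfun.diff_right)
        also have "\<dots> \<le> C * L2_norm \<nu> (\<lambda>s. Fn n s - F s)"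
          by (rule L2_mult(2)[OF f L2_diff[OF FnL F] _ C(1)]) (use f_le in auto)
        finally show ?thesis .
      qed
      then show "(\<lambda>n. L2_norm \<nu> (\<lambda>s. T (Fn n) s - blinfun_apply (f s) (F s))) \<longlonglongrightarrow> 0"
        by (intro tendsto_sandwich[OF _ _ tendsto_const limC]) auto
    qed
  qed
  then have "y = mult_operator \<nu> f"
    by (intro represents_eq_mult_operator[OF lin T f])
  then show thesis
    by (intro that[OF f f_le])
qed

section \<open>Shift operators along orthonormal sequences\<close>

definition orthonormal :: "(nat \<Rightarrow> 'h::complex_hilbert) \<Rightarrow> bool"
  where "orthonormal u \<longleftrightarrow> (\<forall>i j. cinner (u i) (u j) = (if i = j then 1 else 0))"

lemma orthonormal_cinner: "orthonormal u \<Longrightarrow> cinner (u i) (u j) = (if i = j then 1 else 0)"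
  by (simp add: orthonormal_def)

lemma orthonormal_Suc: "orthonormal u \<Longrightarrow> orthonormal (\<lambda>k. u (Suc k))"
  by (simp add: orthonormal_def)

lemma cinner_orthonormal_sum:
  assumes "orthonormal u" "finite I"
  shows "cinner (\<Sum>i\<in>I. a i *\<^sub>C u i) (u j) = (if j \<in> I then a j else 0)"
  using assms by (simp add: cinner.sum_left cinner_scaleC_left orthonormal_cinner if_distrib[of "(*) _"] cong: if_cong)

lemma norm_orthonormal_sum:
  assumes "orthonormal u" "finite I"
  shows "(norm (\<Sum>i\<in>I. a i *\<^sub>C u i))\<^sup>2 = (\<Sum>i\<in>I. (cmod (a i))\<^sup>2)"
proof -
  let ?x = "\<Sum>i\<in>I. a i *\<^sub>C u i"
  have "complex_of_real ((norm ?x)\<^sup>2) = cinner ?x ?x"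
    by (simp add: cinner_self)
  also have "\<dots> = (\<Sum>i\<in>I. cnj (a i) * cinner ?x (u i))"
    by (subst cinner.sum_right) (simp add: cinner_scaleC_right)
  also have "\<dots> = (\<Sum>i\<in>I. cnj (a i) * a i)"
    by (intro sum.cong) (simp_all add: cinner_orthonormal_sum[OF assms])
  also have "\<dots> = complex_of_real (\<Sum>i\<in>I. (cmod (a i))\<^sup>2)"
    unfolding of_real_sum by (intro sum.cong) (simp_all only: complex_norm_square mult.commute)
  finally show ?thesis
    using of_real_eq_iff by blast
qed

lemma bessel_finite:
  assumes u: "orthonormal u"
  shows "(\<Sum>k<n. (cmod (cinner \<xi> (u k)))\<^sup>2) \<le> (norm \<xi>)\<^sup>2"
proof -
  let ?P = "\<Sum>k<n. cinner \<xi> (u k) *\<^sub>C u k"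
  have "cinner (\<xi> - ?P) ?P = (\<Sum>k<n. cnj (cinner \<xi> (u k)) * cinner (\<xi> - ?P) (u k))"
    by (subst cinner.sum_right) (simp add: cinner_scaleC_right)
  also have "\<dots> = 0"
    by (intro sum.neutral ballI) (simp add: cinner.diff_left cinner_orthonormal_sum[OF u])
  finally have "cinner (\<xi> - ?P) ?P = 0" .
  then have "(norm \<xi>)\<^sup>2 = (norm (\<xi> - ?P))\<^sup>2 + (norm ?P)\<^sup>2"
    using norm_add_square[of "\<xi> - ?P" ?P] by simp
  then show ?thesis
    by (simp add: norm_orthonormal_sum[OF u])
qed

lemma bessel_summable:
  assumes u: "orthonormal u"
  shows "summable (\<lambda>k. (cmod (cinner \<xi> (u k)))\<^sup>2)"
  by (rule summableI_nonneg_bounded[of _ "(norm \<xi>)\<^sup>2"]) (simp_all add: bessel_finite[OF u])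

lemma orthonormal_series_summable:
  fixes u :: "nat \<Rightarrow> 'h::complex_hilbert"
  assumes u: "orthonormal u" and a: "summable (\<lambda>k. (cmod (a k))\<^sup>2)"
  shows "summable (\<lambda>k. a k *\<^sub>C u k)"
  unfolding summable_Cauchy
proof (intro allI impI)
  fix e :: real assume e: "0 < e"
  then have "0 < e\<^sup>2" by simp
  then obtain N where N: "\<And>m n. m \<ge> N \<Longrightarrow> norm (\<Sum>k\<in>{m..<n}. (cmod (a k))\<^sup>2) < e\<^sup>2"
    using a unfolding summable_Cauchy by blast
  have "norm (\<Sum>k\<in>{m..<n}. a k *\<^sub>C u k) < e" if "m \<ge> N" for m n
  proof -
    have "(norm (\<Sum>k\<in>{m..<n}. a k *\<^sub>C u k))\<^sup>2 < e\<^sup>2"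
      using N[OF that, of n] by (simp add: norm_orthonormal_sum[OF u] sum_nonneg)
    then show ?thesis
      using e by (simp add: power2_less_imp_less)
  qed
  then show "\<exists>N. \<forall>m\<ge>N. \<forall>n. norm (\<Sum>k\<in>{m..<n}. a k *\<^sub>C u k) < e" by blast
qed

text \<open>The partial isometry carrying \<open>u k\<close> to \<open>w k\<close> and vanishing on the complement of the \<open>u k\<close>.\<close>

definition carry :: "(nat \<Rightarrow> 'h::complex_hilbert) \<Rightarrow> (nat \<Rightarrow> 'h) \<Rightarrow> 'h \<Rightarrow>\<^sub>L 'h"
  where "carry u w = Blinfun (\<lambda>\<xi>. \<Sum>k. cinner \<xi> (u k) *\<^sub>C w k)"

lemma
  assumes u: "orthonormal u" and w: "orthonormal w"
  shows carry_apply: "blinfun_apply (carry u w) \<xi> = (\<Sum>k. cinner \<xi> (u k) *\<^sub>C w k)"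
    and carry_sums: "(\<lambda>k. cinner \<xi> (u k) *\<^sub>C w k) sums blinfun_apply (carry u w) \<xi>"
    and carry_in_BH: "carry u w \<in> BH"
    and norm_carry_le: "norm (carry u w) \<le> 1"
proof -
  let ?R = "\<lambda>\<xi>. \<Sum>k. cinner \<xi> (u k) *\<^sub>C w k"
  have sums: "(\<lambda>k. cinner \<xi> (u k) *\<^sub>C w k) sums ?R \<xi>" for \<xi>
    by (intro summable_sums orthonormal_series_summable[OF w] bessel_summable[OF u])
  have add: "?R (x + z) = ?R x + ?R z" for x z
    using sums_unique[OF sums_add[OF sums[of x] sums[of z]]] by (simp add: cinner_add_left scaleC_add_left)
  have scale: "?R (c *\<^sub>C x) = c *\<^sub>C ?R x" for c x
    using sums_unique[OF bounded_linear.sums[OF scaleC.bounded_linear_right sums[of x], of c]]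
    by (simp add: cinner_scaleC_left scaleC_scaleC)
  have le: "norm (?R x) \<le> norm x" for x
  proof (rule LIMSEQ_le_const2[OF tendsto_norm[OF sums[of x, unfolded sums_def]]], intro exI allI impI)
    fix n
    have "(norm (\<Sum>k<n. cinner x (u k) *\<^sub>C w k))\<^sup>2 \<le> (norm x)\<^sup>2"
      by (simp add: norm_orthonormal_sum[OF w] bessel_finite[OF u])
    then show "norm (\<Sum>k<n. cinner x (u k) *\<^sub>C w k) \<le> norm x"
      by (rule power2_le_imp_le) simp
  qed
  then have "bounded_linear ?R"
    by (intro bounded_linear_intro[of _ 1]) (simp_all add: add scale scaleR_scaleC)
  then have eq: "blinfun_apply (carry u w) = ?R"
    unfolding carry_def by (rule bounded_linear_Blinfun_apply)
  show "blinfun_apply (carry u w) \<xi> = ?R \<xi>" "(\<lambda>k. cinner \<xi> (u k) *\<^sub>C w k) sums blinfun_apply (carry u w) \<xi>"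
    "carry u w \<in> BH" "norm (carry u w) \<le> 1"
    using sums le by (simp_all add: eq BH_def scale norm_blinfun_bound)
qed

lemma cinner_carry:
  assumes u: "orthonormal u" and w: "orthonormal w"
  shows "(\<lambda>k. cinner \<xi> (u k) * cinner (w k) \<eta>) sums cinner (blinfun_apply (carry u w) \<xi>) \<eta>"
  using bounded_linear.sums[OF cinner.bounded_linear_left carry_sums[OF u w, of \<xi>], of \<eta>]
  by (simp add: cinner_scaleC_left)

lemma cinner_carry_basis:
  assumes u: "orthonormal u" and w: "orthonormal w"
  shows "cinner (blinfun_apply (carry u w) \<xi>) (w j) = cinner \<xi> (u j)"
proof -
  have "(\<lambda>k. if k = j then cinner \<xi> (u k) else 0) sums cinner (blinfun_apply (carry u w) \<xi>) (w j)"
    using cinner_carry[OF u w, of \<xi> "w j"]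
    by (simp add: orthonormal_cinner[OF w] if_distrib[of "(*) _"] cong: if_cong)
  moreover have "(\<lambda>k. if k = j then cinner \<xi> (u k) else 0) sums cinner \<xi> (u j)"
    by (rule sums_single)
  ultimately show ?thesis by (rule sums_unique2)
qed

lemma carry_adj:
  assumes u: "orthonormal u" and w: "orthonormal w"
  shows "cinner (blinfun_apply (carry u w) \<xi>) \<eta> = cinner \<xi> (blinfun_apply (carry w u) \<eta>)"
proof -
  have "(\<lambda>k. cnj (cinner \<eta> (w k) * cinner (u k) \<xi>)) sums cnj (cinner (blinfun_apply (carry w u) \<eta>) \<xi>)"
    using cinner_carry[OF w u] by (simp only: sums_cnj)
  then have "(\<lambda>k. cinner \<xi> (u k) * cinner (w k) \<eta>) sums cinner \<xi> (blinfun_apply (carry w u) \<eta>)"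
    by (simp add: mult.commute flip: cinner_commute)
  with cinner_carry[OF u w] show ?thesis
    by (rule sums_unique2)
qed

lemma carry_carry:
  assumes "orthonormal u" "orthonormal w" "orthonormal z"
  shows "blinfun_apply (carry w z) (blinfun_apply (carry u w) \<xi>) = blinfun_apply (carry u z) \<xi>"
  using assms by (simp add: carry_apply[of w z] carry_apply[of u z] cinner_carry_basis)

text \<open>
  On the range of a projection \<open>e\<close> containing an orthonormal sequence \<open>u\<close>, shifting the sequence
  and fixing its complement is isometric but misses \<open>u 0\<close>.
\<close>

definition shift_op :: "('h::complex_hilbert \<Rightarrow>\<^sub>L 'h) \<Rightarrow> (nat \<Rightarrow> 'h) \<Rightarrow> 'h \<Rightarrow>\<^sub>L 'h"
  where "shift_op e u = e - carry u u + carry u (\<lambda>k. u (Suc k))"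

lemma shift_op:
  fixes e :: "'h::complex_hilbert \<Rightarrow>\<^sub>L 'h"
  assumes e: "e \<in> BH" "e o\<^sub>L e = e" "BH_adj e = e" and u: "orthonormal u"
    and eu: "\<And>k. blinfun_apply e (u k) = u k"
  shows shift_op_in_BH: "shift_op e u \<in> BH"
    and shift_op_isometry: "BH_adj (shift_op e u) o\<^sub>L shift_op e u = e"
    and shift_op_range: "shift_op e u o\<^sub>L BH_adj (shift_op e u) = e - rank_one (u 0) (u 0)"
proof -
  let ?Su = "\<lambda>k. u (Suc k)"
  note Su = orthonormal_Suc[OF u]
  define P W W' P' where "P = blinfun_apply (carry u u)" and "W = blinfun_apply (carry u ?Su)"
    and "W' = blinfun_apply (carry ?Su u)" and "P' = blinfun_apply (carry ?Su ?Su)"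
  note defs = P_def W_def W'_def P'_def
  have e_adj: "cinner (blinfun_apply e x) z = cinner x (blinfun_apply e z)" for x z
    using cinner_BH_adj[OF e(1)] by (simp add: e(3))
  have ee: "blinfun_apply e (blinfun_apply e x) = blinfun_apply e x" for x
    using e(2) by (metis blinfun_apply_blinfun_compose)
  have e_carry: "blinfun_apply e (blinfun_apply (carry w z) x) = blinfun_apply (carry w z) x"
    if w: "orthonormal w" and z: "orthonormal z" and ez: "\<And>k. blinfun_apply e (z k) = z k" for w z x
    using sums_unique[OF blinfun.bounded_linear_right[THEN bounded_linear.sums, OF carry_sums[OF w z, of x], of e]]
    by (simp add: BH_D[OF e(1)] ez carry_apply[OF w z])
  have carry_e: "blinfun_apply (carry w z) (blinfun_apply e x) = blinfun_apply (carry w z) x"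
    if w: "orthonormal w" and z: "orthonormal z" and ew: "\<And>k. blinfun_apply e (w k) = w k" for w z x
    by (simp add: carry_apply[OF w z] e_adj ew)
  have P_split: "P x = cinner x (u 0) *\<^sub>C u 0 + P' x" for x
  proof -
    have "summable (\<lambda>k. cinner x (u k) *\<^sub>C u k)"
      using carry_sums[OF u u] by (rule sums_summable)
    from suminf_split_head[OF this] show ?thesis
      by (simp add: defs carry_apply u Su)
  qed
  then have P'_eq: "P' x = P x - cinner x (u 0) *\<^sub>C u 0" for x
    by simp
  have W0: "cinner (W x) (u 0) = 0" for x
  proof -
    have "(\<lambda>k. 0) sums cinner (W x) (u 0)"
      using cinner_carry[OF u Su, of x "u 0"] by (simp add: orthonormal_cinner[OF u] W_def)
    then show ?thesis
      using sums_unique2[OF sums_zero] by metis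
  qed
  have W'0: "W' (u 0) = 0"
    by (simp add: W'_def carry_apply[OF Su u] orthonormal_cinner[OF u] scaleC.zero_left)
  have W'_lin: "W' (c *\<^sub>C x + z) = c *\<^sub>C W' x + W' z" for c x z
    unfolding W'_def using BH_D[OF carry_in_BH[OF Su u]] by (simp add: blinfun.add_right)
  have PW: "P (W x) = W x" for x
    unfolding P_split W0 by (simp add: defs carry_carry u Su scaleC.zero_left)
  have W'P: "W' (P x) = W' x" for x
    unfolding P_split W'_lin W'0 by (simp add: defs carry_carry u Su scaleC.zero_right)
  have rules: "P (P x) = P x" "W (P x) = W x" "P (W' x) = W' x" "W' (W x) = P x" "W (W' x) = P' x"
    "blinfun_apply e (P x) = P x" "blinfun_apply e (W x) = W x" "blinfun_apply e (W' x) = W' x"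
    "P (blinfun_apply e x) = P x" "W (blinfun_apply e x) = W x" "W' (blinfun_apply e x) = W' x" for x
    unfolding defs by (simp_all add: carry_carry e_carry carry_e u Su eu)
  let ?w = "e - carry u u + carry ?Su u"
  have v_apply: "blinfun_apply (shift_op e u) x = blinfun_apply e x - P x + W x"
    and w_apply: "blinfun_apply ?w x = blinfun_apply e x - P x + W' x" for x
    by (simp_all add: shift_op_def defs blinfun.add_left blinfun.diff_left)
  have adj: "BH_adj (shift_op e u) = ?w"
  proof (rule BH_adj_eqI)
    show "cinner (blinfun_apply (shift_op e u) x) z = cinner x (blinfun_apply ?w z)" for x z
      unfolding v_apply w_apply cinner.add_left cinner.diff_left cinner.add_right cinner.diff_right
      by (simp add: defs e_adj carry_adj u Su)
  qed
  have lin: "P (x - y + z) = P x - P y + P z" "W (x - y + z) = W x - W y + W z"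
    "W' (x - y + z) = W' x - W' y + W' z" for x y z
    by (simp_all add: defs blinfun.add_right blinfun.diff_right)
  show "shift_op e u \<in> BH"
    unfolding shift_op_def by (intro BH_add BH_diff carry_in_BH e u Su)
  show "BH_adj (shift_op e u) o\<^sub>L shift_op e u = e"
    unfolding adj
    by (rule blinfun_eqI)
      (simp add: v_apply w_apply lin rules PW W'P ee blinfun.add_right blinfun.diff_right)
  show "shift_op e u o\<^sub>L BH_adj (shift_op e u) = e - rank_one (u 0) (u 0)"
    unfolding adj
    by (rule blinfun_eqI)
      (simp add: v_apply w_apply lin rules PW W'P ee blinfun.add_right blinfun.diff_right
        blinfun.diff_left rank_one_apply P'_eq)
qed

lemma norm_shift_op_le:
  assumes "orthonormal u"
  shows "norm (shift_op e u) \<le> norm e + 2"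
proof -
  have "norm (shift_op e u) \<le> (norm e + norm (carry u u)) + norm (carry u (\<lambda>k. u (Suc k)))"
    unfolding shift_op_def by (intro norm_triangle_le add_right_mono norm_triangle_ineq4)
  then show ?thesis
    using norm_carry_le[OF assms assms] norm_carry_le[OF assms orthonormal_Suc[OF assms]] by linarith
qed

lemma projection_minus_rank_one:
  fixes e :: "'h::complex_hilbert \<Rightarrow>\<^sub>L 'h"
  assumes e: "e \<in> BH" "e o\<^sub>L e = e" "BH_adj e = e" and x: "blinfun_apply e x = x" "norm x = 1"
  shows "(e - rank_one x x) o\<^sub>L (e - rank_one x x) = e - rank_one x x"
    and "BH_adj (e - rank_one x x) = e - rank_one x x"
    and "e o\<^sub>L (e - rank_one x x) = e - rank_one x x"
proof -
  have e_adj: "cinner (blinfun_apply e z) w = cinner z (blinfun_apply e w)" for z w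
    using cinner_BH_adj[OF e(1)] by (simp add: e(3))
  have ee: "blinfun_apply e (blinfun_apply e z) = blinfun_apply e z" for z
    using e(2) by (metis blinfun_apply_blinfun_compose)
  have xx: "cinner x x = 1"
    by (simp add: cinner_self x)
  show "(e - rank_one x x) o\<^sub>L (e - rank_one x x) = e - rank_one x x"
    by (rule blinfun_eqI)
      (simp add: blinfun.diff_left blinfun.diff_right rank_one_apply ee BH_D[OF e(1)] x(1) e_adj
        cinner.diff_left cinner_scaleC_left xx scaleC.diff_left)
  show "e o\<^sub>L (e - rank_one x x) = e - rank_one x x"
    by (rule blinfun_eqI)
      (simp add: blinfun.diff_left blinfun.diff_right rank_one_apply ee BH_D[OF e(1)] x(1))
  have sym: "cinner z x * cinner x w = cnj (cinner w x) * cinner z x" for z w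
    by (simp add: mult.commute flip: cinner_commute)
  show "BH_adj (e - rank_one x x) = e - rank_one x x"
    by (rule BH_adj_eqI)
      (simp add: blinfun.diff_left rank_one_apply cinner.diff_left cinner.diff_right e_adj
        cinner_scaleC_left cinner_scaleC_right sym)
qed

section \<open>The closed graph theorem\<close>

text \<open>
  Baire's argument: if no sublevel set of \<open>q\<close> is dense in a ball, nested balls that avoid more and
  more sublevel sets shrink to a point at which \<open>q\<close> exceeds every \<open>n\<close>.
\<close>

lemma sublevel_dense_in_ball:
  fixes q :: "('s \<Rightarrow> 'h::{complex_hilbert, second_countable_topology}) \<Rightarrow> real"
  shows "\<exists>n F0 r. F0 \<in> L2_functions \<nu> \<and> 0 < r \<and>
    (\<forall>F\<in>L2_functions \<nu>. L2_norm \<nu> (\<lambda>s. F s - F0 s) < r \<longrightarrow>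
      (\<forall>\<epsilon>>0. \<exists>G\<in>L2_functions \<nu>. q G \<le> real n \<and> L2_norm \<nu> (\<lambda>s. G s - F s) < \<epsilon>))"
proof (rule ccontr)
  let ?L = "L2_functions \<nu> :: ('s \<Rightarrow> 'h) set"
  let ?d = "\<lambda>F G. L2_norm \<nu> (\<lambda>s. F s - G s :: 'h)"
  assume contr: "\<not> ?thesis"
  have step: "\<exists>F r'. F \<in> ?L \<and> 0 < r' \<and> r' \<le> r / 2 \<and> ?d F F0 \<le> r / 2 \<and>
      (\<forall>G\<in>?L. ?d G F \<le> r' \<longrightarrow> real n < q G)" if F0: "F0 \<in> ?L" and r: "0 < r" for n F0 and r :: real
  proof -
    have "\<exists>F\<in>?L. ?d F F0 < r / 2 \<and> (\<exists>\<epsilon>>0. \<forall>G\<in>?L. q G \<le> real n \<longrightarrow> \<not> ?d G F < \<epsilon>)"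
    proof (rule ccontr)
      assume "\<not> (\<exists>F\<in>?L. ?d F F0 < r / 2 \<and> (\<exists>\<epsilon>>0. \<forall>G\<in>?L. q G \<le> real n \<longrightarrow> \<not> ?d G F < \<epsilon>))"
      then have "\<forall>F\<in>?L. ?d F F0 < r / 2 \<longrightarrow> (\<forall>\<epsilon>>0. \<exists>G\<in>?L. q G \<le> real n \<and> ?d G F < \<epsilon>)"
        by blast
      moreover have "0 < r / 2" using r by simp
      ultimately show False
        using contr F0 by blast
    qed
    then obtain F \<epsilon> where F: "F \<in> ?L" "?d F F0 < r / 2" "\<epsilon> > 0" "\<forall>G\<in>?L. q G \<le> real n \<longrightarrow> \<not> ?d G F < \<epsilon>"
      by blast
    have "\<forall>G\<in>?L. ?d G F \<le> min (r / 2) (\<epsilon> / 2) \<longrightarrow> real n < q G"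
    proof (intro ballI impI)
      fix G assume "G \<in> ?L" "?d G F \<le> min (r / 2) (\<epsilon> / 2)"
      then have "\<not> q G \<le> real n"
        using F(3,4) by fastforce
      then show "real n < q G" by simp
    qed
    then show ?thesis
      using F r by (intro exI[of _ F] exI[of _ "min (r / 2) (\<epsilon> / 2)"]) auto
  qed
  have "\<exists>p. \<forall>n. (fst (p n) \<in> ?L \<and> 0 < snd (p n)) \<and>
      (snd (p (Suc n)) \<le> snd (p n) / 2 \<and> ?d (fst (p (Suc n))) (fst (p n)) \<le> snd (p n) / 2 \<and>
       (\<forall>G\<in>?L. ?d G (fst (p (Suc n))) \<le> snd (p (Suc n)) \<longrightarrow> real n < q G))"
  proof (rule dependent_nat_choice)
    show "\<exists>x :: ('s \<Rightarrow> 'h) \<times> real. fst x \<in> ?L \<and> 0 < snd x"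
      by (rule exI[of _ "(\<lambda>s. 0, 1)"]) simp
    fix x :: "('s \<Rightarrow> 'h) \<times> real" and n
    assume "fst x \<in> ?L \<and> 0 < snd x"
    then obtain F r' where "F \<in> ?L \<and> 0 < r' \<and> r' \<le> snd x / 2 \<and> ?d F (fst x) \<le> snd x / 2 \<and>
        (\<forall>G\<in>?L. ?d G F \<le> r' \<longrightarrow> real n < q G)"
      using step[of "fst x" "snd x" n] by blast
    then show "\<exists>y. (fst y \<in> ?L \<and> 0 < snd y) \<and> snd y \<le> snd x / 2 \<and> ?d (fst y) (fst x) \<le> snd x / 2 \<and>
        (\<forall>G\<in>?L. ?d G (fst y) \<le> snd y \<longrightarrow> real n < q G)"
      by (intro exI[of _ "(F, r')"]) simp
  qed
  then obtain p where p: "\<And>n. fst (p n) \<in> ?L" "\<And>n. 0 < snd (p n)" "\<And>n. snd (p (Suc n)) \<le> snd (p n) / 2"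
    "\<And>n. ?d (fst (p (Suc n))) (fst (p n)) \<le> snd (p n) / 2"
    "\<And>n G. G \<in> ?L \<Longrightarrow> ?d G (fst (p (Suc n))) \<le> snd (p (Suc n)) \<Longrightarrow> real n < q G"
    by blast
  define F where "F n = fst (p n)" for n
  define r where "r n = snd (p n)" for n
  have FL: "F n \<in> ?L" and r: "0 < r n" "r (Suc n) \<le> r n / 2" "?d (F (Suc n)) (F n) \<le> r n / 2" for n
    using p unfolding F_def r_def by auto
  have r_le: "r n \<le> r 0 / 2 ^ n" for n
  proof (induction n)
    case (Suc n)
    have "r (Suc n) \<le> r n / 2" by (rule r)
    also have "\<dots> \<le> r 0 / 2 ^ Suc n" using Suc.IH by simp
    finally show ?case .
  qed simp
  have steps: "?d (F (Suc n)) (F n) \<le> (r 0 / 2) / 2 ^ n" for n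
    using r(3)[of n] r_le[of n] by simp
  obtain G where G: "G \<in> ?L" "(\<lambda>n. ?d (F n) G) \<longlonglongrightarrow> 0"
    using L2_complete[of F \<nu> "r 0 / 2", OF FL steps] by blast
  have close: "?d (F n) (F (n + k)) \<le> r n - r (n + k)" for n k
  proof (induction k)
    case (Suc k)
    have "?d (F n) (F (n + Suc k)) \<le> ?d (F n) (F (n + k)) + ?d (F (n + k)) (F (Suc (n + k)))"
      using L2_norm_diff_triangle[OF FL[of n] FL[of "n + k"] FL[of "Suc (n + k)"]] by simp
    also have "?d (F (n + k)) (F (Suc (n + k))) = ?d (F (Suc (n + k))) (F (n + k))"
      by (rule L2_norm_diff_commute)
    finally show ?case
      using Suc.IH r(2)[of "n + k"] r(3)[of "n + k"] by simp
  qed simp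
  have G_close: "?d G (F n) \<le> r n" for n
  proof (rule LIMSEQ_le_const2)
    have "(\<lambda>k. ?d (F (n + k)) G) \<longlonglongrightarrow> 0"
      using LIMSEQ_ignore_initial_segment[OF G(2), of n] by (simp add: add.commute)
    then show "(\<lambda>k. ?d G (F n) - ?d (F (n + k)) G) \<longlonglongrightarrow> ?d G (F n)"
      using tendsto_diff[OF tendsto_const[of "?d G (F n)"]] by fastforce
    show "\<exists>N. \<forall>k\<ge>N. ?d G (F n) - ?d (F (n + k)) G \<le> r n"
    proof (intro exI allI impI)
      fix k
      have "?d (F n) G \<le> ?d (F n) (F (n + k)) + ?d (F (n + k)) G"
        by (rule L2_norm_diff_triangle[OF FL FL G(1)])
      then show "?d G (F n) - ?d (F (n + k)) G \<le> r n"
        using close[of n k] r(1)[of "n + k"] L2_norm_diff_commute[of \<nu> G "F n"] by simp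
    qed
  qed
  have "real n < q G" for n
    using p(5)[OF G(1), of n] G_close[of "Suc n"] by (simp add: F_def r_def)
  then show False
    using reals_Archimedean2[of "q G"] less_asym by blast
qed

text \<open>
  Differences of approximants in the ball from the Baire argument approximate every \<open>F\<close> by \<open>G\<close>
  with \<open>T G\<close> controlled by the norm of \<open>F\<close>; summing the successive corrections and using that
  the graph is closed bounds \<open>T F\<close> itself.
\<close>

theorem closed_graph_L2:
  fixes y :: "('s \<Rightarrow> 'h::{complex_hilbert, second_countable_topology}) set operator"
  assumes lin: "linear_operator (L2_space \<nu>) y" and closed: "closed_operator (L2_space \<nu>) y"
    and dom: "Domain y = hcarrier (L2_space \<nu>)"
  shows "y \<in> bounded_operators (L2_space \<nu>)"
proof -
  let ?L = "L2_functions \<nu> :: ('s \<Rightarrow> 'h) set"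
  let ?N = "L2_norm \<nu> :: ('s \<Rightarrow> 'h) \<Rightarrow> real"
  obtain T where T: "represents \<nu> y T"
    by (rule represents_exists[OF lin dom])
  note TL = represents_in[OF T]
  have T_diff: "?N (\<lambda>s. T F s - T G s) = ?N (T (\<lambda>s. F s - G s))" if "F \<in> ?L" "G \<in> ?L" for F G
    using represents_diff[OF lin T that]
    by (intro L2_norm_cong_AE L2_measurable L2_diff TL that) (auto elim: eventually_mono)
  have T_scale: "?N (T (\<lambda>s. c *\<^sub>C F s)) = cmod c * ?N (T F)" if "F \<in> ?L" for c F
  proof -
    have "?N (T (\<lambda>s. c *\<^sub>C F s)) = ?N (\<lambda>s. c *\<^sub>C T F s)"
      by (intro L2_norm_cong_AE L2_measurable L2_scale TL that represents_scale[OF lin T])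
    then show ?thesis by (simp add: L2_norm_scale)
  qed
  have T0: "?N (T (\<lambda>s. 0)) = 0"
    using T_scale[of "\<lambda>s. 0" 0] by (simp add: scaleC.zero_left)
  have T_null: "?N (T F) = 0" if F: "F \<in> ?L" "?N F = 0" for F
  proof -
    have "AE s in \<nu>. F s = 0"
      using F by (simp add: L2_norm_eq_0)
    then have "AE s in \<nu>. T F s = T (\<lambda>s. 0) s"
      by (intro represents_cong[OF T F(1)]) auto
    then have "?N (T F) = ?N (T (\<lambda>s. 0))"
      by (intro L2_norm_cong_AE L2_measurable TL F) auto
    then show ?thesis using T0 by simp
  qed
  obtain n F0 r where F0: "F0 \<in> ?L" and r: "0 < r"
    and dense: "\<And>F \<epsilon>. F \<in> ?L \<Longrightarrow> ?N (\<lambda>s. F s - F0 s) < r \<Longrightarrow> 0 < \<epsilon> \<Longrightarrow>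
      \<exists>G\<in>?L. ?N (T G) \<le> real n \<and> ?N (\<lambda>s. G s - F s) < \<epsilon>"
    using sublevel_dense_in_ball[of \<nu> "\<lambda>G. ?N (T G)"] by blast
  \<comment> \<open>The difference of two approximants has an image of norm at most \<open>2 n\<close>, and scaling \<open>F\<close> to
    norm \<open>r / 2\<close> and back contributes the factor \<open>2 / r\<close>.\<close>
  define C where "C = 4 * real n / r"
  have C: "0 \<le> C" using r by (simp add: C_def)
  have approx: "\<exists>G\<in>?L. ?N (T G) \<le> C * ?N F \<and> ?N (\<lambda>s. F s - G s) < \<epsilon>" if F: "F \<in> ?L" and \<epsilon>: "0 < \<epsilon>" for F and \<epsilon> :: real
  proof (cases "?N F = 0")
    case True
    then show ?thesis
      using T0 \<epsilon> by (intro bexI[of _ "\<lambda>s. 0"]) simp_all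
  next
    case False
    then have NF: "0 < ?N F"
      using L2_norm_nonneg[of \<nu> F] by linarith
    define t where "t = r / (2 * ?N F)"
    have t: "0 < t" using r NF by (simp add: t_def)
    define K where "K s = complex_of_real t *\<^sub>C F s" for s
    have K: "K \<in> ?L" unfolding K_def[abs_def] by (rule L2_scale[OF F])
    have "?N K = t * ?N F"
      unfolding K_def[abs_def] L2_norm_scale using t by simp
    then have NK: "?N K < r" using r NF by (simp add: t_def)
    have \<delta>: "0 < t * \<epsilon> / 2" using t \<epsilon> by simp
    obtain G1 where G1: "G1 \<in> ?L" "?N (T G1) \<le> real n" "?N (\<lambda>s. G1 s - (F0 s + K s)) < t * \<epsilon> / 2"
      using dense[OF L2_add[OF F0 K] _ \<delta>] NK by auto
    obtain G2 where G2: "G2 \<in> ?L" "?N (T G2) \<le> real n" "?N (\<lambda>s. G2 s - F0 s) < t * \<epsilon> / 2"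
      using dense[OF F0 _ \<delta>] r by auto
    define G where "G s = complex_of_real (1 / t) *\<^sub>C (G1 s - G2 s)" for s
    have G: "G \<in> ?L" unfolding G_def[abs_def] by (intro L2_scale L2_diff G1 G2)
    have "?N (T G) = (1 / t) * ?N (T (\<lambda>s. G1 s - G2 s))"
      unfolding G_def[abs_def] T_scale[OF L2_diff[OF G1(1) G2(1)]] using t by (simp add: norm_divide)
    also have "?N (T (\<lambda>s. G1 s - G2 s)) \<le> ?N (T G1) + ?N (T G2)"
      unfolding T_diff[OF G1(1) G2(1), symmetric] by (intro L2_norm_diff_le TL G1 G2)
    also have "?N (T G1) + ?N (T G2) \<le> 2 * real n"
      using G1(2) G2(2) by simp
    finally have "?N (T G) \<le> (1 / t) * (2 * real n)"
      using t by (simp add: divide_right_mono)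
    also have "\<dots> = C * ?N F"
      using NF r by (simp add: C_def t_def field_simps)
    finally have 1: "?N (T G) \<le> C * ?N F" .
    have eq: "(\<lambda>s. F s - G s) = (\<lambda>s. complex_of_real (1 / t) *\<^sub>C ((G2 s - F0 s) - (G1 s - (F0 s + K s))))"
    proof
      fix s
      have "F s = complex_of_real (1 / t) *\<^sub>C K s"
        using t by (simp add: K_def scaleC_scaleC flip: of_real_mult)
      then show "F s - G s = complex_of_real (1 / t) *\<^sub>C ((G2 s - F0 s) - (G1 s - (F0 s + K s)))"
        by (simp add: G_def scaleC.diff_right scaleC_add_right)
    qed
    have "?N (\<lambda>s. (G2 s - F0 s) - (G1 s - (F0 s + K s))) < t * \<epsilon>"
      using L2_norm_diff_le[OF L2_diff[OF G2(1) F0] L2_diff[OF G1(1) L2_add[OF F0 K]]] G1(3) G2(3) by linarith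
    then have "?N (\<lambda>s. F s - G s) < \<epsilon>"
      unfolding eq L2_norm_scale using t by (simp add: norm_divide pos_divide_less_eq mult.commute)
    with 1 G show ?thesis by blast
  qed
  have bound: "?N (T F) \<le> 2 * C * ?N F" if F: "F \<in> ?L" for F
  proof (cases "?N F = 0")
    case True
    then show ?thesis using T_null[OF F] by simp
  next
    case False
    define a where "a = ?N F"
    have a: "0 < a"
      using False L2_norm_nonneg[of \<nu> F] unfolding a_def by linarith
    have "\<exists>H. \<forall>k. (H k \<in> ?L \<and> ?N (H k) \<le> a / 2 ^ k \<and> (k = 0 \<longrightarrow> H k = F)) \<and>
        ?N (T (\<lambda>s. H k s - H (Suc k) s)) \<le> C * a / 2 ^ k"
    proof (rule dependent_nat_choice)
      show "\<exists>H. H \<in> ?L \<and> ?N H \<le> a / 2 ^ 0 \<and> ((0::nat) = 0 \<longrightarrow> H = F)"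
        using F by (intro exI[of _ F]) (simp add: a_def)
      fix H :: "'s \<Rightarrow> 'h" and k
      assume H: "H \<in> ?L \<and> ?N H \<le> a / 2 ^ k \<and> (k = 0 \<longrightarrow> H = F)"
      have "0 < a / 2 ^ Suc k" using a by simp
      then obtain G where G: "G \<in> ?L" "?N (T G) \<le> C * ?N H" "?N (\<lambda>s. H s - G s) < a / 2 ^ Suc k"
        using approx H by blast
      have "C * ?N H \<le> C * (a / 2 ^ k)"
        using H C by (intro mult_left_mono) auto
      then have "?N (T G) \<le> C * a / 2 ^ k" using G(2) by simp
      moreover have "(\<lambda>s. H s - G s) \<in> ?L" using H G(1) by (intro L2_diff) auto
      ultimately show "\<exists>H'. (H' \<in> ?L \<and> ?N H' \<le> a / 2 ^ Suc k \<and> (Suc k = 0 \<longrightarrow> H' = F)) \<and>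
          ?N (T (\<lambda>s. H s - H' s)) \<le> C * a / 2 ^ k"
        using G(3) by (intro exI[of _ "\<lambda>s. H s - G s"]) simp
    qed
    then obtain H where H: "\<And>k. H k \<in> ?L" "\<And>k. ?N (H k) \<le> a / 2 ^ k" "H 0 = F"
      "\<And>k. ?N (T (\<lambda>s. H k s - H (Suc k) s)) \<le> C * a / 2 ^ k"
      by metis
    define S where "S k s = F s - H k s" for k s
    have S: "S k \<in> ?L" for k
      unfolding S_def[abs_def] by (intro L2_diff F H)
    have "?N (\<lambda>s. T (S (Suc k)) s - T (S k) s) \<le> C * a / 2 ^ k" for k
      unfolding T_diff[OF S S] using H(4)[of k] by (simp add: S_def)
    then obtain Y where Y: "Y \<in> ?L" "\<And>k. ?N (\<lambda>s. T (S k) s - Y s) \<le> 2 * (C * a) / 2 ^ k"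
      "(\<lambda>k. ?N (\<lambda>s. T (S k) s - Y s)) \<longlonglongrightarrow> 0"
      using L2_complete[of "\<lambda>k. T (S k)" \<nu> "C * a", OF TL[OF S]] by blast
    have "(\<lambda>k. a * (1 / 2) ^ k) \<longlonglongrightarrow> a * 0"
      by (intro tendsto_intros LIMSEQ_realpow_zero) auto
    then have "(\<lambda>k. a / 2 ^ k) \<longlonglongrightarrow> 0"
      by (simp add: power_divide)
    then have "(\<lambda>k. ?N (\<lambda>s. S k s - F s)) \<longlonglongrightarrow> 0"
      by (rule tendsto_sandwich[OF _ _ tendsto_const, rotated -1]) (use H(2) in \<open>auto simp: S_def\<close>)
    then have "(L2_class \<nu> F, L2_class \<nu> Y) \<in> op_closure (L2_space \<nu>) y"
      using Y(3) by (intro L2_op_closureI[where U = S and V = "\<lambda>k. T (S k)"] F Y(1) S TL represents_pair[OF T])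
    then have "(L2_class \<nu> F, L2_class \<nu> Y) \<in> y"
      using closed unfolding closed_operator_def by blast
    then have TF: "AE s in \<nu>. Y s = T F s"
      by (simp add: represents_iff[OF T F Y(1)])
    have S0: "S 0 = (\<lambda>s. 0)" by (simp add: S_def[abs_def] H(3))
    have "?N (T F) = ?N Y"
      using TF by (intro L2_norm_cong_AE L2_measurable TL F Y) (auto elim: eventually_mono)
    also have "\<dots> \<le> ?N (\<lambda>s. Y s - T (S 0) s) + ?N (T (S 0))"
      by (rule L2_norm_le_diff[OF Y(1) TL[OF S]])
    also have "?N (\<lambda>s. Y s - T (S 0) s) = ?N (\<lambda>s. T (S 0) s - Y s)"
      by (rule L2_norm_diff_commute)
    finally show ?thesis
      using Y(2)[of 0] T0 by (simp add: S0 a_def)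
  qed
  show ?thesis
    unfolding bounded_operators_def
  proof (intro CollectI conjI lin dom exI[of _ "2 * C"] ballI, clarify)
    fix a b assume ab: "(a, b) \<in> y"
    then have "a \<in> hcarrier (L2_space \<nu>)" "b \<in> hcarrier (L2_space \<nu>)"
      using lin unfolding linear_operator_def by blast+
    then obtain F G where F: "F \<in> ?L" "a = L2_class \<nu> F" and G: "G \<in> ?L" "b = L2_class \<nu> G"
      by (auto simp: L2_carrier_iff)
    have "AE s in \<nu>. G s = T F s"
      using ab by (simp add: F G represents_iff[OF T])
    then have "?N G = ?N (T F)"
      by (intro L2_norm_cong_AE L2_measurable TL F G)
    then show "hnorm (L2_space \<nu>) b \<le> 2 * C * hnorm (L2_space \<nu>) a"
      using bound[OF F(1)] by (simp add: hnorm_L2 F G)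
  qed
qed

section \<open>The von Neumann algebra and its projections\<close>

lemma commutant_bounded: "commutant K G \<subseteq> bounded_operators K"
  by (auto simp: commutant_def)

lemma commutant_antimono: "G \<subseteq> G' \<Longrightarrow> commutant K G' \<subseteq> commutant K G"
  unfolding commutant_def by blast

lemma double_commutant_superset: "G \<subseteq> bounded_operators K \<Longrightarrow> G \<subseteq> commutant K (commutant K G)"
  unfolding commutant_def by (intro subsetI CollectI conjI ballI) (blast, simp)

lemma triple_commutant:
  assumes "G \<subseteq> bounded_operators K"
  shows "commutant K (commutant K (commutant K G)) = commutant K G"
  using commutant_antimono[OF double_commutant_superset[OF assms]]
    double_commutant_superset[OF commutant_bounded[of K G]] by blast

lemma Linf_tensor_BH_eq:
  "Linf_tensor_BH \<nu> = commutant (L2_space \<nu>) (commutant (L2_space \<nu>) (elementary_tensors \<nu>))"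
  by (simp add: Linf_tensor_BH_def generated_vN_def elementary_tensors_def)

lemma elementary_tensors_bounded:
  "(elementary_tensors \<nu> :: ('s \<Rightarrow> 'h::{complex_hilbert, second_countable_topology}) set operator set)
    \<subseteq> bounded_operators (L2_space \<nu>)"
proof
  fix x :: "('s \<Rightarrow> 'h) set operator" assume "x \<in> elementary_tensors \<nu>"
  then obtain g a where x: "x = mult_operator \<nu> (\<lambda>s. BH_scale (g s) a)" and ga: "g \<in> Linf_functions \<nu>" "a \<in> BH"
    unfolding elementary_tensors_def by blast
  obtain C where "AE s in \<nu>. norm (BH_scale (g s) a) \<le> C"
    using elementary_tensor_L0wo(2)[OF ga] by blast
  then show "x \<in> bounded_operators (L2_space \<nu>)"
    unfolding x by (rule mult_operator_bounded[OF elementary_tensor_L0wo(1)[OF ga]])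
qed

lemma commutant_Linf_tensor_BH:
  "commutant (L2_space \<nu>) (Linf_tensor_BH \<nu>) = commutant (L2_space \<nu>) (elementary_tensors \<nu>)"
  unfolding Linf_tensor_BH_eq by (rule triple_commutant[OF elementary_tensors_bounded])

lemma mult_operator_comp_subset:
  fixes f :: "'s \<Rightarrow> 'h::{complex_hilbert, second_countable_topology} \<Rightarrow>\<^sub>L 'h"
  assumes f: "f \<in> L0wo_functions \<nu>" and g: "g \<in> L0wo_functions \<nu>"
  shows "mult_operator \<nu> g O mult_operator \<nu> f \<subseteq> mult_operator \<nu> (\<lambda>s. f s o\<^sub>L g s)"
proof (rule subrelI)
  fix a c assume "(a, c) \<in> mult_operator \<nu> g O mult_operator \<nu> f"
  then obtain b where "(a, b) \<in> mult_operator \<nu> g" and bc: "(b, c) \<in> mult_operator \<nu> f"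
    by blast
  then obtain F G where F: "F \<in> L2_functions \<nu>" "G \<in> L2_functions \<nu>" "a = L2_class \<nu> F" "b = L2_class \<nu> G"
    "AE s in \<nu>. G s = blinfun_apply (g s) (F s)"
    by (elim mult_operator_cases_AE)
  have "c \<in> hcarrier (L2_space \<nu>)"
    using bc mult_operator_carrier by blast
  then obtain E where E: "E \<in> L2_functions \<nu>" "c = L2_class \<nu> E"
    by (auto simp: L2_carrier_iff)
  have "AE s in \<nu>. E s = blinfun_apply (f s) (G s)"
    using bc by (simp add: F E mult_operator_iff[OF f F(2) E(1)])
  then have "AE s in \<nu>. E s = blinfun_apply (f s o\<^sub>L g s) (F s)"
    using F(5) by eventually_elim simp
  then show "(a, c) \<in> mult_operator \<nu> (\<lambda>s. f s o\<^sub>L g s)"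
    by (simp add: F E mult_operator_iff[OF L0wo_compose[OF f g] F(1) E(1)])
qed

text \<open>
  Scalars commute with \<open>f s\<close> at every point. For unbounded \<open>f\<close> there is only an inclusion: where
  \<open>\<phi>\<close> is small, \<open>f (\<phi> F)\<close> can be square integrable although \<open>f F\<close> is not.
\<close>

lemma scalar_comp_mult_operator:
  fixes f :: "'s \<Rightarrow> 'h::{complex_hilbert, second_countable_topology} \<Rightarrow>\<^sub>L 'h"
  assumes f: "f \<in> L0wo_functions \<nu>" and \<phi>: "\<phi> \<in> borel_measurable \<nu>"
    and y: "y = mult_operator \<nu> (\<lambda>s. BH_scale (\<phi> s) id_blinfun)" "y \<in> bounded_operators (L2_space \<nu>)"
  shows "mult_operator \<nu> f O y \<subseteq> y O mult_operator \<nu> f"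
    and "mult_operator \<nu> f \<in> bounded_operators (L2_space \<nu>) \<Longrightarrow> mult_operator \<nu> f O y = y O mult_operator \<nu> f"
proof -
  have s: "(\<lambda>s. BH_scale (\<phi> s) id_blinfun :: 'h \<Rightarrow>\<^sub>L 'h) \<in> L0wo_functions \<nu>"
    by (intro L0wo_scale \<phi> L0wo_const BH_id)
  have eq: "mult_operator \<nu> (\<lambda>s. f s o\<^sub>L BH_scale (\<phi> s) id_blinfun)
      = mult_operator \<nu> (\<lambda>s. BH_scale (\<phi> s) id_blinfun o\<^sub>L f s)"
    by (rule mult_operator_cong[OF L0wo_compose[OF f s] L0wo_compose[OF s f]], rule AE_I2, rule blinfun_eqI)
      (simp add: BH_scale_apply BH_D[OF L0wo_BH[OF f]])
  have 1: "y O mult_operator \<nu> f = mult_operator \<nu> (\<lambda>s. f s o\<^sub>L BH_scale (\<phi> s) id_blinfun)"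
    unfolding y(1) by (rule mult_operator_comp[OF f s y(2)[unfolded y(1)]])
  show "mult_operator \<nu> f O y \<subseteq> y O mult_operator \<nu> f"
    unfolding 1 eq unfolding y(1) by (rule mult_operator_comp_subset[OF s f])
  show "mult_operator \<nu> f O y = y O mult_operator \<nu> f"
    if "mult_operator \<nu> f \<in> bounded_operators (L2_space \<nu>)"
    unfolding 1 eq unfolding y(1) by (rule mult_operator_comp[OF s f that])
qed

lemma mult_operator_affiliated:
  fixes f :: "'s \<Rightarrow> 'h::{complex_hilbert, second_countable_topology} \<Rightarrow>\<^sub>L 'h"
  assumes sf: "sigma_finite_measure \<nu>" and f: "f \<in> L0wo_functions \<nu>"
  shows "affiliated (L2_space \<nu>) (Linf_tensor_BH \<nu>) (mult_operator \<nu> f)"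
  unfolding affiliated_def commutant_Linf_tensor_BH
proof (intro conjI ballI mult_operator_linear[OF f])
  fix y :: "('s \<Rightarrow> 'h) set operator"
  assume y: "y \<in> commutant (L2_space \<nu>) (elementary_tensors \<nu>)"
  obtain \<phi> where \<phi>: "\<phi> \<in> borel_measurable \<nu>" "y = mult_operator \<nu> (\<lambda>s. BH_scale (\<phi> s) id_blinfun)"
    by (rule commutant_elementary_tensors[OF sf y])
  show "mult_operator \<nu> f O y \<subseteq> y O mult_operator \<nu> f"
    using y commutant_bounded by (intro scalar_comp_mult_operator(1)[OF f \<phi>]) blast
qed

lemma mult_operator_in_Linf_tensor_BH:
  fixes f :: "'s \<Rightarrow> 'h::{complex_hilbert, second_countable_topology} \<Rightarrow>\<^sub>L 'h"
  assumes sf: "sigma_finite_measure \<nu>" and f: "f \<in> L0wo_functions \<nu>" and le: "AE s in \<nu>. norm (f s) \<le> C"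
  shows "mult_operator \<nu> f \<in> Linf_tensor_BH \<nu>"
proof -
  have bdd: "mult_operator \<nu> f \<in> bounded_operators (L2_space \<nu>)"
    by (rule mult_operator_bounded[OF f le])
  have "y O mult_operator \<nu> f = mult_operator \<nu> f O y"
    if y: "y \<in> commutant (L2_space \<nu>) (elementary_tensors \<nu>)" for y
  proof -
    obtain \<phi> where \<phi>: "\<phi> \<in> borel_measurable \<nu>" "y = mult_operator \<nu> (\<lambda>s. BH_scale (\<phi> s) id_blinfun)"
      by (rule commutant_elementary_tensors[OF sf y])
    show ?thesis
      using scalar_comp_mult_operator(2)[OF f \<phi> _ bdd] y commutant_bounded by blast
  qed
  then show ?thesis
    unfolding Linf_tensor_BH_eq using bdd by (auto simp: commutant_def[of _ "commutant _ _"])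
qed

definition indicator_op ::
    "'s measure \<Rightarrow> ('s \<Rightarrow> bool) \<Rightarrow> ('s \<Rightarrow> 'h::{complex_hilbert, second_countable_topology}) set operator"
  where "indicator_op \<nu> P = mult_operator \<nu> (\<lambda>s. if P s then id_blinfun else 0)"

lemma indicator_op_in_elementary_tensors:
  assumes P: "Measurable.pred \<nu> P"
  shows "(indicator_op \<nu> P :: ('s \<Rightarrow> 'h::{complex_hilbert, second_countable_topology}) set operator)
    \<in> elementary_tensors \<nu>"
proof -
  have "(\<lambda>s. if P s then 1 else 0 :: complex) \<in> borel_measurable \<nu>"
    using P by measurable
  then have "(\<lambda>s. if P s then 1 else 0 :: complex) \<in> Linf_functions \<nu>"
    unfolding Linf_functions_def by (auto intro!: exI[of _ 1])
  moreover have "(\<lambda>s. if P s then id_blinfun else 0) = (\<lambda>s. BH_scale (if P s then 1 else 0) id_blinfun :: 'h \<Rightarrow>\<^sub>L 'h)"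
    by (auto intro!: ext blinfun_eqI simp: BH_scale_apply scaleC.zero_left)
  ultimately show ?thesis
    unfolding indicator_op_def elementary_tensors_def using BH_id by auto
qed

lemma indicator_op_in_commutant:
  assumes P: "Measurable.pred \<nu> P"
  shows "(indicator_op \<nu> P :: ('s \<Rightarrow> 'h::{complex_hilbert, second_countable_topology}) set operator)
    \<in> commutant (L2_space \<nu>) (elementary_tensors \<nu>)"
  unfolding commutant_def
proof (intro CollectI conjI ballI)
  let ?y = "indicator_op \<nu> P :: ('s \<Rightarrow> 'h) set operator"
  show bdd: "?y \<in> bounded_operators (L2_space \<nu>)"
    using indicator_op_in_elementary_tensors[OF P] elementary_tensors_bounded by blast
  fix x :: "('s \<Rightarrow> 'h) set operator" assume x: "x \<in> elementary_tensors \<nu>"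
  then obtain g a where x_eq: "x = mult_operator \<nu> (\<lambda>s. BH_scale (g s) a)" and ga: "g \<in> Linf_functions \<nu>" "a \<in> BH"
    unfolding elementary_tensors_def by blast
  have "(\<lambda>s. if P s then 1 else 0 :: complex) \<in> borel_measurable \<nu>"
    using P by measurable
  moreover have "?y = mult_operator \<nu> (\<lambda>s. BH_scale (if P s then 1 else 0) id_blinfun)"
    unfolding indicator_op_def
    by (intro arg_cong[where f = "mult_operator \<nu>"]) (auto intro!: ext blinfun_eqI simp: BH_scale_apply scaleC.zero_left)
  ultimately show "x O ?y = ?y O x"
    unfolding x_eq using bdd x elementary_tensors_bounded
    by (intro scalar_comp_mult_operator(2)[OF elementary_tensor_L0wo(1)[OF ga]]) (auto simp: x_eq)
qed

lemma indicator_op_in_center: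
  assumes P: "Measurable.pred \<nu> P"
  shows "(indicator_op \<nu> P :: ('s \<Rightarrow> 'h::{complex_hilbert, second_countable_topology}) set operator)
    \<in> center (L2_space \<nu>) (Linf_tensor_BH \<nu>)"
  unfolding center_def commutant_Linf_tensor_BH
  using indicator_op_in_commutant[OF P] indicator_op_in_elementary_tensors[OF P]
    double_commutant_superset[OF elementary_tensors_bounded] unfolding Linf_tensor_BH_eq by blast

text \<open>Every element of the algebra commutes with the indicators, hence is decomposable.\<close>

lemma Linf_tensor_BH_cases:
  fixes x :: "('s \<Rightarrow> 'h::{complex_hilbert, second_countable_topology}) set operator"
  assumes sf: "sigma_finite_measure \<nu>" and x: "x \<in> Linf_tensor_BH \<nu>"
  obtains f C where "f \<in> L0wo_functions \<nu>" "\<And>s. norm (f s) \<le> C" "x = mult_operator \<nu> f"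
proof (rule decomposable_operator[OF sf])
  show "x \<in> bounded_operators (L2_space \<nu>)"
    using x commutant_bounded unfolding Linf_tensor_BH_eq by blast
  show "mult_operator \<nu> (\<lambda>s. if P s then id_blinfun else 0) O x
      = x O mult_operator \<nu> (\<lambda>s. if P s then id_blinfun else 0)" if "Measurable.pred \<nu> P" for P
    using x indicator_op_in_commutant[OF that]
    unfolding Linf_tensor_BH_eq indicator_op_def commutant_def[of _ "commutant _ _"] by blast
qed (rule that)

definition projection_field ::
    "'s measure \<Rightarrow> ('s \<Rightarrow> 'h::{complex_hilbert, second_countable_topology} \<Rightarrow>\<^sub>L 'h) \<Rightarrow> bool"
  where "projection_field \<nu> f \<longleftrightarrow> f \<in> L0wo_functions \<nu> \<and> (\<exists>C. AE s in \<nu>. norm (f s) \<le> C) \<and>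
    (AE s in \<nu>. f s o\<^sub>L f s = f s \<and> BH_adj (f s) = f s)"

lemma projection_field_L0wo: "projection_field \<nu> f \<Longrightarrow> f \<in> L0wo_functions \<nu>"
  by (simp add: projection_field_def)

lemma projection_field_AE: "projection_field \<nu> f \<Longrightarrow> AE s in \<nu>. f s o\<^sub>L f s = f s \<and> BH_adj (f s) = f s"
  by (simp add: projection_field_def)

lemma projection_field_bounded:
  "projection_field \<nu> f \<Longrightarrow> mult_operator \<nu> f \<in> bounded_operators (L2_space \<nu>)"
  unfolding projection_field_def by (auto intro: mult_operator_bounded)

lemma projection_fieldI:
  assumes "f \<in> L0wo_functions \<nu>" "AE s in \<nu>. norm (f s) \<le> C"
    "AE s in \<nu>. f s o\<^sub>L f s = f s \<and> BH_adj (f s) = f s"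
  shows "projection_field \<nu> f"
  using assms unfolding projection_field_def by blast

lemma projection_bounded_operator:
  fixes f :: "'s \<Rightarrow> 'h::{complex_hilbert, second_countable_topology} \<Rightarrow>\<^sub>L 'h"
  assumes p: "projection_field \<nu> f"
  shows "mult_operator \<nu> f O mult_operator \<nu> f = mult_operator \<nu> f"
    and "op_adj (L2_space \<nu>) (mult_operator \<nu> f) = mult_operator \<nu> f"
proof -
  note f = projection_field_L0wo[OF p]
  have "mult_operator \<nu> f O mult_operator \<nu> f = mult_operator \<nu> (\<lambda>s. f s o\<^sub>L f s)"
    by (rule mult_operator_comp[OF f f projection_field_bounded[OF p]])
  also have "\<dots> = mult_operator \<nu> f"
    using projection_field_AE[OF p] by (intro mult_operator_cong L0wo_compose f) (auto elim: eventually_mono)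
  finally show "mult_operator \<nu> f O mult_operator \<nu> f = mult_operator \<nu> f" .
  show "op_adj (L2_space \<nu>) (mult_operator \<nu> f) = mult_operator \<nu> f"
    unfolding mult_operator_adj[OF f]
    using projection_field_AE[OF p] by (intro mult_operator_cong L0wo_adj f) (auto elim: eventually_mono)
qed

lemma projection_field_in_projections:
  assumes sf: "sigma_finite_measure \<nu>" and p: "projection_field \<nu> f"
  shows "mult_operator \<nu> f \<in> projections (L2_space \<nu>) (Linf_tensor_BH \<nu>)"
    and "mult_operator \<nu> f \<in> projections (L2_space \<nu>) (bounded_operators (L2_space \<nu>))"
proof -
  have "mult_operator \<nu> f \<in> Linf_tensor_BH \<nu>"
    using p unfolding projection_field_def by (auto intro: mult_operator_in_Linf_tensor_BH[OF sf])
  then show "mult_operator \<nu> f \<in> projections (L2_space \<nu>) (Linf_tensor_BH \<nu>)"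
    "mult_operator \<nu> f \<in> projections (L2_space \<nu>) (bounded_operators (L2_space \<nu>))"
    using projection_field_bounded[OF p] projection_bounded_operator[OF p]
    by (simp_all add: projections_def)
qed

lemma projections_cases:
  fixes p :: "('s \<Rightarrow> 'h::{complex_hilbert, second_countable_topology}) set operator"
  assumes sf: "sigma_finite_measure \<nu>" and p: "p \<in> projections (L2_space \<nu>) M" and M: "M \<subseteq> Linf_tensor_BH \<nu>"
  obtains f where "projection_field \<nu> f" "p = mult_operator \<nu> f"
proof -
  have "p \<in> Linf_tensor_BH \<nu>"
    using p M by (auto simp: projections_def)
  then obtain f C where f: "f \<in> L0wo_functions \<nu>" "\<And>s. norm (f s) \<le> C" and p_eq: "p = mult_operator \<nu> f"
    using Linf_tensor_BH_cases[OF sf] by blast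
  have bdd: "mult_operator \<nu> f \<in> bounded_operators (L2_space \<nu>)"
    by (rule mult_operator_bounded[OF f(1)]) (use f(2) in auto)
  have "mult_operator \<nu> (\<lambda>s. f s o\<^sub>L f s) = mult_operator \<nu> f"
    using p unfolding mult_operator_comp[OF f(1) f(1) bdd, symmetric] by (simp add: projections_def p_eq)
  then have 1: "AE s in \<nu>. f s o\<^sub>L f s = f s"
    by (rule mult_operator_inject[OF sf L0wo_compose[OF f(1) f(1)] f(1)])
  have "mult_operator \<nu> (\<lambda>s. BH_adj (f s)) = mult_operator \<nu> f"
    using p unfolding mult_operator_adj[OF f(1), symmetric] by (simp add: projections_def p_eq)
  then have 2: "AE s in \<nu>. BH_adj (f s) = f s"
    by (rule mult_operator_inject[OF sf L0wo_adj[OF f(1)] f(1)])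
  show thesis
  proof (rule that[OF _ p_eq])
    show "projection_field \<nu> f"
      by (rule projection_fieldI[OF f(1), of C]) (use f(2) 1 2 in auto)
  qed
qed

lemma projection_range_iff:
  fixes f :: "'s \<Rightarrow> 'h::{complex_hilbert, second_countable_topology} \<Rightarrow>\<^sub>L 'h"
  assumes p: "projection_field \<nu> f"
  shows "b \<in> Range (mult_operator \<nu> f) \<longleftrightarrow> (b, b) \<in> mult_operator \<nu> f"
proof
  assume "b \<in> Range (mult_operator \<nu> f)"
  then obtain a where a: "(a, b) \<in> mult_operator \<nu> f" by blast
  then have "(a, b) \<in> mult_operator \<nu> f O mult_operator \<nu> f"
    by (simp add: projection_bounded_operator(1)[OF p])
  then obtain c where "(a, c) \<in> mult_operator \<nu> f" "(c, b) \<in> mult_operator \<nu> f" by blast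
  moreover have "single_valued (mult_operator \<nu> f)"
    using mult_operator_linear[OF projection_field_L0wo[OF p]] unfolding linear_operator_def by blast
  ultimately show "(b, b) \<in> mult_operator \<nu> f"
    using a single_valuedD by metis
qed blast

lemma proj_le_projection_field:
  fixes f g :: "'s \<Rightarrow> 'h::{complex_hilbert, second_countable_topology} \<Rightarrow>\<^sub>L 'h"
  assumes sf: "sigma_finite_measure \<nu>" and p: "projection_field \<nu> f" and q: "projection_field \<nu> g"
  shows "proj_le (mult_operator \<nu> f) (mult_operator \<nu> g) \<longleftrightarrow> (AE s in \<nu>. g s o\<^sub>L f s = f s)"
proof -
  note f = projection_field_L0wo[OF p] and g = projection_field_L0wo[OF q]
  have comp: "mult_operator \<nu> f O mult_operator \<nu> g = mult_operator \<nu> (\<lambda>s. g s o\<^sub>L f s)"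
    by (rule mult_operator_comp[OF g f projection_field_bounded[OF p]])
  have single: "single_valued (mult_operator \<nu> g)"
    using mult_operator_linear[OF g] unfolding linear_operator_def by blast
  show ?thesis
  proof
    assume "proj_le (mult_operator \<nu> f) (mult_operator \<nu> g)"
    then have sub: "(b, b) \<in> mult_operator \<nu> g" if "(a, b) \<in> mult_operator \<nu> f" for a b
      using that projection_range_iff[OF q] unfolding proj_le_def by blast
    have "mult_operator \<nu> f O mult_operator \<nu> g = mult_operator \<nu> f"
    proof (intro equalityI subrelI)
      fix a c assume "(a, c) \<in> mult_operator \<nu> f O mult_operator \<nu> g"
      then obtain b where b: "(a, b) \<in> mult_operator \<nu> f" "(b, c) \<in> mult_operator \<nu> g" by blast
      have "c = b"
        by (rule single_valuedD[OF single b(2) sub[OF b(1)]])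
      with b show "(a, c) \<in> mult_operator \<nu> f" by simp
    next
      fix a b assume ab: "(a, b) \<in> mult_operator \<nu> f"
      then show "(a, b) \<in> mult_operator \<nu> f O mult_operator \<nu> g"
        using sub[OF ab] by blast
    qed
    then show "AE s in \<nu>. g s o\<^sub>L f s = f s"
      unfolding comp by (rule mult_operator_inject[OF sf L0wo_compose[OF g f] f])
  next
    assume "AE s in \<nu>. g s o\<^sub>L f s = f s"
    then have "mult_operator \<nu> f O mult_operator \<nu> g = mult_operator \<nu> f"
      unfolding comp by (intro mult_operator_cong L0wo_compose f g)
    then show "proj_le (mult_operator \<nu> f) (mult_operator \<nu> g)"
      unfolding proj_le_def by blast
  qed
qed

lemma op_one_L2: "op_one (L2_space \<nu>) =
  mult_operator \<nu> (\<lambda>s. id_blinfun :: 'h::{complex_hilbert, second_countable_topology} \<Rightarrow>\<^sub>L 'h)"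
proof (rule L2_operator_eqI[OF _ mult_operator_carrier])
  show "op_one (L2_space \<nu>) \<subseteq> hcarrier (L2_space \<nu>) \<times> hcarrier (L2_space \<nu>)"
    by (auto simp: op_one_def)
  fix F G :: "'a \<Rightarrow> 'h" assume F: "F \<in> L2_functions \<nu>" and G: "G \<in> L2_functions \<nu>"
  have "(L2_class \<nu> F, L2_class \<nu> G) \<in> op_one (L2_space \<nu>) \<longleftrightarrow> L2_class \<nu> F = L2_class \<nu> G"
    by (auto simp: op_one_def Id_on_iff F G)
  also have "\<dots> \<longleftrightarrow> (AE s in \<nu>. G s = blinfun_apply id_blinfun (F s))"
    by (simp add: L2_class_eq_iff F G eq_commute)
  finally show "(L2_class \<nu> F, L2_class \<nu> G) \<in> op_one (L2_space \<nu>) \<longleftrightarrow>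
      (L2_class \<nu> F, L2_class \<nu> G) \<in> mult_operator \<nu> (\<lambda>s. id_blinfun)"
    by (simp add: mult_operator_iff[OF L0wo_const[OF BH_id] F G])
qed

lemma proj_perp_mult_operator:
  fixes f :: "'s \<Rightarrow> 'h::{complex_hilbert, second_countable_topology} \<Rightarrow>\<^sub>L 'h"
  assumes f: "f \<in> L0wo_functions \<nu>" and bdd: "mult_operator \<nu> f \<in> bounded_operators (L2_space \<nu>)"
  shows "proj_perp (L2_space \<nu>) (mult_operator \<nu> f) = mult_operator \<nu> (\<lambda>s. id_blinfun - f s)"
proof (rule L2_operator_eqI[OF _ mult_operator_carrier])
  note g = L0wo_diff[OF L0wo_const[OF BH_id] f]
  note lin = mult_operator_linear[OF f]
  obtain T where T: "represents \<nu> (mult_operator \<nu> f) T"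
    by (rule represents_exists[OF lin bounded_operators_Domain[OF bdd]])
  have T_eq: "AE s in \<nu>. T F s = blinfun_apply (f s) (F s)" if F: "F \<in> L2_functions \<nu>" for F
    using represents_pair[OF T F] by (simp add: mult_operator_iff[OF f F represents_in[OF T F]])
  have perp: "(a, b) \<in> proj_perp (L2_space \<nu>) (mult_operator \<nu> f) \<longleftrightarrow>
      (\<exists>F\<in>L2_functions \<nu>. a = L2_class \<nu> F \<and> b = L2_class \<nu> (\<lambda>s. F s - T F s))" for a b
  proof -
    have "(a, b) \<in> proj_perp (L2_space \<nu>) (mult_operator \<nu> f) \<longleftrightarrow>
      (\<exists>c. a \<in> hcarrier (L2_space \<nu>) \<and> (a, c) \<in> mult_operator \<nu> f \<and>
        b = hadd (L2_space \<nu>) a (hscale (L2_space \<nu>) (- 1) c))"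
      unfolding proj_perp_def op_add_def op_scale_def op_one_def by auto
    also have "\<dots> \<longleftrightarrow> (\<exists>F\<in>L2_functions \<nu>. a = L2_class \<nu> F \<and>
        b = hadd (L2_space \<nu>) (L2_class \<nu> F) (hscale (L2_space \<nu>) (- 1) (L2_class \<nu> (T F))))"
    proof safe
      fix c assume "a \<in> hcarrier (L2_space \<nu>)" and ac: "(a, c) \<in> mult_operator \<nu> f"
      then obtain F where F: "F \<in> L2_functions \<nu>" "a = L2_class \<nu> F"
        by (auto simp: L2_carrier_iff)
      have "c = L2_class \<nu> (T F)"
        using ac represents_pair[OF T F(1)] lin unfolding F(2) linear_operator_def
        by (blast dest: single_valuedD)
      then show "\<exists>F\<in>L2_functions \<nu>. a = L2_class \<nu> F \<and>
          hadd (L2_space \<nu>) a (hscale (L2_space \<nu>) (- 1) c) =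
          hadd (L2_space \<nu>) (L2_class \<nu> F) (hscale (L2_space \<nu>) (- 1) (L2_class \<nu> (T F)))"
        using F by blast
    next
      fix F :: "'s \<Rightarrow> 'h" assume F: "F \<in> L2_functions \<nu>"
      show "\<exists>c. L2_class \<nu> F \<in> hcarrier (L2_space \<nu>) \<and> (L2_class \<nu> F, c) \<in> mult_operator \<nu> f \<and>
        hadd (L2_space \<nu>) (L2_class \<nu> F) (hscale (L2_space \<nu>) (- 1) (L2_class \<nu> (T F))) =
        hadd (L2_space \<nu>) (L2_class \<nu> F) (hscale (L2_space \<nu>) (- 1) c)"
        using F represents_pair[OF T F] by (intro exI[of _ "L2_class \<nu> (T F)"]) simp
    qed
    also have "\<dots> \<longleftrightarrow> (\<exists>F\<in>L2_functions \<nu>. a = L2_class \<nu> F \<and> b = L2_class \<nu> (\<lambda>s. F s - T F s))"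
      by (intro bex_cong refl)
        (simp add: hscale_L2 hadd_L2 represents_in[OF T] L2_minus scaleC_minus_one)
    finally show ?thesis .
  qed
  show "proj_perp (L2_space \<nu>) (mult_operator \<nu> f) \<subseteq> hcarrier (L2_space \<nu>) \<times> hcarrier (L2_space \<nu>)"
  proof (rule subrelI)
    fix a b assume "(a, b) \<in> proj_perp (L2_space \<nu>) (mult_operator \<nu> f)"
    then obtain F where "F \<in> L2_functions \<nu>" "a = L2_class \<nu> F" "b = L2_class \<nu> (\<lambda>s. F s - T F s)"
      unfolding perp by blast
    then show "(a, b) \<in> hcarrier (L2_space \<nu>) \<times> hcarrier (L2_space \<nu>)"
      by (simp add: L2_diff represents_in[OF T])
  qed
  fix F G :: "'s \<Rightarrow> 'h" assume F: "F \<in> L2_functions \<nu>" and G: "G \<in> L2_functions \<nu>"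
  note FT = L2_diff[OF F represents_in[OF T F]]
  have "(L2_class \<nu> F, L2_class \<nu> G) \<in> proj_perp (L2_space \<nu>) (mult_operator \<nu> f) \<longleftrightarrow>
      (AE s in \<nu>. G s = F s - T F s)"
    unfolding perp
  proof
    assume "\<exists>F'\<in>L2_functions \<nu>. L2_class \<nu> F = L2_class \<nu> F' \<and> L2_class \<nu> G = L2_class \<nu> (\<lambda>s. F' s - T F' s)"
    then obtain F' where F': "F' \<in> L2_functions \<nu>" "L2_class \<nu> F = L2_class \<nu> F'"
      "L2_class \<nu> G = L2_class \<nu> (\<lambda>s. F' s - T F' s)" by blast
    have 1: "AE s in \<nu>. F s = F' s" "AE s in \<nu>. G s = F' s - T F' s"
      using F' F G L2_diff[OF F'(1) represents_in[OF T F'(1)]] by (simp_all add: L2_class_eq_iff)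
    show "AE s in \<nu>. G s = F s - T F s"
      using 1 represents_cong[OF T F F'(1) 1(1)] by eventually_elim simp
  next
    assume "AE s in \<nu>. G s = F s - T F s"
    then have "L2_class \<nu> G = L2_class \<nu> (\<lambda>s. F s - T F s)"
      by (simp add: L2_class_eq_iff[OF G FT])
    then show "\<exists>F'\<in>L2_functions \<nu>. L2_class \<nu> F = L2_class \<nu> F' \<and> L2_class \<nu> G = L2_class \<nu> (\<lambda>s. F' s - T F' s)"
      using F by blast
  qed
  also have "\<dots> \<longleftrightarrow> (AE s in \<nu>. G s = blinfun_apply (id_blinfun - f s) (F s))"
    by (rule eventually_subst) (use T_eq[OF F] in \<open>auto elim!: eventually_mono simp: blinfun.diff_left\<close>)
  finally show "(L2_class \<nu> F, L2_class \<nu> G) \<in> proj_perp (L2_space \<nu>) (mult_operator \<nu> f) \<longleftrightarrow>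
      (L2_class \<nu> F, L2_class \<nu> G) \<in> mult_operator \<nu> (\<lambda>s. id_blinfun - f s)"
    by (simp add: mult_operator_iff[OF g F G])
qed

section \<open>Sequences of projections increasing to the identity\<close>

lemma BH_adj_id: "BH_adj id_blinfun = (id_blinfun :: 'h::complex_hilbert \<Rightarrow>\<^sub>L 'h)"
  and BH_adj_zero: "BH_adj 0 = (0 :: 'h \<Rightarrow>\<^sub>L 'h)"
  by (rule BH_adj_eqI, simp add: cinner.zero_left cinner.zero_right)+

lemma blinfun_compose_id [simp]: "id_blinfun o\<^sub>L a = a" "a o\<^sub>L id_blinfun = a"
  by (rule blinfun_eqI, simp)+

lemma blinfun_compose_zero [simp]: "a o\<^sub>L 0 = 0"
  by (rule blinfun_eqI) simp

lemma projection_field_indicator: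
  assumes P: "Measurable.pred \<nu> P"
  shows "projection_field \<nu> (\<lambda>s. if P s then id_blinfun else 0 :: 'h::{complex_hilbert, second_countable_topology} \<Rightarrow>\<^sub>L 'h)"
  by (rule projection_fieldI[OF indicator_L0wo(1)[OF P] AE_I2[OF indicator_L0wo(2)[OF P]]])
    (auto simp: BH_adj_id BH_adj_zero intro!: AE_I2)

lemma projection_field_perp:
  fixes f :: "'s \<Rightarrow> 'h::{complex_hilbert, second_countable_topology} \<Rightarrow>\<^sub>L 'h"
  assumes p: "projection_field \<nu> f"
  shows "projection_field \<nu> (\<lambda>s. id_blinfun - f s)"
proof -
  obtain C where C: "AE s in \<nu>. norm (f s) \<le> C"
    using p unfolding projection_field_def by blast
  note f = projection_field_L0wo[OF p]
  show ?thesis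
  proof (rule projection_fieldI[of _ _ "1 + C"])
    show "(\<lambda>s. id_blinfun - f s) \<in> L0wo_functions \<nu>"
      by (intro L0wo_diff L0wo_const BH_id f)
    show "AE s in \<nu>. norm (id_blinfun - f s) \<le> 1 + C"
      using C
    proof eventually_elim
      case (elim s)
      then show ?case
        using norm_triangle_ineq4[of id_blinfun "f s"] norm_blinfun_id_le[where 'a = 'h] by linarith
    qed
    show "AE s in \<nu>. (id_blinfun - f s) o\<^sub>L (id_blinfun - f s) = id_blinfun - f s \<and>
        BH_adj (id_blinfun - f s) = id_blinfun - f s"
      using projection_field_AE[OF p] AE_space
    proof eventually_elim
      case (elim s)
      have ff: "blinfun_apply (f s) (blinfun_apply (f s) x) = blinfun_apply (f s) x" for x
        using elim(1) by (metis blinfun_apply_blinfun_compose)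
      have adj: "cinner (blinfun_apply (f s) x) z = cinner x (blinfun_apply (f s) z)" for x z
        using cinner_BH_adj[OF L0wo_BH[OF f elim(2)], of x z] elim(1) by simp
      show ?case
      proof
        show "(id_blinfun - f s) o\<^sub>L (id_blinfun - f s) = id_blinfun - f s"
          by (rule blinfun_eqI) (simp add: blinfun.diff_left blinfun.diff_right ff)
        show "BH_adj (id_blinfun - f s) = id_blinfun - f s"
          by (rule BH_adj_eqI) (simp add: blinfun.diff_left cinner.diff_left cinner.diff_right adj)
      qed
    qed
  qed
qed

text \<open>An upper bound of the indicators fixes all truncations of \<open>F\<close>, hence their limit \<open>F\<close>.\<close>

lemma increases_to_one_indicator:
  assumes sf: "sigma_finite_measure \<nu>" and P: "\<And>n. Measurable.pred \<nu> (P n)"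
    and mono: "\<And>n s. P n s \<Longrightarrow> P (Suc n) s" and ev: "AE s in \<nu>. eventually (\<lambda>n. P n s) sequentially"
  shows "increases_to_one (L2_space \<nu>)
    (\<lambda>n. indicator_op \<nu> (P n) :: ('s \<Rightarrow> 'h::{complex_hilbert, second_countable_topology}) set operator)"
  unfolding increases_to_one_def
proof (intro conjI allI ballI impI)
  show "proj_le (indicator_op \<nu> (P n) :: ('s \<Rightarrow> 'h) set operator) (indicator_op \<nu> (P (Suc n)))" for n
    unfolding indicator_op_def proj_le_projection_field[OF sf projection_field_indicator[OF P] projection_field_indicator[OF P]]
    using mono by (intro AE_I2) auto
  fix q :: "('s \<Rightarrow> 'h) set operator"
  assume q: "q \<in> projections (L2_space \<nu>) (bounded_operators (L2_space \<nu>))"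
    and le: "\<forall>n. proj_le (indicator_op \<nu> (P n)) q"
  have bdd: "q \<in> bounded_operators (L2_space \<nu>)" and qq: "q O q = q"
    using q by (simp_all add: projections_def)
  note lin = bounded_operators_linear[OF bdd]
  obtain T where T: "represents \<nu> q T"
    by (rule represents_exists[OF lin bounded_operators_Domain[OF bdd]])
  obtain C where C: "0 \<le> C" "\<And>F. F \<in> L2_functions \<nu> \<Longrightarrow> L2_norm \<nu> (T F) \<le> C * L2_norm \<nu> F"
    by (rule represents_bounded[OF bdd T]) blast
  have fixed: "(b, b) \<in> q" if b: "b \<in> Range q" for b
  proof -
    obtain a where a: "(a, b) \<in> q" using b by blast
    then obtain c where "(a, c) \<in> q" "(c, b) \<in> q"
      using qq by blast
    moreover have "c = b"
      using lin a \<open>(a, c) \<in> q\<close> unfolding linear_operator_def by (blast dest: single_valuedD)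
    ultimately show ?thesis by simp
  qed
  show "q = op_one (L2_space \<nu>)"
    unfolding op_one_L2
  proof (rule represents_eq_mult_operator[OF lin T L0wo_const[OF BH_id]])
    fix F :: "'s \<Rightarrow> 'h" assume F: "F \<in> L2_functions \<nu>"
    let ?F = "\<lambda>n s. if P n s then F s else 0"
    have FL: "?F n \<in> L2_functions \<nu>" for n
      by (rule L2_If(1)[OF F P])
    have "(L2_class \<nu> (?F n), L2_class \<nu> (?F n)) \<in> indicator_op \<nu> (P n)" for n
      unfolding indicator_op_def by (simp add: mult_operator_iff[OF indicator_L0wo(1)[OF P] FL FL])
    then have "L2_class \<nu> (?F n) \<in> Range q" for n
      using le unfolding proj_le_def by blast
    then have "(L2_class \<nu> (?F n), L2_class \<nu> (?F n)) \<in> q" for n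
      by (rule fixed)
    then have TF: "AE s in \<nu>. ?F n s = T (?F n) s" for n
      by (simp add: represents_iff[OF T FL FL])
    have lim: "(\<lambda>n. L2_norm \<nu> (\<lambda>s. ?F n s - F s)) \<longlonglongrightarrow> 0"
      by (rule L2_truncation_tendsto[OF F P ev])
    have "L2_norm \<nu> (\<lambda>s. ?F n s - T F s) \<le> C * L2_norm \<nu> (\<lambda>s. ?F n s - F s)" for n
    proof -
      have "AE s in \<nu>. ?F n s - T F s = T (\<lambda>s. ?F n s - F s) s"
        using TF[of n] represents_diff[OF lin T FL[of n] F] by eventually_elim simp
      then have "L2_norm \<nu> (\<lambda>s. ?F n s - T F s) = L2_norm \<nu> (T (\<lambda>s. ?F n s - F s))"
        by (rule L2_norm_cong_AE[rotated 2]) (intro L2_measurable L2_diff represents_in[OF T] FL F)+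
      also have "\<dots> \<le> C * L2_norm \<nu> (\<lambda>s. ?F n s - F s)"
        by (rule C(2)[OF L2_diff[OF FL F]])
      finally show ?thesis .
    qed
    then have lim': "(\<lambda>n. L2_norm \<nu> (\<lambda>s. ?F n s - T F s)) \<longlonglongrightarrow> 0"
      by (intro tendsto_sandwich[OF _ _ tendsto_const tendsto_mult_right_zero[OF lim, of C]]) auto
    have "AE s in \<nu>. T F s = F s"
      by (rule L2_limit_unique[where F = ?F, OF _ represents_in[OF T F] F lim' lim]) (rule FL)
    then show "AE s in \<nu>. T F s = blinfun_apply id_blinfun (F s)"
      by simp
  qed
qed

lemma increasing_projections_step:
  fixes f :: "nat \<Rightarrow> 's \<Rightarrow> 'h::{complex_hilbert, second_countable_topology} \<Rightarrow>\<^sub>L 'h"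
  assumes sf: "sigma_finite_measure \<nu>" and p: "\<And>n. projection_field \<nu> (f n)"
    and inc: "increases_to_one (L2_space \<nu>) (\<lambda>n. mult_operator \<nu> (f n))"
  shows "AE s in \<nu>. \<forall>n. f (Suc n) s o\<^sub>L f n s = f n s"
  using inc unfolding increases_to_one_def proj_le_projection_field[OF sf p p] AE_all_countable by blast

lemma blinfun_chain:
  fixes g :: "nat \<Rightarrow> 'h::real_normed_vector \<Rightarrow>\<^sub>L 'h"
  assumes idem: "\<And>n. g n o\<^sub>L g n = g n" and step: "\<And>n. g (Suc n) o\<^sub>L g n = g n" and "n \<le> m"
  shows "blinfun_apply (g m) (blinfun_apply (g n) x) = blinfun_apply (g n) x"
  using \<open>n \<le> m\<close>
proof (induction m rule: dec_induct)
  case base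
  show ?case using idem[of n] by (metis blinfun_apply_blinfun_compose)
next
  case (step m)
  then show ?case
    using assms(2)[of m] by (metis blinfun_apply_blinfun_compose)
qed

text \<open>
  If the sequence were constant from some index on over a set of positive measure, replacing its
  limit there by the constant value would give a smaller upper bound than the identity.
\<close>

lemma increasing_projections_not_stationary:
  fixes f :: "nat \<Rightarrow> 's \<Rightarrow> 'h::{complex_hilbert, second_countable_topology} \<Rightarrow>\<^sub>L 'h"
  assumes sf: "sigma_finite_measure \<nu>" and p: "\<And>n. projection_field \<nu> (f n)"
    and inc: "increases_to_one (L2_space \<nu>) (\<lambda>n. mult_operator \<nu> (f n))"
  shows "AE s in \<nu>. \<forall>m. f m s \<noteq> id_blinfun \<longrightarrow> (\<exists>n\<ge>m. f n s \<noteq> f (Suc n) s)"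
  unfolding AE_all_countable
proof
  fix m
  note f = projection_field_L0wo[OF p]
  define E where "E s \<longleftrightarrow> f m s \<noteq> id_blinfun \<and> (\<forall>n\<in>{m..}. f n s = f (Suc n) s)" for s
  have E: "Measurable.pred \<nu> E"
    unfolding E_def[abs_def]
    by (intro pred_intros_logic measurable_pred_countable(1) L0wo_eq_pred f L0wo_const BH_id) auto
  define q where "q s = (if E s then f m s else id_blinfun)" for s
  obtain C where C: "AE s in \<nu>. norm (f m s) \<le> C"
    using p[of m] unfolding projection_field_def by blast
  have q: "projection_field \<nu> q"
  proof (rule projection_fieldI[of _ _ "max C 1"])
    show "q \<in> L0wo_functions \<nu>"
      unfolding q_def[abs_def] by (intro L0wo_If f L0wo_const BH_id E)
    show "AE s in \<nu>. norm (q s) \<le> max C 1"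
      using C by eventually_elim (use norm_blinfun_id_le[where 'a = 'h] in \<open>auto simp: q_def le_max_iff_disj\<close>)
    show "AE s in \<nu>. q s o\<^sub>L q s = q s \<and> BH_adj (q s) = q s"
      using projection_field_AE[OF p[of m]] by eventually_elim (auto simp: q_def BH_adj_id)
  qed
  have "proj_le (mult_operator \<nu> (f n)) (mult_operator \<nu> q)" for n
    unfolding proj_le_projection_field[OF sf p q]
  proof -
    have "AE s in \<nu>. \<forall>n. f n s o\<^sub>L f n s = f n s"
      unfolding AE_all_countable using projection_field_AE[OF p] by (auto elim: eventually_mono)
    then show "AE s in \<nu>. q s o\<^sub>L f n s = f n s"
      using increasing_projections_step[OF sf p inc]
    proof eventually_elim
      case (elim s)
      show ?case
      proof (cases "E s")
        case True
        have chain: "f k s o\<^sub>L f n s = f n s" if "n \<le> k" for k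
          by (rule blinfun_eqI) (simp add: blinfun_chain[of "\<lambda>n. f n s", OF _ _ that] elim)
        have "f m s o\<^sub>L f n s = f n s"
        proof (cases "n \<le> m")
          case False
          then have "m \<le> n" by simp
          then have "f n s = f m s"
          proof (induction n rule: dec_induct)
            case (step k)
            have "f k s = f (Suc k) s"
              using True step(1) unfolding E_def by (meson atLeast_iff)
            with step.IH show ?case by metis
          qed simp
          then show ?thesis using elim by simp
        qed (rule chain)
        then show ?thesis using True by (simp add: q_def)
      qed (simp add: q_def)
    qed
  qed
  then have "mult_operator \<nu> q = op_one (L2_space \<nu>)"
    using inc projection_field_in_projections(2)[OF sf q] unfolding increases_to_one_def by blast
  then have "AE s in \<nu>. q s = id_blinfun"
    unfolding op_one_L2 by (rule mult_operator_inject[OF sf projection_field_L0wo[OF q] L0wo_const[OF BH_id]])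
  then show "AE s in \<nu>. f m s \<noteq> id_blinfun \<longrightarrow> (\<exists>n\<ge>m. f n s \<noteq> f (Suc n) s)"
  proof eventually_elim
    case (elim s)
    have "\<not> E s"
    proof
      assume "E s"
      with elim have "f m s = id_blinfun" by (simp add: q_def)
      with \<open>E s\<close> show False unfolding E_def by blast
    qed
    then show ?case unfolding E_def by (meson atLeast_iff)
  qed
qed

text \<open>
  Where no \<open>f n\<close> is the identity, the increments \<open>f (Suc n) - f n\<close> are nonzero infinitely often and
  provide a measurable orthonormal sequence below \<open>1 - f 0\<close>. The corresponding field of shifts
  would show that \<open>1 - f 0\<close> is equivalent to a proper subprojection.
\<close>

lemma finite_perp_exhausts:
  fixes f :: "nat \<Rightarrow> 's \<Rightarrow> 'h::{complex_hilbert, second_countable_topology} \<Rightarrow>\<^sub>L 'h"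
  assumes sf: "sigma_finite_measure \<nu>" and p: "\<And>n. projection_field \<nu> (f n)"
    and inc: "increases_to_one (L2_space \<nu>) (\<lambda>n. mult_operator \<nu> (f n))"
    and fin: "finite_projection (L2_space \<nu>) (Linf_tensor_BH \<nu>) (proj_perp (L2_space \<nu>) (mult_operator \<nu> (f 0)))"
  shows "AE s in \<nu>. \<exists>n. f n s = id_blinfun"
proof -
  note f = projection_field_L0wo[OF p]
  define Q where "Q s n \<longleftrightarrow> f n s \<noteq> f (Suc n) s" for s n
  define good where "good s \<longleftrightarrow> (\<forall>n. f n s o\<^sub>L f n s = f n s) \<and> (\<forall>n. BH_adj (f n s) = f n s) \<and>
    (\<forall>n. f (Suc n) s o\<^sub>L f n s = f n s) \<and> (\<forall>m. f m s \<noteq> id_blinfun \<longrightarrow> (\<exists>n\<in>{m..}. Q s n))" for s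
  have AE_good: "AE s in \<nu>. good s"
  proof -
    have "AE s in \<nu>. \<forall>n. f n s o\<^sub>L f n s = f n s \<and> BH_adj (f n s) = f n s"
      unfolding AE_all_countable using projection_field_AE[OF p] by blast
    then show ?thesis
      using increasing_projections_step[OF sf p inc] increasing_projections_not_stationary[OF sf p inc]
      by eventually_elim (auto simp: good_def Q_def)
  qed
  have Q_pred: "Measurable.pred \<nu> (\<lambda>s. Q s n)" for n
    unfolding Q_def[abs_def] by (intro pred_intros_logic L0wo_eq_pred f)
  have good_pred: "Measurable.pred \<nu> good"
    unfolding good_def[abs_def]
    by (intro pred_intros_logic pred_intros_countable measurable_pred_countable(2) L0wo_eq_pred
        L0wo_compose L0wo_adj f L0wo_const BH_id Q_pred) auto
  \<comment> \<open>the set that has to be shown null\<close>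
  define B where "B s \<longleftrightarrow> good s \<and> (\<forall>n. f n s \<noteq> id_blinfun)" for s
  have B_pred: "Measurable.pred \<nu> B"
    unfolding B_def[abs_def]
    by (intro pred_intros_logic pred_intros_countable good_pred L0wo_eq_pred f L0wo_const BH_id)
  define r where "r n s = f (Suc n) s - f n s" for n s
  have r: "r n \<in> L0wo_functions \<nu>" for n
    unfolding r_def[abs_def] by (intro L0wo_diff f)
  obtain D :: "'h set" where D: "countable D" "closure D = UNIV"
    by (rule countable_dense_closure)
  then have "D \<noteq> {}" by auto
  define d where "d = from_nat_into D"
  have range_d: "range d = D"
    unfolding d_def by (rule range_from_nat_into[OF \<open>D \<noteq> {}\<close> D(1)])
  define j where "j n s = (LEAST i. blinfun_apply (r n s) (d i) \<noteq> 0)" for n s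
  have j_meas: "j n \<in> measurable \<nu> (count_space UNIV)" for n
    unfolding j_def[abs_def]
  proof (rule measurable_Least)
    fix i
    have "(\<lambda>s. blinfun_apply (r n s) (d i)) \<in> borel_measurable \<nu>"
      by (rule L0wo_apply_const[OF r])
    then show "Measurable.pred \<nu> (\<lambda>s. blinfun_apply (r n s) (d i) \<noteq> 0)"
      by measurable
  qed
  define x where "x n s = blinfun_apply (r n s) (d (j n s))" for n s
  have x_meas: "x n \<in> borel_measurable \<nu>" for n
    unfolding x_def[abs_def]
    by (rule measurable_compose_countable[OF _ j_meas]) (rule L0wo_apply_const[OF r])
  define w where "w n s = (1 / norm (x n s)) *\<^sub>R x n s" for n s
  have w_meas: "w n \<in> borel_measurable \<nu>" for n
    unfolding w_def[abs_def] using x_meas[of n] by measurable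
  \<comment> \<open>the positions of the nonzero increments in increasing order\<close>
  define N where "N k s = rec_nat (LEAST n. Q s n) (\<lambda>_ m. LEAST n. Q s n \<and> m < n) k" for k s
  have N_0: "N 0 s = (LEAST n. Q s n)" and N_Suc: "N (Suc k) s = (LEAST n. Q s n \<and> N k s < n)" for k s
    by (simp_all add: N_def)
  have N_meas: "N k \<in> measurable \<nu> (count_space UNIV)" for k
  proof (induction k)
    case 0
    show ?case
      unfolding N_0[abs_def] by (intro measurable_Least Q_pred)
  next
    case (Suc k)
    have "Measurable.pred \<nu> (\<lambda>s. Q s n \<and> N k s < n)" for n
      using Q_pred[of n] Suc.IH by measurable
    then show ?case
      unfolding N_Suc[abs_def] by (intro measurable_Least)
  qed
  define u where "u k s = w (N k s) s" for k s
  have u_meas: "u k \<in> borel_measurable \<nu>" for k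
    unfolding u_def[abs_def] by (rule measurable_compose_countable[OF w_meas N_meas])
  define e where "e s = id_blinfun - f 0 s" for s
  have e_field: "projection_field \<nu> e"
    unfolding e_def[abs_def] by (rule projection_field_perp[OF p])
  note e = projection_field_L0wo[OF e_field]
  have fiber: "e s o\<^sub>L e s = e s \<and> BH_adj (e s) = e s \<and> orthonormal (\<lambda>k. u k s) \<and>
      (\<forall>k. blinfun_apply (e s) (u k s) = u k s)" if s: "s \<in> space \<nu>" and Bs: "B s" for s
  proof -
    have good: "\<And>n. f n s o\<^sub>L f n s = f n s" "\<And>n. BH_adj (f n s) = f n s"
      "\<And>n. f (Suc n) s o\<^sub>L f n s = f n s" and inf: "\<And>m. \<exists>n\<ge>m. Q s n"
      using Bs unfolding B_def good_def by auto
    have adj: "cinner (blinfun_apply (f n s) y) z = cinner y (blinfun_apply (f n s) z)" for n y z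
      using cinner_BH_adj[OF L0wo_BH[OF f s], of n y z] good(2) by simp
    have up: "blinfun_apply (f m s) (blinfun_apply (f n s) y) = blinfun_apply (f n s) y" if "n \<le> m" for n m y
      by (rule blinfun_chain[of "\<lambda>n. f n s", OF good(1,3) that])
    have down: "blinfun_apply (f n s) (blinfun_apply (f m s) y) = blinfun_apply (f n s) y" if "n \<le> m" for n m y
      by (rule cinner_ext_left) (simp add: adj up[OF that])
    have w_eq: "\<exists>y. w n s = blinfun_apply (r n s) y" for n
      unfolding w_def x_def by (metis blinfun.scaleR_right)
    have w_norm: "norm (w n s) = 1" if "Q s n" for n
    proof -
      have "\<exists>i. blinfun_apply (r n s) (d i) \<noteq> 0"
      proof (rule ccontr)
        assume "\<not> (\<exists>i. blinfun_apply (r n s) (d i) \<noteq> 0)"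
        then have zero: "blinfun_apply (r n s) y = 0" if "y \<in> D" for y
          using that range_d by auto
        have "norm (blinfun_apply (r n s) y) \<le> 0" for y
          by (rule le_on_closure[OF _ _ D(2)]) (use zero in \<open>auto intro!: continuous_intros\<close>)
        then have "r n s = 0"
          by (intro blinfun_eqI) simp
        then show False
          using that by (simp add: r_def Q_def)
      qed
      then have "x n s \<noteq> 0"
        unfolding x_def j_def by (rule LeastI_ex)
      then show ?thesis
        by (simp add: w_def)
    qed
    have w_orth_less: "cinner (w n s) (w m s) = 0" if "n < m" for n m
    proof -
      obtain y z where y: "w n s = blinfun_apply (r n s) y" and z: "w m s = blinfun_apply (r m s) z"
        using w_eq by metis
      have "w n s = blinfun_apply (f (Suc n) s) (w n s)"
        by (simp add: y r_def blinfun.diff_left blinfun.diff_right up)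
      moreover have "blinfun_apply (f (Suc n) s) (w m s) = 0"
        using that by (simp add: z r_def blinfun.diff_left blinfun.diff_right down)
      ultimately show ?thesis
        by (metis adj cinner.zero_right)
    qed
    have w_orth: "cinner (w n s) (w m s) = 0" if "n \<noteq> m" for n m
      using w_orth_less[of n m] w_orth_less[of m n] that cinner_commute[of "w n s" "w m s"]
      by (metis complex_cnj_zero linorder_neqE_nat)
    have Q_N: "Q s (N k s)" for k
    proof (cases k)
      case 0
      then show ?thesis
        using inf[of 0] by (auto simp: N_0 intro: LeastI)
    next
      case (Suc l)
      obtain n where "n \<ge> Suc (N l s)" "Q s n" using inf by blast
      then have "Q s n \<and> N l s < n" by simp
      then show ?thesis
        unfolding Suc N_Suc by (rule LeastI2) simp
    qed
    have N_less: "N k s < N (Suc k) s" for k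
    proof -
      obtain n where "n \<ge> Suc (N k s)" "Q s n" using inf by blast
      then have "Q s n \<and> N k s < n" by simp
      then show ?thesis
        unfolding N_Suc by (rule LeastI2) simp
    qed
    then have "strict_mono (\<lambda>k. N k s)"
      by (simp add: strict_mono_Suc_iff)
    then have N_inj: "N k s = N l s \<longleftrightarrow> k = l" for k l
      by (rule strict_mono_eq)
    have "orthonormal (\<lambda>k. u k s)"
      unfolding orthonormal_def u_def
      using w_orth w_norm[OF Q_N] by (auto simp: N_inj cinner_self)
    moreover have "blinfun_apply (e s) (u k s) = u k s" for k
    proof -
      obtain y where y: "u k s = blinfun_apply (r (N k s) s) y"
        unfolding u_def using w_eq by blast
      show ?thesis
        by (simp add: y e_def r_def blinfun.diff_left blinfun.diff_right down)
    qed
    moreover have "e s o\<^sub>L e s = e s"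
      by (rule blinfun_eqI) (simp add: e_def blinfun.diff_left blinfun.diff_right up)
    moreover have "BH_adj (e s) = e s"
      by (rule BH_adj_eqI) (simp add: e_def blinfun.diff_left cinner.diff_left cinner.diff_right adj)
    ultimately show ?thesis by blast
  qed
  note fiberD = fiber[THEN conjunct1] fiber[THEN conjunct2, THEN conjunct1]
    fiber[THEN conjunct2, THEN conjunct2, THEN conjunct1]
    fiber[THEN conjunct2, THEN conjunct2, THEN conjunct2, rule_format]
  have u0: "norm (u 0 s) = 1" if "s \<in> space \<nu>" "B s" for s
  proof -
    have "complex_of_real ((norm (u 0 s))\<^sup>2) = 1"
      using orthonormal_cinner[OF fiberD(3)[OF that], of 0 0] by (simp add: cinner_self)
    then have "(norm (u 0 s))\<^sup>2 = 1\<^sup>2"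
      by (metis of_real_eq_1_iff one_power2)
    then show ?thesis
      using norm_ge_zero[of "u 0 s"] by (auto simp: power2_eq_1_iff)
  qed
  obtain C where C: "AE s in \<nu>. norm (e s) \<le> C"
    using e_field unfolding projection_field_def by blast
  define v where "v s = (if B s then shift_op (e s) (\<lambda>k. u k s) else e s)" for s
  have v: "v \<in> L0wo_functions \<nu>"
  proof (rule L0woI)
    show "v s \<in> BH" if "s \<in> space \<nu>" for s
      using that L0wo_BH[OF e that] fiberD[OF that] by (auto simp: v_def intro: shift_op_in_BH)
    fix \<xi>
    have "(\<lambda>s. cinner \<xi> (u k s) *\<^sub>C u l s) \<in> borel_measurable \<nu>" for k l
      by (intro borel_measurable_scaleC borel_measurable_cinner borel_measurable_const u_meas)
    then have "(\<lambda>s. if B s then blinfun_apply (e s) \<xi> - (\<Sum>k. cinner \<xi> (u k s) *\<^sub>C u k s)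
        + (\<Sum>k. cinner \<xi> (u k s) *\<^sub>C u (Suc k) s) else blinfun_apply (e s) \<xi>) \<in> borel_measurable \<nu>"
      using B_pred by (intro measurable_If borel_measurable_add borel_measurable_diff borel_measurable_suminf
          L0wo_apply_const[OF e]) (simp_all add: pred_def)
    also have "?this \<longleftrightarrow> (\<lambda>s. blinfun_apply (v s) \<xi>) \<in> borel_measurable \<nu>"
    proof (rule measurable_cong)
      fix s assume s: "s \<in> space \<nu>"
      show "(if B s then blinfun_apply (e s) \<xi> - (\<Sum>k. cinner \<xi> (u k s) *\<^sub>C u k s)
        + (\<Sum>k. cinner \<xi> (u k s) *\<^sub>C u (Suc k) s) else blinfun_apply (e s) \<xi>) = blinfun_apply (v s) \<xi>"
        using fiberD(3)[OF s] orthonormal_Suc[OF fiberD(3)[OF s]]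
        by (simp add: v_def shift_op_def blinfun.add_left blinfun.diff_left carry_apply)
    qed
    finally show "(\<lambda>s. blinfun_apply (v s) \<xi>) \<in> borel_measurable \<nu>" .
  qed
  have v_le: "AE s in \<nu>. norm (v s) \<le> C + 2"
    using C AE_space
  proof eventually_elim
    case (elim s)
    show ?case
    proof (cases "B s")
      case True
      then show ?thesis
        using norm_shift_op_le[OF fiberD(3)[OF elim(2) True], of "e s"] elim(1) by (simp add: v_def)
    qed (use elim in \<open>simp add: v_def\<close>)
  qed
  note av = L0wo_adj[OF v]
  have av_le: "AE s in \<nu>. norm (BH_adj (v s)) \<le> C + 2"
    using v_le AE_space by eventually_elim (rule order_trans[OF norm_BH_adj_le[OF L0wo_BH[OF v]]])
  \<comment> \<open>the field of range projections of \<open>v\<close>\<close>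
  define q where "q s = (if B s then e s - rank_one (u 0 s) (u 0 s) else e s)" for s
  have v_av: "AE s in \<nu>. BH_adj (v s) o\<^sub>L v s = e s \<and> v s o\<^sub>L BH_adj (v s) = q s"
    using projection_field_AE[OF e_field] AE_space
  proof eventually_elim
    case (elim s)
    show ?case
    proof (cases "B s")
      case True
      then show ?thesis
        using shift_op_isometry[OF L0wo_BH[OF e elim(2)] fiberD[OF elim(2) True]]
          shift_op_range[OF L0wo_BH[OF e elim(2)] fiberD[OF elim(2) True]]
        by (simp add: v_def q_def)
    qed (use elim in \<open>simp add: v_def q_def\<close>)
  qed
  have q_proj: "AE s in \<nu>. q s o\<^sub>L q s = q s \<and> BH_adj (q s) = q s \<and> e s o\<^sub>L q s = q s"
    using projection_field_AE[OF e_field] AE_space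
  proof eventually_elim
    case (elim s)
    show ?case
    proof (cases "B s")
      case True
      then show ?thesis
        using projection_minus_rank_one[OF L0wo_BH[OF e elim(2)] fiberD(1,2)[OF elim(2) True]
            fiberD(4)[OF elim(2) True, of 0] u0[OF elim(2) True]]
        by (simp add: q_def)
    qed (use elim in \<open>simp add: q_def\<close>)
  qed
  have q: "q \<in> L0wo_functions \<nu>"
  proof (rule L0woI)
    show "q s \<in> BH" if "s \<in> space \<nu>" for s
      using L0wo_BH[OF e that] by (auto simp: q_def intro: BH_diff rank_one_in_BH)
    fix \<xi>
    have "(\<lambda>s. if B s then blinfun_apply (e s) \<xi> - cinner \<xi> (u 0 s) *\<^sub>C u 0 s else blinfun_apply (e s) \<xi>) \<in> borel_measurable \<nu>"
      using B_pred by (intro measurable_If borel_measurable_diff borel_measurable_scaleC borel_measurable_cinner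
          borel_measurable_const u_meas L0wo_apply_const[OF e]) (simp add: pred_def)
    also have "(\<lambda>s. if B s then blinfun_apply (e s) \<xi> - cinner \<xi> (u 0 s) *\<^sub>C u 0 s else blinfun_apply (e s) \<xi>)
        = (\<lambda>s. blinfun_apply (q s) \<xi>)"
      by (auto simp: q_def blinfun.diff_left rank_one_apply)
    finally show "(\<lambda>s. blinfun_apply (q s) \<xi>) \<in> borel_measurable \<nu>" .
  qed
  have "AE s in \<nu>. norm (q s) \<le> (C + 2) * (C + 2)"
    using v_av v_le av_le
  proof eventually_elim
    case (elim s)
    have "norm (q s) \<le> norm (v s) * norm (BH_adj (v s))"
      using norm_blinfun_compose[of "v s" "BH_adj (v s)"] elim by simp
    also have "\<dots> \<le> (C + 2) * (C + 2)"
    proof (rule mult_mono)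
      show "0 \<le> C + 2"
        using elim(2) norm_ge_zero[of "v s"] by linarith
    qed (use elim in auto)
    finally show ?case .
  qed
  then have q_field: "projection_field \<nu> q"
    using q_proj by (intro projection_fieldI[OF q]) (auto elim: eventually_mono)
  have perp: "proj_perp (L2_space \<nu>) (mult_operator \<nu> (f 0)) = mult_operator \<nu> e"
    unfolding e_def[abs_def] by (rule proj_perp_mult_operator[OF f projection_field_bounded[OF p]])
  have "proj_equiv (L2_space \<nu>) (Linf_tensor_BH \<nu>) (mult_operator \<nu> e) (mult_operator \<nu> q)"
    unfolding proj_equiv_def
  proof (intro bexI conjI)
    show "mult_operator \<nu> v \<in> Linf_tensor_BH \<nu>"
      by (rule mult_operator_in_Linf_tensor_BH[OF sf v v_le])
    have "mult_operator \<nu> v O mult_operator \<nu> (\<lambda>s. BH_adj (v s)) = mult_operator \<nu> (\<lambda>s. BH_adj (v s) o\<^sub>L v s)"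
      by (rule mult_operator_comp[OF av v mult_operator_bounded[OF v v_le]])
    also have "\<dots> = mult_operator \<nu> e"
      using v_av by (intro mult_operator_cong L0wo_compose av v e) (auto elim: eventually_mono)
    finally show "mult_operator \<nu> v O op_adj (L2_space \<nu>) (mult_operator \<nu> v) = mult_operator \<nu> e"
      unfolding mult_operator_adj[OF v] .
    have "mult_operator \<nu> (\<lambda>s. BH_adj (v s)) O mult_operator \<nu> v = mult_operator \<nu> (\<lambda>s. v s o\<^sub>L BH_adj (v s))"
      by (rule mult_operator_comp[OF v av mult_operator_bounded[OF av av_le]])
    also have "\<dots> = mult_operator \<nu> q"
      using v_av by (intro mult_operator_cong L0wo_compose av v q) (auto elim: eventually_mono)
    finally show "op_adj (L2_space \<nu>) (mult_operator \<nu> v) O mult_operator \<nu> v = mult_operator \<nu> q"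
      unfolding mult_operator_adj[OF v] .
  qed
  moreover have "proj_le (mult_operator \<nu> q) (mult_operator \<nu> e)"
    unfolding proj_le_projection_field[OF sf q_field e_field] using q_proj by (auto elim: eventually_mono)
  moreover have "mult_operator \<nu> q \<in> projections (L2_space \<nu>) (Linf_tensor_BH \<nu>)"
    by (rule projection_field_in_projections(1)[OF sf q_field])
  ultimately have "mult_operator \<nu> q = mult_operator \<nu> e"
    using fin unfolding perp finite_projection_def by blast
  then have "AE s in \<nu>. q s = e s"
    by (rule mult_operator_inject[OF sf q e])
  then have "AE s in \<nu>. \<not> B s"
    using AE_space
  proof eventually_elim
    case (elim s)
    show ?case
    proof
      assume B: "B s"
      then have "rank_one (u 0 s) (u 0 s) = 0"
        using elim(1) by (simp add: q_def)
      then have "cinner (u 0 s) (u 0 s) *\<^sub>C u 0 s = 0"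
        by (metis rank_one_apply blinfun.zero_left)
      then show False
        using u0[OF elim(2) B] by (simp add: cinner_self)
    qed
  qed
  then show ?thesis
    using AE_good by eventually_elim (auto simp: B_def)
qed

section \<open>Multiplication operators are locally measurable\<close>

lemma finite_projection_zero:
  fixes \<nu> :: "'s measure"
  assumes sf: "sigma_finite_measure \<nu>"
  shows "finite_projection (L2_space \<nu>) (Linf_tensor_BH \<nu>)
    (mult_operator \<nu> (\<lambda>s. 0 :: 'h::{complex_hilbert, second_countable_topology} \<Rightarrow>\<^sub>L 'h))"
  unfolding finite_projection_def
proof (intro conjI ballI impI)
  have zero: "projection_field \<nu> (\<lambda>s. 0 :: 'h \<Rightarrow>\<^sub>L 'h)"
    using projection_field_indicator[where P = "\<lambda>s. False"] by simp
  then show "mult_operator \<nu> (\<lambda>s. 0 :: 'h \<Rightarrow>\<^sub>L 'h) \<in> projections (L2_space \<nu>) (Linf_tensor_BH \<nu>)"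
    by (rule projection_field_in_projections(1)[OF sf])
  fix q :: "('s \<Rightarrow> 'h) set operator"
  assume q: "q \<in> projections (L2_space \<nu>) (Linf_tensor_BH \<nu>)"
    and le: "proj_le q (mult_operator \<nu> (\<lambda>s. 0 :: 'h \<Rightarrow>\<^sub>L 'h))"
  obtain g where g: "projection_field \<nu> g" "q = mult_operator \<nu> g"
    by (rule projections_cases[OF sf q order_refl])
  have "AE s in \<nu>. g s = 0"
    using le unfolding g(2) proj_le_projection_field[OF sf g(1) zero] by (auto elim: eventually_mono)
  then show "q = mult_operator \<nu> (\<lambda>s. 0 :: 'h \<Rightarrow>\<^sub>L 'h)"
    unfolding g(2) by (intro mult_operator_cong projection_field_L0wo g(1) zero)
qed

lemma mult_operator_closed_dense_affiliated:
  fixes f :: "'s \<Rightarrow> 'h::{complex_hilbert, second_countable_topology} \<Rightarrow>\<^sub>L 'h"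
  assumes sf: "sigma_finite_measure \<nu>" and f: "f \<in> L0wo_functions \<nu>"
  shows "closed_dense_affiliated (L2_space \<nu>) (Linf_tensor_BH \<nu>) (mult_operator \<nu> f)"
  unfolding closed_dense_affiliated_def
  by (intro conjI mult_operator_affiliated[OF sf f] mult_operator_closed[OF f] mult_operator_densely_defined[OF f])

lemma bounded_mult_operator_measurable:
  fixes f :: "'s \<Rightarrow> 'h::{complex_hilbert, second_countable_topology} \<Rightarrow>\<^sub>L 'h"
  assumes sf: "sigma_finite_measure \<nu>" and f: "f \<in> L0wo_functions \<nu>" and le: "AE s in \<nu>. norm (f s) \<le> C"
  shows "mult_operator \<nu> f \<in> measurable_operators (L2_space \<nu>) (Linf_tensor_BH \<nu>)"
proof -
  let ?p = "\<lambda>n::nat. mult_operator \<nu> (\<lambda>s. id_blinfun :: 'h \<Rightarrow>\<^sub>L 'h)"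
  have id: "projection_field \<nu> (\<lambda>s. id_blinfun :: 'h \<Rightarrow>\<^sub>L 'h)"
    using projection_field_indicator[where P = "\<lambda>s. True"] by simp
  note bdd = projection_field_bounded[OF id]
  have "increases_to_one (L2_space \<nu>) ?p"
    using increases_to_one_indicator[OF sf, of "\<lambda>n s. True"] unfolding indicator_op_def by simp
  moreover have "Range (?p n) \<subseteq> Domain (mult_operator \<nu> f)" for n
    using mult_operator_carrier[of \<nu> "\<lambda>s. id_blinfun :: 'h \<Rightarrow>\<^sub>L 'h"]
      bounded_operators_Domain[OF mult_operator_bounded[OF f le]] by auto
  moreover have "finite_projection (L2_space \<nu>) (Linf_tensor_BH \<nu>) (proj_perp (L2_space \<nu>) (?p n))" for n
    using finite_projection_zero[OF sf] by (simp add: proj_perp_mult_operator[OF projection_field_L0wo[OF id] bdd])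
  ultimately show ?thesis
    unfolding measurable_operators_def
    using mult_operator_closed_dense_affiliated[OF sf f] projection_field_in_projections(1)[OF sf id]
    by (intro CollectI conjI exI[of _ ?p] allI)
qed

lemma indicator_op_projection_center:
  assumes P: "Measurable.pred \<nu> P"
  shows "(indicator_op \<nu> P :: ('s \<Rightarrow> 'h::{complex_hilbert, second_countable_topology}) set operator)
    \<in> projections (L2_space \<nu>) (center (L2_space \<nu>) (Linf_tensor_BH \<nu>))"
  using indicator_op_in_center[OF P, where 'h = 'h] projection_field_bounded[OF projection_field_indicator[OF P, where 'h = 'h]]
    projection_bounded_operator[OF projection_field_indicator[OF P, where 'h = 'h]]
  by (simp add: projections_def indicator_op_def)

text \<open>
  The central projections onto the sets where \<open>norm (f s) \<le> n\<close> cut \<open>f\<close> down to bounded fields,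
  which are measurable with the constant sequence 1.
\<close>

theorem mult_operator_locally_measurable:
  fixes f :: "'s \<Rightarrow> 'h::{complex_hilbert, second_countable_topology} \<Rightarrow>\<^sub>L 'h"
  assumes sf: "sigma_finite_measure \<nu>" and f: "f \<in> L0wo_functions \<nu>"
  shows "mult_operator \<nu> f \<in> locally_measurable_operators (L2_space \<nu>) (Linf_tensor_BH \<nu>)"
proof -
  define P where "P n s \<longleftrightarrow> norm (f s) \<le> real n" for n s
  have P: "Measurable.pred \<nu> (P n)" for n
    unfolding P_def[abs_def] using L0wo_norm[OF f] by measurable
  let ?p = "\<lambda>n. indicator_op \<nu> (P n) :: ('s \<Rightarrow> 'h) set operator"
  have "increases_to_one (L2_space \<nu>) ?p"
  proof (rule increases_to_one_indicator[OF sf P])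
    show "P n s \<Longrightarrow> P (Suc n) s" for n s
      by (simp add: P_def)
    show "AE s in \<nu>. eventually (\<lambda>n. P n s) sequentially"
      unfolding P_def by (rule AE_bounded_levels)
  qed
  moreover have "?p n O mult_operator \<nu> f \<in> measurable_operators (L2_space \<nu>) (Linf_tensor_BH \<nu>)" for n
  proof -
    have eq: "?p n O mult_operator \<nu> f = mult_operator \<nu> (\<lambda>s. f s o\<^sub>L (if P n s then id_blinfun else 0))"
      unfolding indicator_op_def
      by (rule mult_operator_comp[OF f indicator_L0wo(1)[OF P] projection_field_bounded[OF projection_field_indicator[OF P]]])
    have "AE s in \<nu>. norm (f s o\<^sub>L (if P n s then id_blinfun else 0)) \<le> real n"
      by (auto simp: P_def)
    then show ?thesis
      unfolding eq by (rule bounded_mult_operator_measurable[OF sf L0wo_compose[OF f indicator_L0wo(1)[OF P]]])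
  qed
  ultimately show ?thesis
    unfolding locally_measurable_operators_def
    using mult_operator_closed_dense_affiliated[OF sf f] indicator_op_projection_center[OF P]
    by (intro CollectI conjI exI[of _ ?p] allI)
qed

section \<open>Locally measurable operators are multiplication operators\<close>

lemma operator_eqI:
  assumes "x \<subseteq> y" "single_valued y" "Domain y \<subseteq> Domain x"
  shows "x = y"
proof
  show "y \<subseteq> x"
  proof (rule subrelI)
    fix a b assume ab: "(a, b) \<in> y"
    then obtain c where c: "(a, c) \<in> x"
      using assms(3) by blast
    then have "b = c"
      using assms(1) ab by (intro single_valuedD[OF assms(2), of a]) auto
    with c show "(a, b) \<in> x" by simp
  qed
qed (rule assms(1))

lemma linear_operator_comp:
  assumes x: "linear_operator K x" and y: "linear_operator K y"
  shows "linear_operator K (x O y)"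
proof -
  have add: "(a, b) \<in> z \<Longrightarrow> (a', b') \<in> z \<Longrightarrow> (hadd K a a', hadd K b b') \<in> z"
    and scale: "(a, b) \<in> z \<Longrightarrow> (hscale K c a, hscale K c b) \<in> z"
    and zero: "(hzero K, hzero K) \<in> z"
    and sub: "z \<subseteq> hcarrier K \<times> hcarrier K" and single: "single_valued z"
    if "linear_operator K z" for z a b a' b' c
    using that by (auto simp: linear_operator_def)
  show ?thesis
    unfolding linear_operator_def
  proof (intro conjI allI impI)
    show "x O y \<subseteq> hcarrier K \<times> hcarrier K"
      using sub[OF x] sub[OF y] by blast
    show "single_valued (x O y)"
      by (rule single_valued_relcomp[OF single[OF x] single[OF y]])
    show "(hzero K, hzero K) \<in> x O y"
      using zero[OF x] zero[OF y] by (rule relcompI)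
    show "(hadd K a a', hadd K b b') \<in> x O y" if ab: "(a, b) \<in> x O y" "(a', b') \<in> x O y" for a b a' b'
    proof -
      obtain c c' where "(a, c) \<in> x" "(c, b) \<in> y" "(a', c') \<in> x" "(c', b') \<in> y"
        using ab by (elim relcompEpair)
      then show ?thesis
        by (intro relcompI[OF add[OF x] add[OF y]])
    qed
    show "(hscale K c a, hscale K c b) \<in> x O y" if ab: "(a, b) \<in> x O y" for c a b
    proof -
      obtain d where "(a, d) \<in> x" "(d, b) \<in> y"
        using ab by (elim relcompEpair)
      then show ?thesis
        by (intro relcompI[OF scale[OF x] scale[OF y]])
    qed
  qed
qed

text \<open>A central projection is given by scalars with \<open>c\<^sup>2 = c\<close>.\<close>

lemma central_projection_cases:
  fixes p :: "('s \<Rightarrow> 'h::{complex_hilbert, second_countable_topology}) set operator"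
  assumes sf: "sigma_finite_measure \<nu>" and p: "p \<in> projections (L2_space \<nu>) (center (L2_space \<nu>) (Linf_tensor_BH \<nu>))"
  obtains f where "projection_field \<nu> f" "p = mult_operator \<nu> f" "AE s in \<nu>. f s = 0 \<or> f s = id_blinfun"
proof -
  obtain f where f: "projection_field \<nu> f" "p = mult_operator \<nu> f"
    by (rule projections_cases[OF sf p]) (auto simp: center_def)
  have "p \<in> commutant (L2_space \<nu>) (elementary_tensors \<nu>)"
    using p by (simp add: projections_def center_def commutant_Linf_tensor_BH)
  then obtain \<phi> where \<phi>: "\<phi> \<in> borel_measurable \<nu>" "p = mult_operator \<nu> (\<lambda>s. BH_scale (\<phi> s) id_blinfun)"
    by (rule commutant_elementary_tensors[OF sf])
  have "AE s in \<nu>. f s = BH_scale (\<phi> s) id_blinfun"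
    using f(2) \<phi>(2)
    by (intro mult_operator_inject[OF sf projection_field_L0wo[OF f(1)] L0wo_scale[OF \<phi>(1) L0wo_const[OF BH_id]]]) simp
  then have "AE s in \<nu>. f s = 0 \<or> f s = id_blinfun"
    using projection_field_AE[OF f(1)]
  proof eventually_elim
    case (elim s)
    have fs: "blinfun_apply (f s) x = \<phi> s *\<^sub>C x" for x
      by (simp add: elim(1) BH_scale_apply)
    show ?case
    proof (cases "\<phi> s = 0")
      case True
      then have "f s = 0"
        by (intro blinfun_eqI) (simp add: fs scaleC.zero_left)
      then show ?thesis ..
    next
      case False
      have "\<phi> s *\<^sub>C x = x" for x :: 'h
      proof -
        have "blinfun_apply (f s o\<^sub>L f s) x = blinfun_apply (f s) x"
          using elim(2) by simp
        then have "(1 / \<phi> s) *\<^sub>C \<phi> s *\<^sub>C \<phi> s *\<^sub>C x = (1 / \<phi> s) *\<^sub>C \<phi> s *\<^sub>C x"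
          by (simp add: fs)
        then show ?thesis
          using False by (simp add: scaleC_scaleC)
      qed
      then have "f s = id_blinfun"
        by (intro blinfun_eqI) (simp add: fs)
      then show ?thesis ..
    qed
  qed
  with f show thesis by (rule that)
qed

text \<open>
  Take the points where the central projection number \<open>n\<close> and the projection number \<open>m\<close> that
  belongs to it are both the identity. A function supported there is fixed by both, so it lies in
  a range that is contained in the domain. Both kinds of projections reach the identity at almost
  every point.
\<close>

lemma locally_measurable_domain:
  fixes x :: "('s \<Rightarrow> 'h::{complex_hilbert, second_countable_topology}) set operator"
  assumes sf: "sigma_finite_measure \<nu>"
    and x: "x \<in> locally_measurable_operators (L2_space \<nu>) (Linf_tensor_BH \<nu>)"
  obtains A :: "nat \<Rightarrow> nat \<Rightarrow> 's \<Rightarrow> bool"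
  where "\<forall>n m. Measurable.pred \<nu> (A n m)" "AE s in \<nu>. \<exists>n m. A n m s"
    "\<forall>n m. \<forall>F\<in>L2_functions \<nu>. (\<forall>s. F s \<noteq> 0 \<longrightarrow> A n m s) \<longrightarrow> L2_class \<nu> F \<in> Domain x"
proof -
  let ?K = "L2_space \<nu> :: ('s \<Rightarrow> 'h) set hilbert_space"
  let ?M = "Linf_tensor_BH \<nu> :: ('s \<Rightarrow> 'h) set operator set"
  obtain p where p: "\<And>n. p n \<in> projections ?K (center ?K ?M)" and p_inc: "increases_to_one ?K p"
    and px: "\<And>n. p n O x \<in> measurable_operators ?K ?M"
    using x unfolding locally_measurable_operators_def by blast
  have "\<forall>n. \<exists>f. projection_field \<nu> f \<and> p n = mult_operator \<nu> f \<and> (AE s in \<nu>. f s = 0 \<or> f s = id_blinfun)"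
    using central_projection_cases[OF sf p] by blast
  then obtain c where c: "\<And>n. projection_field \<nu> (c n)" and p_eq: "\<And>n. p n = mult_operator \<nu> (c n)"
    and c01: "\<And>n. AE s in \<nu>. c n s = 0 \<or> c n s = id_blinfun"
    by metis
  have p_fun: "p = (\<lambda>n. mult_operator \<nu> (c n))"
    using p_eq by auto
  have "AE s in \<nu>. \<forall>n. c n s = 0 \<or> c n s = id_blinfun"
    unfolding AE_all_countable using c01 by blast
  then have c_ex: "AE s in \<nu>. \<exists>n. c n s = id_blinfun"
    using increasing_projections_not_stationary[OF sf c p_inc[unfolded p_fun]]
    by eventually_elim metis
  have "\<forall>n. \<exists>q. (\<forall>m. q m \<in> projections ?K ?M) \<and> increases_to_one ?K q \<and>
      (\<forall>m. Range (q m) \<subseteq> Domain (p n O x) \<and> finite_projection ?K ?M (proj_perp ?K (q m)))"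
    using px unfolding measurable_operators_def by blast
  then obtain q where q: "\<And>n m. q n m \<in> projections ?K ?M" and q_inc: "\<And>n. increases_to_one ?K (q n)"
    and q_dom: "\<And>n m. Range (q n m) \<subseteq> Domain (p n O x)"
    and q_fin: "\<And>n m. finite_projection ?K ?M (proj_perp ?K (q n m))"
    by metis
  have "\<forall>n m. \<exists>f. projection_field \<nu> f \<and> q n m = mult_operator \<nu> f"
    using projections_cases[OF sf q order_refl] by blast
  then obtain g where g: "\<And>n m. projection_field \<nu> (g n m)" and q_eq: "\<And>n m. q n m = mult_operator \<nu> (g n m)"
    by metis
  have q_fun: "q n = (\<lambda>m. mult_operator \<nu> (g n m))" for n
    using q_eq by auto
  have "AE s in \<nu>. \<exists>m. g n m s = id_blinfun" for n
    by (rule finite_perp_exhausts[OF sf g q_inc[of n, unfolded q_fun] q_fin[of n 0, unfolded q_eq]])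
  then have g_ex: "AE s in \<nu>. \<forall>n. \<exists>m. g n m s = id_blinfun"
    unfolding AE_all_countable by blast
  define A where "A n m s \<longleftrightarrow> c n s = id_blinfun \<and> g n m s = id_blinfun" for n m s
  show thesis
  proof (rule that[of A])
    show "\<forall>n m. Measurable.pred \<nu> (A n m)"
      unfolding A_def[abs_def]
      by (intro allI pred_intros_logic L0wo_eq_pred projection_field_L0wo c g L0wo_const BH_id)
    show "AE s in \<nu>. \<exists>n m. A n m s"
      using c_ex g_ex by eventually_elim (auto simp: A_def)
    show "\<forall>n m. \<forall>F\<in>L2_functions \<nu>. (\<forall>s. F s \<noteq> 0 \<longrightarrow> A n m s) \<longrightarrow> L2_class \<nu> F \<in> Domain x"
    proof (intro allI ballI impI)
      fix n m and F :: "'s \<Rightarrow> 'h"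
      assume F: "F \<in> L2_functions \<nu>" and supp: "\<forall>s. F s \<noteq> 0 \<longrightarrow> A n m s"
      have fixed: "F s = blinfun_apply (c n s) (F s)" "F s = blinfun_apply (g n m s) (F s)" for s
        using supp[rule_format, of s] by (cases "F s = 0"; simp add: A_def)+
      have pF: "(L2_class \<nu> F, L2_class \<nu> F) \<in> p n"
        unfolding p_eq using fixed(1) by (simp add: mult_operator_iff[OF projection_field_L0wo[OF c] F F])
      have "(L2_class \<nu> F, L2_class \<nu> F) \<in> q n m"
        unfolding q_eq using fixed(2) by (simp add: mult_operator_iff[OF projection_field_L0wo[OF g] F F])
      then have "L2_class \<nu> F \<in> Domain (p n O x)"
        using q_dom by blast
      then obtain b where b: "(L2_class \<nu> F, b) \<in> p n" "b \<in> Domain x"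
        by blast
      have "single_valued (p n)"
        using mult_operator_linear[OF projection_field_L0wo[OF c]] unfolding p_eq linear_operator_def by blast
      then have "b = L2_class \<nu> F"
        using b(1) pF by (blast dest: single_valuedD)
      with b(2) show "L2_class \<nu> F \<in> Domain x" by simp
    qed
  qed
qed

text \<open>
  On each set of such a partition the operator is everywhere defined, hence bounded by the closed
  graph theorem and decomposable; the pieces are glued, and closedness recovers the domain.
\<close>

theorem locally_measurable_is_mult_operator:
  fixes x :: "('s \<Rightarrow> 'h::{complex_hilbert, second_countable_topology}) set operator"
  assumes sf: "sigma_finite_measure \<nu>"
    and x: "x \<in> locally_measurable_operators (L2_space \<nu>) (Linf_tensor_BH \<nu>)"
  obtains f where "f \<in> L0wo_functions \<nu>" "x = mult_operator \<nu> f"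
proof -
  let ?K = "L2_space \<nu> :: ('s \<Rightarrow> 'h) set hilbert_space"
  have lin: "linear_operator ?K x" and aff: "\<And>y. y \<in> commutant ?K (Linf_tensor_BH \<nu>) \<Longrightarrow> x O y \<subseteq> y O x"
    and closed: "closed_operator ?K x"
    using x unfolding locally_measurable_operators_def closed_dense_affiliated_def affiliated_def by blast+
  have x_carrier: "x \<subseteq> hcarrier ?K \<times> hcarrier ?K" and x_single: "single_valued x"
    using lin unfolding linear_operator_def by blast+
  obtain A :: "nat \<Rightarrow> nat \<Rightarrow> 's \<Rightarrow> bool" where A: "\<forall>n m. Measurable.pred \<nu> (A n m)" "AE s in \<nu>. \<exists>n m. A n m s"
    "\<forall>n m. \<forall>F\<in>L2_functions \<nu>. (\<forall>s. F s \<noteq> 0 \<longrightarrow> A n m s) \<longrightarrow> L2_class \<nu> F \<in> Domain x"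
    by (rule locally_measurable_domain[OF sf x])
  define A' where "A' k = A (fst (prod_decode k)) (snd (prod_decode k))" for k
  have A': "Measurable.pred \<nu> (A' k)" for k
    unfolding A'_def using A(1) by blast
  \<comment> \<open>disjoint pieces\<close>
  define P where "P k s \<longleftrightarrow> A' k s \<and> (\<forall>i\<in>{..<k}. \<not> A' i s)" for k s
  have P: "Measurable.pred \<nu> (P k)" for k
    unfolding P_def[abs_def] by (intro pred_intros_logic measurable_pred_countable(1) A') auto
  have P_unique: "k = l" if "P k s" "P l s" for k l s
    using that unfolding P_def by (metis lessThan_iff linorder_neqE_nat)
  have P_ex: "AE s in \<nu>. \<exists>k. P k s"
    using A(2)
  proof eventually_elim
    case (elim s)
    then obtain n m where "A n m s" by blast
    then have "A' (prod_encode (n, m)) s" by (simp add: A'_def)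
    then have "A' (LEAST k. A' k s) s" "\<forall>i<(LEAST k. A' k s). \<not> A' i s"
      by (rule LeastI) (auto dest: not_less_Least)
    then show ?case unfolding P_def by blast
  qed
  have P_dom: "L2_class \<nu> (\<lambda>s. if P k s then F s else 0) \<in> Domain x" if F: "F \<in> L2_functions \<nu>" for k and F :: "'s \<Rightarrow> 'h"
    by (rule A(3)[rule_format, OF L2_If(1)[OF F P], of k "fst (prod_decode k)" "snd (prod_decode k)"])
      (auto simp: P_def A'_def split: if_splits)
  define J where "J R = (indicator_op \<nu> R :: ('s \<Rightarrow> 'h) set operator)" for R
  have J_iff: "(L2_class \<nu> F, L2_class \<nu> G) \<in> J R \<longleftrightarrow> (AE s in \<nu>. G s = (if R s then F s else 0))"
    if "Measurable.pred \<nu> R" "F \<in> L2_functions \<nu>" "G \<in> L2_functions \<nu>" for R F G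
    using mult_operator_iff[OF indicator_L0wo(1)[OF that(1)] that(2,3)]
    by (simp add: J_def indicator_op_def if_distrib[of blinfun_apply] if_distribR cong: if_cong)
  have J_If: "(L2_class \<nu> F, L2_class \<nu> (\<lambda>s. if R s then F s else 0)) \<in> J R"
    if "Measurable.pred \<nu> R" "F \<in> L2_functions \<nu>" for R F
    by (simp add: J_iff[OF that L2_If(1)[OF that(2,1)]])
  have J_bdd: "J R \<in> bounded_operators ?K" if "Measurable.pred \<nu> R" for R
    unfolding J_def indicator_op_def by (rule projection_field_bounded[OF projection_field_indicator[OF that]])
  have J_single: "single_valued (J R)" if "Measurable.pred \<nu> R" for R
    using bounded_operators_linear[OF J_bdd[OF that]] unfolding linear_operator_def by blast
  have J_dest: "b = L2_class \<nu> (\<lambda>s. if R s then F s else 0)"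
    if "Measurable.pred \<nu> R" "F \<in> L2_functions \<nu>" "(L2_class \<nu> F, b) \<in> J R" for R F b
    using single_valuedD[OF J_single[OF that(1)] that(3) J_If[OF that(1,2)]] .
  have x_J: "x O J R \<subseteq> J R O x" if "Measurable.pred \<nu> R" for R
    unfolding J_def
    by (rule aff) (simp add: commutant_Linf_tensor_BH indicator_op_in_commutant[OF that])
  have J_J: "J R O J R' = J R' O J R" if R: "Measurable.pred \<nu> R" and R': "Measurable.pred \<nu> R'" for R R'
    using indicator_op_in_commutant[OF R, where 'h = 'h] indicator_op_in_elementary_tensors[OF R', where 'h = 'h]
    unfolding J_def commutant_def by blast
  define y where "y k = J (P k) O x" for k
  have y_iff: "(L2_class \<nu> F, b) \<in> y k \<longleftrightarrow> (L2_class \<nu> (\<lambda>s. if P k s then F s else 0), b) \<in> x"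
    if F: "F \<in> L2_functions \<nu>" for k F b
    unfolding y_def using J_If[OF P F] J_dest[OF P F] by blast
  have y_dom: "Domain (y k) = hcarrier ?K" for k
  proof
    show "Domain (y k) \<subseteq> hcarrier ?K"
      unfolding y_def J_def indicator_op_def using mult_operator_carrier by blast
    show "hcarrier ?K \<subseteq> Domain (y k)"
    proof
      fix a assume "a \<in> hcarrier ?K"
      then obtain F where F: "F \<in> L2_functions \<nu>" "a = L2_class \<nu> F"
        by (auto simp: L2_carrier_iff)
      then show "a \<in> Domain (y k)"
        using P_dom[OF F(1), of k] y_iff[OF F(1)] by blast
    qed
  qed
  have y_carrier: "y k \<subseteq> hcarrier ?K \<times> hcarrier ?K" for k
    using y_dom[of k] x_carrier unfolding y_def by blast
  have y_lin: "linear_operator ?K (y k)" for k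
    unfolding y_def by (rule linear_operator_comp[OF bounded_operators_linear[OF J_bdd[OF P]] lin])
  have y_closed: "closed_operator ?K (y k)" for k
    unfolding closed_operator_def
  proof (rule subrelI)
    fix a b assume "(a, b) \<in> op_closure ?K (y k)"
    then obtain F G U V where FG: "F \<in> L2_functions \<nu>" "G \<in> L2_functions \<nu>" "a = L2_class \<nu> F" "b = L2_class \<nu> G"
      and U: "\<And>n. U n \<in> L2_functions \<nu>" and V: "\<And>n. V n \<in> L2_functions \<nu>"
      and UV: "\<And>n. (L2_class \<nu> (U n), L2_class \<nu> (V n)) \<in> y k"
      and limU: "(\<lambda>n. L2_norm \<nu> (\<lambda>s. U n s - F s)) \<longlonglongrightarrow> 0" and limV: "(\<lambda>n. L2_norm \<nu> (\<lambda>s. V n s - G s)) \<longlonglongrightarrow> 0"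
      using L2_op_closure_cases[OF y_carrier] by blast
    let ?cut = "\<lambda>W s. if P k s then W s else 0 :: 'h"
    have "(\<lambda>n. L2_norm \<nu> (\<lambda>s. ?cut (U n) s - ?cut F s)) \<longlonglongrightarrow> 0"
      by (rule L2_cut_tendsto[OF U FG(1) P limU])
    then have "(L2_class \<nu> (?cut F), L2_class \<nu> G) \<in> op_closure ?K x"
      using limV UV by (intro L2_op_closureI[where U = "\<lambda>n. ?cut (U n)" and V = V] L2_If(1) P U V FG(1,2))
        (simp_all add: y_iff[OF U])
    then show "(a, b) \<in> y k"
      using closed unfolding FG(3,4) y_iff[OF FG(1)] closed_operator_def by blast
  qed
  have y_bdd: "y k \<in> bounded_operators ?K" for k
    by (rule closed_graph_L2[OF y_lin y_closed y_dom])
  have y_comm: "J R O y k = y k O J R" if R: "Measurable.pred \<nu> R" for R k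
  proof (rule operator_eqI[symmetric])
    have "y k O J R = J (P k) O (x O J R)"
      by (auto simp: y_def)
    also have "\<dots> \<subseteq> J (P k) O (J R O x)"
      by (intro relcomp_mono order_refl x_J R)
    also have "\<dots> = (J (P k) O J R) O x"
      by (rule O_assoc[symmetric])
    also have "\<dots> = J R O y k"
      unfolding J_J[OF P R] y_def by (rule O_assoc)
    finally show "y k O J R \<subseteq> J R O y k" .
    show "single_valued (J R O y k)"
      using y_lin unfolding linear_operator_def by (intro single_valued_relcomp J_single R) blast
    have "Range (y k) \<subseteq> Domain (J R)"
      using y_carrier[of k] bounded_operators_Domain[OF J_bdd[OF R]] by blast
    then show "Domain (J R O y k) \<subseteq> Domain (y k O J R)"
      using y_dom[of k] bounded_operators_Domain[OF J_bdd[OF R]] by blast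
  qed
  have "\<exists>f C. f \<in> L0wo_functions \<nu> \<and> (\<forall>s. norm (f s) \<le> C) \<and> y k = mult_operator \<nu> f" for k
    using decomposable_operator[OF sf y_bdd[of k]] y_comm[unfolded J_def indicator_op_def] by metis
  then obtain g C where g: "\<And>k. g k \<in> L0wo_functions \<nu>" "\<And>k s. norm (g k s) \<le> C k" "\<And>k. y k = mult_operator \<nu> (g k)"
    by metis
  define k0 where "k0 s = (LEAST k. P k s)" for s
  have k0: "k0 s = k" if "P k s" for k s
    using P_unique[OF that LeastI[of "\<lambda>k. P k s", OF that]] by (simp add: k0_def)
  have k0_meas: "k0 \<in> measurable \<nu> (count_space UNIV)"
    unfolding k0_def[abs_def] by (intro measurable_Least P)
  define f where "f s = g (k0 s) s" for s
  have f: "f \<in> L0wo_functions \<nu>"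
  proof (rule L0woI)
    show "f s \<in> BH" if "s \<in> space \<nu>" for s
      unfolding f_def by (rule L0wo_BH[OF g(1) that])
    show "(\<lambda>s. blinfun_apply (f s) \<xi>) \<in> borel_measurable \<nu>" for \<xi>
      unfolding f_def by (rule measurable_compose_countable[OF _ k0_meas]) (rule L0wo_apply_const[OF g(1)])
  qed
  have sub: "x \<subseteq> mult_operator \<nu> f"
  proof (rule subrelI)
    fix a b assume ab: "(a, b) \<in> x"
    then have "a \<in> hcarrier ?K" "b \<in> hcarrier ?K"
      using x_carrier by blast+
    then obtain F G where F: "F \<in> L2_functions \<nu>" "a = L2_class \<nu> F" and G: "G \<in> L2_functions \<nu>" "b = L2_class \<nu> G"
      by (auto simp: L2_carrier_iff)
    have "AE s in \<nu>. P k s \<longrightarrow> G s = blinfun_apply (f s) (F s)" for k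
    proof -
      have "(L2_class \<nu> F, L2_class \<nu> (\<lambda>s. if P k s then G s else 0)) \<in> J (P k) O x"
        using x_J[OF P[of k]] ab J_If[OF P G(1), of k] unfolding F(2) G(2) by blast
      then have "AE s in \<nu>. (if P k s then G s else 0) = blinfun_apply (g k s) (F s)"
        unfolding y_def[symmetric] g(3) by (simp add: mult_operator_iff[OF g(1) F(1) L2_If(1)[OF G(1) P]])
      then show ?thesis
        by eventually_elim (auto simp: f_def k0)
    qed
    then have "AE s in \<nu>. \<forall>k. P k s \<longrightarrow> G s = blinfun_apply (f s) (F s)"
      by (intro AE_all_countable[THEN iffD2] allI)
    then have "AE s in \<nu>. G s = blinfun_apply (f s) (F s)"
      using P_ex by eventually_elim blast
    then show "(a, b) \<in> mult_operator \<nu> f"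
      unfolding F(2) G(2) by (simp add: mult_operator_iff[OF f F(1) G(1)])
  qed
  define U where "U n s \<longleftrightarrow> (\<exists>k\<in>{..<n}. P k s)" for n s
  have U: "Measurable.pred \<nu> (U n)" for n
    unfolding U_def[abs_def] by (intro measurable_pred_countable(2) P) auto
  have U_ev: "AE s in \<nu>. eventually (\<lambda>n. U n s) sequentially"
    using P_ex
  proof eventually_elim
    case (elim s)
    then obtain k where "P k s" by blast
    then have "U n s" if "n \<ge> Suc k" for n
      unfolding U_def using that by (intro bexI[of _ k]) auto
    then show ?case
      by (rule eventually_sequentiallyI)
  qed
  have "op_closure ?K x = mult_operator \<nu> f"
  proof (rule mult_operator_core[OF f sub U U_ev])
    fix F n assume F: "F \<in> L2_functions \<nu>" and fF: "(\<lambda>s. blinfun_apply (f s) (F s)) \<in> L2_functions \<nu>"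
    let ?G = "\<lambda>s. blinfun_apply (f s) (F s)"
    have piece: "(L2_class \<nu> (\<lambda>s. if P k s then F s else 0), L2_class \<nu> (\<lambda>s. if P k s then ?G s else 0)) \<in> x" for k
    proof -
      let ?F = "\<lambda>s. if P k s then F s else 0"
      let ?H = "\<lambda>s. blinfun_apply (g k s) (F s)"
      have F': "?F \<in> L2_functions \<nu>"
        by (rule L2_If(1)[OF F P])
      have H: "?H \<in> L2_functions \<nu>"
        by (rule L2_mult(1)[OF g(1) F]) (use g(2) in auto)
      have "(L2_class \<nu> F, L2_class \<nu> ?H) \<in> y k"
        unfolding g(3) by (simp add: mult_operator_iff[OF g(1) F H])
      then have "(L2_class \<nu> ?F, L2_class \<nu> ?H) \<in> x"
        by (simp add: y_iff[OF F])
      then have "(L2_class \<nu> ?F, L2_class \<nu> (\<lambda>s. if P k s then ?H s else 0)) \<in> y k"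
        using x_J[OF P[of k]] J_If[OF P H, of k] unfolding y_def by blast
      moreover have "(\<lambda>s. if P k s then ?H s else 0) = (\<lambda>s. if P k s then ?G s else 0)"
        by (auto simp: f_def k0)
      moreover have "(\<lambda>s. if P k s then ?F s else 0) = ?F"
        by auto
      ultimately show ?thesis
        by (simp add: y_iff[OF F'])
    qed
    show "(L2_class \<nu> (\<lambda>s. if U n s then F s else 0), L2_class \<nu> (\<lambda>s. if U n s then ?G s else 0)) \<in> x"
    proof (induction n)
      case 0
      show ?case
        using lin unfolding linear_operator_def by (simp add: U_def hzero_L2)
    next
      case (Suc n)
      have eq: "(\<lambda>s. (if U n s then H s else 0) + (if P n s then H s else 0)) = (\<lambda>s. if U (Suc n) s then H s else 0)"
        for H :: "'s \<Rightarrow> 'h"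
        using P_unique by (fastforce simp: U_def lessThan_Suc)
      show ?case
        using linear_operator_L2_add[OF lin L2_If(1)[OF F U] L2_If(1)[OF fF U] L2_If(1)[OF F P] L2_If(1)[OF fF P] Suc.IH piece[of n]]
        unfolding eq .
    qed
  qed
  then have "x = mult_operator \<nu> f"
    using closed sub unfolding closed_operator_def by blast
  with f show thesis by (rule that)
qed

section \<open>Strong operations on multiplication operators\<close>

lemma level_pred:
  fixes f :: "'s \<Rightarrow> 'h::{complex_hilbert, second_countable_topology} \<Rightarrow>\<^sub>L 'h"
  assumes "f \<in> L0wo_functions \<nu>"
  shows "Measurable.pred \<nu> (\<lambda>s. norm (f s) \<le> real n)"
  using L0wo_norm[OF assms] by measurable

lemma mult_operator_level:
  fixes f :: "'s \<Rightarrow> 'h::{complex_hilbert, second_countable_topology} \<Rightarrow>\<^sub>L 'h"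
  assumes f: "f \<in> L0wo_functions \<nu>" and F: "F \<in> L2_functions \<nu>" and P: "Measurable.pred \<nu> P"
    and le: "\<And>s. P s \<Longrightarrow> norm (f s) \<le> C"
  shows "(\<lambda>s. if P s then blinfun_apply (f s) (F s) else 0) \<in> L2_functions \<nu>"
    and "(L2_class \<nu> (\<lambda>s. if P s then F s else 0), L2_class \<nu> (\<lambda>s. if P s then blinfun_apply (f s) (F s) else 0))
      \<in> mult_operator \<nu> f"
proof -
  have eq: "(\<lambda>s. blinfun_apply (f s) (if P s then F s else 0)) = (\<lambda>s. if P s then blinfun_apply (f s) (F s) else 0)"
    by auto
  note cut = L2_If(1)[OF F P]
  show L2: "(\<lambda>s. if P s then blinfun_apply (f s) (F s) else 0) \<in> L2_functions \<nu>"
    using L2_mult_supported[OF f cut, of C] le unfolding eq by auto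
  show "(L2_class \<nu> (\<lambda>s. if P s then F s else 0), L2_class \<nu> (\<lambda>s. if P s then blinfun_apply (f s) (F s) else 0))
      \<in> mult_operator \<nu> f"
    unfolding mult_operator_iff[OF f cut L2] by (intro AE_I2) auto
qed

text \<open>
  For product, sum and scalar multiple alike, the algebraic operation is a restriction of the pointwise one and contains the
  truncations to the sets where the norms of the functions are at most \<open>n\<close>.
\<close>

lemma strong_product:
  fixes f g :: "'s \<Rightarrow> 'h::{complex_hilbert, second_countable_topology} \<Rightarrow>\<^sub>L 'h"
  assumes f: "f \<in> L0wo_functions \<nu>" and g: "g \<in> L0wo_functions \<nu>"
  shows "op_closure (L2_space \<nu>) (mult_operator \<nu> g O mult_operator \<nu> f) = mult_operator \<nu> (\<lambda>s. f s o\<^sub>L g s)"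
proof (rule mult_operator_core[where P = "\<lambda>n s. norm (f s) \<le> real n \<and> norm (g s) \<le> real n"])
  show "mult_operator \<nu> g O mult_operator \<nu> f \<subseteq> mult_operator \<nu> (\<lambda>s. f s o\<^sub>L g s)"
    by (rule mult_operator_comp_subset[OF f g])
  show P: "Measurable.pred \<nu> (\<lambda>s. norm (f s) \<le> real n \<and> norm (g s) \<le> real n)" for n
    by (intro pred_intros_logic level_pred f g)
  show "AE s in \<nu>. eventually (\<lambda>n. norm (f s) \<le> real n \<and> norm (g s) \<le> real n) sequentially"
    using AE_bounded_levels[where h = "\<lambda>s. norm (f s)"] AE_bounded_levels[where h = "\<lambda>s. norm (g s)"]
    by eventually_elim (rule eventually_conj)
  fix F :: "'s \<Rightarrow> 'h" and n assume F: "F \<in> L2_functions \<nu>"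
  let ?P = "\<lambda>s. norm (f s) \<le> real n \<and> norm (g s) \<le> real n"
  let ?G = "\<lambda>s. if ?P s then blinfun_apply (g s) (F s) else 0"
  have G: "?G \<in> L2_functions \<nu>" and 1: "(L2_class \<nu> (\<lambda>s. if ?P s then F s else 0), L2_class \<nu> ?G) \<in> mult_operator \<nu> g"
    using mult_operator_level[OF g F P, of n "real n"] by auto
  have "(L2_class \<nu> (\<lambda>s. if ?P s then ?G s else 0), L2_class \<nu> (\<lambda>s. if ?P s then blinfun_apply (f s) (?G s) else 0)) \<in> mult_operator \<nu> f"
    by (rule mult_operator_level(2)[OF f G P]) auto
  moreover have "(\<lambda>s. if ?P s then ?G s else 0) = ?G"
    "(\<lambda>s. if ?P s then blinfun_apply (f s) (?G s) else 0) = (\<lambda>s. if ?P s then blinfun_apply (f s o\<^sub>L g s) (F s) else 0)"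
    by auto
  ultimately have "(L2_class \<nu> ?G, L2_class \<nu> (\<lambda>s. if ?P s then blinfun_apply (f s o\<^sub>L g s) (F s) else 0)) \<in> mult_operator \<nu> f"
    by (simp only:)
  with 1 show "(L2_class \<nu> (\<lambda>s. if ?P s then F s else 0), L2_class \<nu> (\<lambda>s. if ?P s then blinfun_apply (f s o\<^sub>L g s) (F s) else 0))
      \<in> mult_operator \<nu> g O mult_operator \<nu> f"
    by (rule relcompI)
qed (rule L0wo_compose[OF f g])

lemma strong_sum:
  fixes f g :: "'s \<Rightarrow> 'h::{complex_hilbert, second_countable_topology} \<Rightarrow>\<^sub>L 'h"
  assumes f: "f \<in> L0wo_functions \<nu>" and g: "g \<in> L0wo_functions \<nu>"
  shows "op_closure (L2_space \<nu>) (op_add (L2_space \<nu>) (mult_operator \<nu> f) (mult_operator \<nu> g))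
    = mult_operator \<nu> (\<lambda>s. f s + g s)"
proof (rule mult_operator_core[where P = "\<lambda>n s. norm (f s) \<le> real n \<and> norm (g s) \<le> real n"])
  show "op_add (L2_space \<nu>) (mult_operator \<nu> f) (mult_operator \<nu> g) \<subseteq> mult_operator \<nu> (\<lambda>s. f s + g s)"
  proof (rule subrelI)
    fix a d assume "(a, d) \<in> op_add (L2_space \<nu>) (mult_operator \<nu> f) (mult_operator \<nu> g)"
    then obtain b c where b: "(a, b) \<in> mult_operator \<nu> f" and c: "(a, c) \<in> mult_operator \<nu> g" and d: "d = hadd (L2_space \<nu>) b c"
      unfolding op_add_def by blast
    obtain F G where F: "F \<in> L2_functions \<nu>" "G \<in> L2_functions \<nu>" "a = L2_class \<nu> F" "b = L2_class \<nu> G"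
      "AE s in \<nu>. G s = blinfun_apply (f s) (F s)"
      by (rule mult_operator_cases_AE[OF b])
    have "c \<in> hcarrier (L2_space \<nu>)"
      using c mult_operator_carrier by blast
    then obtain H where H: "H \<in> L2_functions \<nu>" "c = L2_class \<nu> H"
      by (auto simp: L2_carrier_iff)
    have "AE s in \<nu>. H s = blinfun_apply (g s) (F s)"
      using c unfolding F(3) H(2) by (simp add: mult_operator_iff[OF g F(1) H(1)])
    then have "AE s in \<nu>. G s + H s = blinfun_apply (f s + g s) (F s)"
      using F(5) by eventually_elim (simp add: blinfun.add_left)
    then show "(a, d) \<in> mult_operator \<nu> (\<lambda>s. f s + g s)"
      unfolding d F(3,4) H(2) hadd_L2[OF F(2) H(1)]
      by (simp add: mult_operator_iff[OF L0wo_add[OF f g] F(1) L2_add[OF F(2) H(1)]])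
  qed
  show P: "Measurable.pred \<nu> (\<lambda>s. norm (f s) \<le> real n \<and> norm (g s) \<le> real n)" for n
    by (intro pred_intros_logic level_pred f g)
  show "AE s in \<nu>. eventually (\<lambda>n. norm (f s) \<le> real n \<and> norm (g s) \<le> real n) sequentially"
    using AE_bounded_levels[where h = "\<lambda>s. norm (f s)"] AE_bounded_levels[where h = "\<lambda>s. norm (g s)"]
    by eventually_elim (rule eventually_conj)
  fix F :: "'s \<Rightarrow> 'h" and n assume F: "F \<in> L2_functions \<nu>"
  let ?P = "\<lambda>s. norm (f s) \<le> real n \<and> norm (g s) \<le> real n"
  let ?G = "\<lambda>s. if ?P s then blinfun_apply (f s) (F s) else 0"
  let ?H = "\<lambda>s. if ?P s then blinfun_apply (g s) (F s) else 0"
  have G: "?G \<in> L2_functions \<nu>" and 1: "(L2_class \<nu> (\<lambda>s. if ?P s then F s else 0), L2_class \<nu> ?G) \<in> mult_operator \<nu> f"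
    using mult_operator_level[OF f F P, of n "real n"] by auto
  have H: "?H \<in> L2_functions \<nu>" and 2: "(L2_class \<nu> (\<lambda>s. if ?P s then F s else 0), L2_class \<nu> ?H) \<in> mult_operator \<nu> g"
    using mult_operator_level[OF g F P, of n "real n"] by auto
  have "(\<lambda>s. ?G s + ?H s) = (\<lambda>s. if ?P s then blinfun_apply (f s + g s) (F s) else 0)"
    by (auto simp: blinfun.add_left)
  then have eq: "hadd (L2_space \<nu>) (L2_class \<nu> ?G) (L2_class \<nu> ?H)
      = L2_class \<nu> (\<lambda>s. if ?P s then blinfun_apply (f s + g s) (F s) else 0)"
    by (simp only: hadd_L2[OF G H])
  from 1 2 show "(L2_class \<nu> (\<lambda>s. if ?P s then F s else 0), L2_class \<nu> (\<lambda>s. if ?P s then blinfun_apply (f s + g s) (F s) else 0))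
      \<in> op_add (L2_space \<nu>) (mult_operator \<nu> f) (mult_operator \<nu> g)"
    unfolding op_add_def eq[symmetric] by blast
qed (rule L0wo_add[OF f g])

lemma strong_scale:
  fixes f :: "'s \<Rightarrow> 'h::{complex_hilbert, second_countable_topology} \<Rightarrow>\<^sub>L 'h"
  assumes f: "f \<in> L0wo_functions \<nu>"
  shows "op_closure (L2_space \<nu>) (op_scale (L2_space \<nu>) c (mult_operator \<nu> f)) = mult_operator \<nu> (\<lambda>s. BH_scale c (f s))"
proof -
  have cf: "(\<lambda>s. BH_scale c (f s)) \<in> L0wo_functions \<nu>"
    by (intro L0wo_scale borel_measurable_const f)
  show ?thesis
  proof (rule mult_operator_core[OF cf, where P = "\<lambda>n s. norm (f s) \<le> real n"])
    show "op_scale (L2_space \<nu>) c (mult_operator \<nu> f) \<subseteq> mult_operator \<nu> (\<lambda>s. BH_scale c (f s))"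
    proof (rule subrelI)
      fix a d assume "(a, d) \<in> op_scale (L2_space \<nu>) c (mult_operator \<nu> f)"
      then obtain b where b: "(a, b) \<in> mult_operator \<nu> f" and d: "d = hscale (L2_space \<nu>) c b"
        unfolding op_scale_def by blast
      obtain F G where F: "F \<in> L2_functions \<nu>" "G \<in> L2_functions \<nu>" "a = L2_class \<nu> F" "b = L2_class \<nu> G"
        "AE s in \<nu>. G s = blinfun_apply (f s) (F s)"
        by (rule mult_operator_cases_AE[OF b])
      have "AE s in \<nu>. c *\<^sub>C G s = blinfun_apply (BH_scale c (f s)) (F s)"
        using F(5) by eventually_elim (simp add: BH_scale_apply)
      then show "(a, d) \<in> mult_operator \<nu> (\<lambda>s. BH_scale c (f s))"
        unfolding d F(3,4) hscale_L2[OF F(2)] by (simp add: mult_operator_iff[OF cf F(1) L2_scale[OF F(2)]])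
    qed
    show P: "Measurable.pred \<nu> (\<lambda>s. norm (f s) \<le> real n)" for n
      by (rule level_pred[OF f])
    show "AE s in \<nu>. eventually (\<lambda>n. norm (f s) \<le> real n) sequentially"
      by (rule AE_bounded_levels)
    fix F :: "'s \<Rightarrow> 'h" and n assume F: "F \<in> L2_functions \<nu>"
    let ?P = "\<lambda>s. norm (f s) \<le> real n"
    let ?G = "\<lambda>s. if ?P s then blinfun_apply (f s) (F s) else 0"
    have G: "?G \<in> L2_functions \<nu>" and 1: "(L2_class \<nu> (\<lambda>s. if ?P s then F s else 0), L2_class \<nu> ?G) \<in> mult_operator \<nu> f"
      using mult_operator_level[OF f F P, of n "real n"] by auto
    have "(\<lambda>s. c *\<^sub>C ?G s) = (\<lambda>s. if ?P s then blinfun_apply (BH_scale c (f s)) (F s) else 0)"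
      by (auto simp: BH_scale_apply scaleC.zero_right)
    then have eq: "hscale (L2_space \<nu>) c (L2_class \<nu> ?G) = L2_class \<nu> (\<lambda>s. if ?P s then blinfun_apply (BH_scale c (f s)) (F s) else 0)"
      by (simp only: hscale_L2[OF G])
    from 1 show "(L2_class \<nu> (\<lambda>s. if ?P s then F s else 0), L2_class \<nu> (\<lambda>s. if ?P s then blinfun_apply (BH_scale c (f s)) (F s) else 0))
        \<in> op_scale (L2_space \<nu>) c (mult_operator \<nu> f)"
      unfolding op_scale_def eq[symmetric] by blast
  qed
qed

section \<open>The *-algebra structures\<close>

lemma unital_star_algebraI:
  fixes A :: "('a, 'm) star_algebra_scheme" (structure)
  assumes add: "\<And>x y. x \<in> carrier A \<Longrightarrow> y \<in> carrier A \<Longrightarrow> x \<oplus> y \<in> carrier A"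
      "\<And>x y z. x \<in> carrier A \<Longrightarrow> y \<in> carrier A \<Longrightarrow> z \<in> carrier A \<Longrightarrow> (x \<oplus> y) \<oplus> z = x \<oplus> (y \<oplus> z)"
      "\<And>x y. x \<in> carrier A \<Longrightarrow> y \<in> carrier A \<Longrightarrow> x \<oplus> y = y \<oplus> x"
    and zero: "\<zero> \<in> carrier A" "\<And>x. x \<in> carrier A \<Longrightarrow> \<zero> \<oplus> x = x"
      "\<And>x. x \<in> carrier A \<Longrightarrow> \<exists>y\<in>carrier A. y \<oplus> x = \<zero>"
    and mult: "\<And>x y. x \<in> carrier A \<Longrightarrow> y \<in> carrier A \<Longrightarrow> x \<otimes> y \<in> carrier A"
      "\<And>x y z. x \<in> carrier A \<Longrightarrow> y \<in> carrier A \<Longrightarrow> z \<in> carrier A \<Longrightarrow> (x \<otimes> y) \<otimes> z = x \<otimes> (y \<otimes> z)"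
      "\<And>x y z. x \<in> carrier A \<Longrightarrow> y \<in> carrier A \<Longrightarrow> z \<in> carrier A \<Longrightarrow> (x \<oplus> y) \<otimes> z = x \<otimes> z \<oplus> y \<otimes> z"
      "\<And>x y z. x \<in> carrier A \<Longrightarrow> y \<in> carrier A \<Longrightarrow> z \<in> carrier A \<Longrightarrow> z \<otimes> (x \<oplus> y) = z \<otimes> x \<oplus> z \<otimes> y"
    and one: "\<one> \<in> carrier A" "\<And>x. x \<in> carrier A \<Longrightarrow> \<one> \<otimes> x = x" "\<And>x. x \<in> carrier A \<Longrightarrow> x \<otimes> \<one> = x"
    and smult: "\<And>c x. x \<in> carrier A \<Longrightarrow> c \<odot> x \<in> carrier A"
      "\<And>c d x. x \<in> carrier A \<Longrightarrow> (c + d) \<odot> x = c \<odot> x \<oplus> d \<odot> x"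
      "\<And>c x y. x \<in> carrier A \<Longrightarrow> y \<in> carrier A \<Longrightarrow> c \<odot> (x \<oplus> y) = c \<odot> x \<oplus> c \<odot> y"
      "\<And>c d x. x \<in> carrier A \<Longrightarrow> (c * d) \<odot> x = c \<odot> (d \<odot> x)"
      "\<And>x. x \<in> carrier A \<Longrightarrow> 1 \<odot> x = x"
      "\<And>c x y. x \<in> carrier A \<Longrightarrow> y \<in> carrier A \<Longrightarrow> (c \<odot> x) \<otimes> y = c \<odot> (x \<otimes> y)"
      "\<And>c x y. x \<in> carrier A \<Longrightarrow> y \<in> carrier A \<Longrightarrow> x \<otimes> (c \<odot> y) = c \<odot> (x \<otimes> y)"
    and star: "\<And>x. x \<in> carrier A \<Longrightarrow> star A x \<in> carrier A"
      "\<And>x. x \<in> carrier A \<Longrightarrow> star A (star A x) = x"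
      "\<And>x y. x \<in> carrier A \<Longrightarrow> y \<in> carrier A \<Longrightarrow> star A (x \<oplus> y) = star A x \<oplus> star A y"
      "\<And>c x. x \<in> carrier A \<Longrightarrow> star A (c \<odot> x) = cnj c \<odot> star A x"
      "\<And>x y. x \<in> carrier A \<Longrightarrow> y \<in> carrier A \<Longrightarrow> star A (x \<otimes> y) = star A y \<otimes> star A x"
  shows "unital_star_algebra A"
proof -
  have grp: "abelian_group A"
    by (rule abelian_groupI) (fact add zero)+
  have mon: "monoid A"
    by (rule monoidI) (fact mult one)+
  have ring: "ring A"
    by (rule ringI[OF grp mon]) (fact mult)+
  have module: "module (ring_of_type_algebra :: complex ring) A"
    by (rule moduleI[OF cring_from_type_algebra grp]) (simp_all add: ring_of_type_algebra_def smult)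
  show ?thesis
    by (intro unital_star_algebra.intro ring module unital_star_algebra_axioms.intro) (fact smult star)+
qed

text \<open>A bijection compatible with all operations carries the axioms over to its target.\<close>

lemma unital_star_isomorphismI:
  fixes A :: "('a, 'm) star_algebra_scheme" and B :: "('b, 'n) star_algebra_scheme"
  assumes A: "unital_star_algebra A" and bij: "bij_betw h (carrier A) (carrier B)"
    and mult: "\<And>x y. x \<in> carrier A \<Longrightarrow> y \<in> carrier A \<Longrightarrow> h (x \<otimes>\<^bsub>A\<^esub> y) = h x \<otimes>\<^bsub>B\<^esub> h y"
    and add: "\<And>x y. x \<in> carrier A \<Longrightarrow> y \<in> carrier A \<Longrightarrow> h (x \<oplus>\<^bsub>A\<^esub> y) = h x \<oplus>\<^bsub>B\<^esub> h y"
    and one: "h \<one>\<^bsub>A\<^esub> = \<one>\<^bsub>B\<^esub>" and zero: "h \<zero>\<^bsub>A\<^esub> = \<zero>\<^bsub>B\<^esub>"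
    and smult: "\<And>c x. x \<in> carrier A \<Longrightarrow> h (c \<odot>\<^bsub>A\<^esub> x) = c \<odot>\<^bsub>B\<^esub> h x"
    and star: "\<And>x. x \<in> carrier A \<Longrightarrow> h (star A x) = star B (h x)"
  shows "unital_star_isomorphism A B h"
proof -
  interpret R: ring A by (rule unital_star_algebra.axioms(1)[OF A])
  interpret A: unital_star_algebra A by (rule A)
  have carrier: "carrier B = h ` carrier A"
    using bij by (simp add: bij_betw_def)
  have smult_closed: "c \<odot>\<^bsub>A\<^esub> x \<in> carrier A" if "x \<in> carrier A" for c x
    using A.smult_closed[OF _ that, of c] by (simp add: ring_of_type_algebra_def)
  have smult_l: "(c + d) \<odot>\<^bsub>A\<^esub> x = c \<odot>\<^bsub>A\<^esub> x \<oplus>\<^bsub>A\<^esub> d \<odot>\<^bsub>A\<^esub> x" if "x \<in> carrier A" for c d x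
    using A.smult_l_distr[OF _ _ that, of c d] by (simp add: ring_of_type_algebra_def)
  have smult_r: "c \<odot>\<^bsub>A\<^esub> (x \<oplus>\<^bsub>A\<^esub> y) = c \<odot>\<^bsub>A\<^esub> x \<oplus>\<^bsub>A\<^esub> c \<odot>\<^bsub>A\<^esub> y" if "x \<in> carrier A" "y \<in> carrier A" for c x y
    using A.smult_r_distr[OF _ that, of c] by (simp add: ring_of_type_algebra_def)
  have smult_assoc: "(c * d) \<odot>\<^bsub>A\<^esub> x = c \<odot>\<^bsub>A\<^esub> (d \<odot>\<^bsub>A\<^esub> x)" if "x \<in> carrier A" for c d x
    using A.smult_assoc1[OF _ _ that, of c d] by (simp add: ring_of_type_algebra_def)
  have smult_1: "1 \<odot>\<^bsub>A\<^esub> x = x" if "x \<in> carrier A" for x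
    using A.smult_one[OF that] by (simp add: ring_of_type_algebra_def)
  note ops = mult[symmetric] add[symmetric] one[symmetric] zero[symmetric] smult[symmetric] star[symmetric]
    smult_closed A.star_closed
  have "unital_star_algebra B"
  proof (rule unital_star_algebraI)
    show "\<exists>y\<in>carrier B. y \<oplus>\<^bsub>B\<^esub> x = \<zero>\<^bsub>B\<^esub>" if x: "x \<in> carrier B" for x
    proof -
      obtain a where a: "a \<in> carrier A" "x = h a"
        using x by (auto simp: carrier)
      then have "h (\<ominus>\<^bsub>A\<^esub> a) \<oplus>\<^bsub>B\<^esub> x = \<zero>\<^bsub>B\<^esub>"
        by (simp add: ops R.l_neg)
      then show ?thesis
        using a by (auto simp: carrier)
    qed
    show "x \<oplus>\<^bsub>B\<^esub> y = y \<oplus>\<^bsub>B\<^esub> x" if "x \<in> carrier B" "y \<in> carrier B" for x y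
      using that by (auto simp: carrier ops R.a_comm)
  qed (auto simp: carrier ops R.a_assoc R.m_assoc R.l_distr R.r_distr smult_l smult_r smult_assoc smult_1
      A.smult_mult_left A.smult_mult_right A.star_star A.star_add A.star_smult A.star_mult)
  moreover have "h \<in> ring_iso A B"
    unfolding ring_iso_def
    by (intro CollectI conjI bij) (auto intro!: ring_hom_memI simp: mult add one carrier)
  ultimately show ?thesis
    unfolding unital_star_isomorphism_def using A smult star by blast
qed

lemma L0wo_class_cong:
  "f \<in> L0wo_functions \<nu> \<Longrightarrow> g \<in> L0wo_functions \<nu> \<Longrightarrow> (\<And>s. s \<in> space \<nu> \<Longrightarrow> f s = g s) \<Longrightarrow>
    L0wo_class \<nu> f = L0wo_class \<nu> g"
  by (simp add: ae_class_eq_iff)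

lemma L0wo_carrier_iff: "a \<in> carrier (L0wo_algebra \<nu>) \<longleftrightarrow> (\<exists>f\<in>L0wo_functions \<nu>. a = L0wo_class \<nu> f)"
  unfolding L0wo_algebra_def by (auto intro: ae_class_in elim: ae_class_cases)

lemma L0wo_class_in: "f \<in> L0wo_functions \<nu> \<Longrightarrow> L0wo_class \<nu> f \<in> carrier (L0wo_algebra \<nu>)"
  by (auto simp: L0wo_carrier_iff)

lemma L0wo_carrier_cases:
  assumes "a \<in> carrier (L0wo_algebra \<nu>)"
  obtains f where "f \<in> L0wo_functions \<nu>" "a = L0wo_class \<nu> f"
  using assms by (auto simp: L0wo_carrier_iff)

lemma
  fixes f g :: "'s \<Rightarrow> 'h::{complex_hilbert, second_countable_topology} \<Rightarrow>\<^sub>L 'h"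
  assumes f: "f \<in> L0wo_functions \<nu>" and g: "g \<in> L0wo_functions \<nu>"
  shows L0wo_class_mult: "L0wo_class \<nu> f \<otimes>\<^bsub>L0wo_algebra \<nu>\<^esub> L0wo_class \<nu> g = L0wo_class \<nu> (\<lambda>s. f s o\<^sub>L g s)"
    and L0wo_class_add: "L0wo_class \<nu> f \<oplus>\<^bsub>L0wo_algebra \<nu>\<^esub> L0wo_class \<nu> g = L0wo_class \<nu> (\<lambda>s. f s + g s)"
  unfolding L0wo_algebra_def
  using AE_rep[OF f, of \<nu>] AE_rep[OF g, of \<nu>]
  by (auto simp: ae_class_eq_iff L0wo_compose L0wo_add rep_in f g elim: eventually_elim2)

lemma
  fixes f :: "'s \<Rightarrow> 'h::{complex_hilbert, second_countable_topology} \<Rightarrow>\<^sub>L 'h"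
  assumes f: "f \<in> L0wo_functions \<nu>"
  shows L0wo_class_smult: "c \<odot>\<^bsub>L0wo_algebra \<nu>\<^esub> L0wo_class \<nu> f = L0wo_class \<nu> (\<lambda>s. BH_scale c (f s))"
    and L0wo_class_star: "star (L0wo_algebra \<nu>) (L0wo_class \<nu> f) = L0wo_class \<nu> (\<lambda>s. BH_adj (f s))"
  unfolding L0wo_algebra_def
  using AE_rep[OF f, of \<nu>]
  by (auto simp: ae_class_eq_iff L0wo_scale L0wo_adj rep_in f elim: eventually_mono)

lemma L0wo_class_one: "\<one>\<^bsub>L0wo_algebra \<nu>\<^esub> = L0wo_class \<nu> (\<lambda>s. id_blinfun)"
  and L0wo_class_zero: "\<zero>\<^bsub>L0wo_algebra \<nu>\<^esub> = L0wo_class \<nu> (\<lambda>s. 0)"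
  by (simp_all add: L0wo_algebra_def)

lemma BH_scale_add_left: "BH_scale (c + d) a = BH_scale c a + BH_scale d a"
  and BH_scale_add_right: "BH_scale c (a + b) = BH_scale c a + BH_scale c b"
  and BH_scale_scale: "BH_scale (c * d) a = BH_scale c (BH_scale d a)"
  and BH_scale_one: "BH_scale 1 a = a"
  and BH_scale_compose_left: "BH_scale c a o\<^sub>L b = BH_scale c (a o\<^sub>L b)"
  and BH_scale_compose_right: "a \<in> BH \<Longrightarrow> a o\<^sub>L BH_scale c b = BH_scale c (a o\<^sub>L b)"
  by (rule blinfun_eqI; simp add: BH_scale_apply blinfun.add_left scaleC_add_left scaleC_add_right
      scaleC_scaleC BH_D)+

lemma BH_adj_add: "a \<in> BH \<Longrightarrow> b \<in> BH \<Longrightarrow> BH_adj (a + b) = BH_adj a + BH_adj b"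
  and BH_adj_scale: "a \<in> BH \<Longrightarrow> BH_adj (BH_scale c a) = BH_scale (cnj c) (BH_adj a)"
  and BH_adj_compose: "a \<in> BH \<Longrightarrow> b \<in> BH \<Longrightarrow> BH_adj (a o\<^sub>L b) = BH_adj b o\<^sub>L BH_adj a"
  by (rule BH_adj_eqI; simp add: blinfun.add_left cinner_add_left cinner_add_right BH_scale_apply
      cinner_scaleC_left cinner_scaleC_right cinner_BH_adj)+

lemma blinfun_compose_assoc: "(a o\<^sub>L b) o\<^sub>L c = a o\<^sub>L (b o\<^sub>L c)"
  and blinfun_compose_add_left: "(a + b) o\<^sub>L c = (a o\<^sub>L c) + (b o\<^sub>L c)"
  and blinfun_compose_add_right: "a o\<^sub>L (b + c) = (a o\<^sub>L b) + (a o\<^sub>L c)"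
  by (rule blinfun_eqI; simp add: blinfun.add_left blinfun.add_right)+

text \<open>Every axiom is an identity in B(H) at each point.\<close>

lemma unital_star_algebra_L0wo:
  "unital_star_algebra (L0wo_algebra \<nu> ::
    ('s \<Rightarrow> 'h::{complex_hilbert, second_countable_topology} \<Rightarrow>\<^sub>L 'h) set star_algebra)"
proof -
  note ops = L0wo_class_mult L0wo_class_add L0wo_class_smult L0wo_class_star L0wo_class_one L0wo_class_zero
  note closed = L0wo_add L0wo_compose L0wo_adj L0wo_scale L0wo_const BH_id BH_zero borel_measurable_const
  note fiber = BH_scale_add_left BH_scale_add_right BH_scale_scale BH_scale_one BH_scale_compose_left
    BH_scale_compose_right BH_adj_add BH_adj_scale BH_adj_compose BH_adj_adj L0wo_BH
    blinfun_compose_assoc blinfun_compose_add_left blinfun_compose_add_right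
  show ?thesis
  proof (rule unital_star_algebraI)
    fix x :: "('s \<Rightarrow> 'h \<Rightarrow>\<^sub>L 'h) set" assume "x \<in> carrier (L0wo_algebra \<nu>)"
    then obtain f where f: "f \<in> L0wo_functions \<nu>" "x = L0wo_class \<nu> f"
      by (auto simp: L0wo_carrier_iff)
    have neg: "(\<lambda>s. - f s) \<in> L0wo_functions \<nu>"
      using L0wo_diff[OF L0wo_const[OF BH_zero] f(1)] by simp
    show "\<exists>y\<in>carrier (L0wo_algebra \<nu>). y \<oplus>\<^bsub>L0wo_algebra \<nu>\<^esub> x = \<zero>\<^bsub>L0wo_algebra \<nu>\<^esub>"
      by (rule bexI[of _ "L0wo_class \<nu> (\<lambda>s. - f s)"])
        (use neg f in \<open>auto simp: ops intro: L0wo_class_in\<close>)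
  qed (auto simp: ops closed fiber add_ac elim!: L0wo_carrier_cases intro!: L0wo_class_in L0wo_class_cong del: equalityI subsetI)
qed

lemma x_op_class:
  fixes f :: "'s \<Rightarrow> 'h::{complex_hilbert, second_countable_topology} \<Rightarrow>\<^sub>L 'h"
  assumes "f \<in> L0wo_functions \<nu>"
  shows "x_op \<nu> (L0wo_class \<nu> f) = mult_operator \<nu> f"
  unfolding x_op_def by (intro mult_operator_cong rep_in AE_rep assms)

lemma op_zero_L2: "op_zero (L2_space \<nu>) =
  mult_operator \<nu> (\<lambda>s. 0 :: 'h::{complex_hilbert, second_countable_topology} \<Rightarrow>\<^sub>L 'h)"
proof (rule L2_operator_eqI[OF _ mult_operator_carrier])
  show "op_zero (L2_space \<nu>) \<subseteq> hcarrier (L2_space \<nu>) \<times> hcarrier (L2_space \<nu>)"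
    by (auto simp: op_zero_def hzero_L2)
  fix F G :: "'a \<Rightarrow> 'h" assume F: "F \<in> L2_functions \<nu>" and G: "G \<in> L2_functions \<nu>"
  show "(L2_class \<nu> F, L2_class \<nu> G) \<in> op_zero (L2_space \<nu>) \<longleftrightarrow>
      (L2_class \<nu> F, L2_class \<nu> G) \<in> mult_operator \<nu> (\<lambda>s. 0)"
    by (simp add: mult_operator_iff[OF L0wo_const[OF BH_zero] F G] op_zero_def hzero_L2 F L2_class_eq_iff[OF G L2_zero])
qed

theorem proposition6p3:
  fixes \<nu> :: "'s measure"
  assumes "sigma_finite_measure \<nu>" and "complete_measure \<nu>"
  shows "unital_star_isomorphism
    (L0wo_algebra \<nu> ::
      ('s \<Rightarrow> 'h::{complex_hilbert, second_countable_topology} \<Rightarrow>\<^sub>L 'h) set star_algebra)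
    (LS_algebra (L2_space \<nu>) (Linf_tensor_BH \<nu>))
    (x_op \<nu>)"
proof (rule unital_star_isomorphismI[OF unital_star_algebra_L0wo])
  note sf = assms(1)
  let ?A = "L0wo_algebra \<nu> :: ('s \<Rightarrow> 'h \<Rightarrow>\<^sub>L 'h) set star_algebra"
  let ?B = "LS_algebra (L2_space \<nu>) (Linf_tensor_BH \<nu>) :: ('s \<Rightarrow> 'h) set operator star_algebra"
  have A: "\<exists>f\<in>L0wo_functions \<nu>. x = L0wo_class \<nu> f" if "x \<in> carrier ?A" for x
    using that by (simp add: L0wo_carrier_iff)
  show "bij_betw (x_op \<nu>) (carrier ?A) (carrier ?B)"
  proof (rule bij_betwI')
    fix x y assume "x \<in> carrier ?A" "y \<in> carrier ?A"
    then obtain f g where f: "f \<in> L0wo_functions \<nu>" "x = L0wo_class \<nu> f" and g: "g \<in> L0wo_functions \<nu>" "y = L0wo_class \<nu> g"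
      using A by blast
    show "x_op \<nu> x = x_op \<nu> y \<longleftrightarrow> x = y"
      unfolding f(2) g(2) x_op_class[OF f(1)] x_op_class[OF g(1)] ae_class_eq_iff[OF f(1) g(1)]
      using mult_operator_inject[OF sf f(1) g(1)] mult_operator_cong[OF f(1) g(1)] by blast
  next
    fix x assume "x \<in> carrier ?A"
    then obtain f where f: "f \<in> L0wo_functions \<nu>" "x = L0wo_class \<nu> f"
      using A by blast
    then show "x_op \<nu> x \<in> carrier ?B"
      by (simp add: x_op_class LS_algebra_def mult_operator_locally_measurable[OF sf])
  next
    fix y assume "y \<in> carrier ?B"
    then have y: "y \<in> locally_measurable_operators (L2_space \<nu>) (Linf_tensor_BH \<nu>)"
      by (simp add: LS_algebra_def)
    obtain f where "f \<in> L0wo_functions \<nu>" "y = mult_operator \<nu> f"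
      by (rule locally_measurable_is_mult_operator[OF sf y])
    then show "\<exists>x\<in>carrier ?A. y = x_op \<nu> x"
      using x_op_class by (auto simp: L0wo_carrier_iff intro!: bexI[of _ "L0wo_class \<nu> f"])
  qed
  show "x_op \<nu> \<one>\<^bsub>?A\<^esub> = \<one>\<^bsub>?B\<^esub>"
    by (simp add: L0wo_class_one x_op_class[OF L0wo_const[OF BH_id]] LS_algebra_def op_one_L2)
  show "x_op \<nu> \<zero>\<^bsub>?A\<^esub> = \<zero>\<^bsub>?B\<^esub>"
    by (simp add: L0wo_class_zero x_op_class[OF L0wo_const[OF BH_zero]] LS_algebra_def op_zero_L2)
  fix x assume "x \<in> carrier ?A"
  then obtain f where f: "f \<in> L0wo_functions \<nu>" "x = L0wo_class \<nu> f"
    using A by blast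
  show "x_op \<nu> (c \<odot>\<^bsub>?A\<^esub> x) = c \<odot>\<^bsub>?B\<^esub> x_op \<nu> x" for c
    unfolding f(2) L0wo_class_smult[OF f(1)] x_op_class[OF f(1)] x_op_class[OF L0wo_scale[OF borel_measurable_const f(1)]]
    by (simp add: LS_algebra_def strong_scale[OF f(1)])
  show "x_op \<nu> (star ?A x) = star ?B (x_op \<nu> x)"
    unfolding f(2) L0wo_class_star[OF f(1)] x_op_class[OF f(1)] x_op_class[OF L0wo_adj[OF f(1)]]
    by (simp add: LS_algebra_def mult_operator_adj[OF f(1)])
  fix y assume "y \<in> carrier ?A"
  then obtain g where g: "g \<in> L0wo_functions \<nu>" "y = L0wo_class \<nu> g"
    using A by blast
  show "x_op \<nu> (x \<otimes>\<^bsub>?A\<^esub> y) = x_op \<nu> x \<otimes>\<^bsub>?B\<^esub> x_op \<nu> y"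
    unfolding f(2) g(2) L0wo_class_mult[OF f(1) g(1)] x_op_class[OF f(1)] x_op_class[OF g(1)]
      x_op_class[OF L0wo_compose[OF f(1) g(1)]]
    by (simp add: LS_algebra_def strong_product[OF f(1) g(1)])
  show "x_op \<nu> (x \<oplus>\<^bsub>?A\<^esub> y) = x_op \<nu> x \<oplus>\<^bsub>?B\<^esub> x_op \<nu> y"
    unfolding f(2) g(2) L0wo_class_add[OF f(1) g(1)] x_op_class[OF f(1)] x_op_class[OF g(1)]
      x_op_class[OF L0wo_add[OF f(1) g(1)]]
    by (simp add: LS_algebra_def strong_sum[OF f(1) g(1)])
qed

end
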